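(* Consider either of the test models (Layer Model with Fault or Channelized Model) with piecewise constant permeability, with prior $\mu_0$ on $u\in U$ satisfying $\mu_0(U)=1$. For $y,y'\in Y$ let $\mu,\mu'\ll\mu_0$ be the resulting posterior distributions, with $\frac{d\mu}{d\mu_0}(u)=\frac1Z\exp(-\Phi(u;y))$, $Z=\int_U\exp(-\Phi(u;y))\mu_0(du)$, and $\frac{d\mu'}{d\mu_0}(u)=\frac1{Z'}\exp(-\Phi(u;y'))$, $Z'=\int_U\exp(-\Phi(u;y'))\mu_0(du)$. Then: (i) for lognormal and uniform priors on the permeabilities $\kappa_i$: for every fixed $r>0$ there are constants $C_i=C_i(r)$, $i=1,2$, such that for all $y,y'\in Y$ with $\max\{|y|_\Gamma,|y'|_\Gamma\}<r$, $$d_{TV}(\mu,\mu')\le C_1|y-y'|_\Gamma,\qquad d_{Hell}(\mu,\mu')\le C_2|y-y'|_\Gamma;$$ (ii) for exponential priors on the permeabilities $\kappa_i$: for every fixed $r>0$ and $\iota\in(0,1)$ there are constants $K_i=K_i(r,\iota)$, $i=1,2$, such that for all $y,y'\in Y$ with $\max\{|y|_\Gamma,|y'|_\Gamma\}<r$, $$d_{TV}(\mu,\mu')\le K_1|y-y'|_\Gamma^{\iota},\qquad d_{Hell}(\mu,\mu')\le K_2|y-y'|_\Gamma^{\iota/2}.$$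
   Context: Let $D=(0,1)^2$ with points $(x,y)$, $V=H^1_0(D)$ with norm $\|p\|_V=\|\nabla p\|_{L^2(D)}$, $V^*$ its dual, and $X=\{g\in L^\infty(D;\mathbb{R}) : \operatorname{ess\,inf}_D g>0\}$. Fix $f\in V^*$. For $\kappa\in X$ let $G(\kappa)=p\in V$ be the unique weak solution of $-\nabla\cdot(\kappa\nabla p)=f$ in $D$, $p=0$ on $\partial D$. Let $L:V\to Y=\mathbb{R}^J$, $L(p)=(l_1(p),\dots,l_J(p))^T$ with fixed $l_j\in V^*$. The unknown is $u=(u_g,u_\kappa)\in U=U_g\times U_\kappa$, $F(u)=\kappa=\sum_{i=1}^n\kappa_i\chi_{D_i}$ where the $D_i$ are determined by $u_g$, and $\mathcal{G}=L\circ G\circ F:U\to Y$. $\Gamma$ is a symmetric positive definite $J\times J$ matrix, $|\cdot|_\Gamma=|\Gamma^{-1/2}\cdot|$, and $\Phi(u;y)=\frac12|y-\mathcal{G}(u)|_\Gamma^2$. Geometries. (1) Layer Model with Fault ($n\ge 2$ layers): $u_g=(a,b,c)\in U_g=A^2\times[-c^\star,c^\star]$ with $c^\star>0$ and $A=\{\mathbf{x}\in\mathbb{R}^{n-1}:\sum_{i=1}^{n-1}x_i\le1,\ x_i\ge0\}$. Here $a_i$ and $b_i$ are the thicknesses of layer $i$ at the right side $x=1$ and the left side $x=0$ of $D$, with layers numbered from top to bottom. For $1\le i\le n-1$ put $h_i(x)=\sum_{k=1}^i\big(b_k(1-x)+a_kx\big)$, and let the depth (distance below the top of $D$) of the interface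 between layers $i$ and $i+1$ be $S_i(x)=h_i(x)+c$ for $x<\frac12$ and $S_i(x)=h_i(x)$ for $x>\frac12$. With $S_0=-\infty$, $S_n=+\infty$, $D_i=\{(x,y)\in D: x\ne\frac12,\ S_{i-1}(x)<1-y<S_i(x)\}$. (2) Channelized Model ($n=2$): $u_g=(d_1,\dots,d_5)\in U_g=\prod_{i=1}^5[d_i^-,d_i^+]$, with $[d_3^-,d_3^+]\subset(-\pi/2,\pi/2)$ and $d_5^-\ge0$. $D_1=\{(x,y)\in D: g(x)<y<g(x)+d_5\}$, where $g(x)=d_1\sin(d_2x)+\tan(d_3)x+d_4$, and $D_2=D\setminus\overline{D_1}$. Piecewise constant permeability: $u_\kappa=(\kappa_1,\dots,\kappa_n)\in U_\kappa=(0,\infty)^n$. Prior: under $\mu_0$, $u_g$ is uniformly distributed on $U_g$ (so in the layer model $a,b,c$ are independent and uniform), and the $\kappa_i$ are independent of each other and of $u_g$. "Lognormal" means $\log\kappa_i\sim N(m_i,\sigma_i^2)$; "uniform" means $\kappa_i$ uniform on $[\kappa^{i,-},\kappa^{i,+}]$ with $\kappa^{i,-}>0$; "exponential" means $\kappa_i$ is exponential with parameter $\lambda_i>0$. Metrics: with $\nu$ any common reference measure dominating $\mu,\mu'$, $d_{Hell}(\mu,\mu')=\Big(\frac12\int_U\big(\sqrt{d\mu/d\nu}-\sqrt{d\mu'/d\nu}\big)^2d\nu\Big)^{1/2}$ and $d_{TV}(\mu,\mu')=\frac12\int_U\big|\frac{d\mu}{d\nu}-\frac{d\mu'}{d\nu}\big|d\nu$.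 *)

theory Defs
  imports "HOL-Probability.Probability" "HOL-Probability.Essential_Supremum"
begin

type_synonym point = "real \<times> real"

definition unit_square :: "point set" where
  "unit_square = {0<..<1} \<times> {0<..<1}"

abbreviation lebD :: "point measure" where
  "lebD \<equiv> restrict_space lborel unit_square"

primrec times_differentiable :: "nat \<Rightarrow> (point \<Rightarrow> real) \<Rightarrow> bool" where
  "times_differentiable 0 \<phi> \<longleftrightarrow> continuous_on UNIV \<phi>"
| "times_differentiable (Suc k) \<phi> \<longleftrightarrow>
     (\<forall>z. \<phi> differentiable (at z)) \<and>
     (\<forall>v. times_differentiable k (\<lambda>z. frechet_derivative \<phi> (at z) v))"

definition test_functions :: "(point \<Rightarrow> real) set" where
  "test_functions = {\<phi>. (\<forall>k. times_differentiable k \<phi>) \<and>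
     (\<exists>K. compact K \<and> K \<subseteq> unit_square \<and> (\<forall>z. z \<notin> K \<longrightarrow> \<phi> z = 0))}"

definition grad :: "(point \<Rightarrow> real) \<Rightarrow> point \<Rightarrow> point" where
  "grad \<phi> z = (frechet_derivative \<phi> (at z) (1, 0), frechet_derivative \<phi> (at z) (0, 1))"

text \<open>Members of \<open>L\<^sup>2\<close>, and hence of the spaces built on it, are Borel functions rather than
  classes modulo equality almost everywhere. Their values outside the square are irrelevant.\<close>

definition L2 :: "(point \<Rightarrow> 'b::euclidean_space) set" where
  "L2 = {p \<in> borel_measurable lebD. integrable lebD (\<lambda>z. (norm (p z))\<^sup>2)}"

definition L2_norm :: "(point \<Rightarrow> 'b::euclidean_space) \<Rightarrow> real" where
  "L2_norm p = sqrt (\<integral>z. (norm (p z))\<^sup>2 \<partial>lebD)"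

definition is_weak_grad :: "(point \<Rightarrow> real) \<Rightarrow> (point \<Rightarrow> point) \<Rightarrow> bool" where
  "is_weak_grad p g \<longleftrightarrow> g \<in> L2 \<and>
     (\<forall>\<phi>\<in>test_functions. (\<integral>z. p z *\<^sub>R grad \<phi> z \<partial>lebD) = - (\<integral>z. \<phi> z *\<^sub>R g z \<partial>lebD))"

text \<open>The weak gradient is determined only up to a null set; every use below is insensitive to the
  representative chosen.\<close>

definition weak_grad :: "(point \<Rightarrow> real) \<Rightarrow> point \<Rightarrow> point" where
  "weak_grad p = (SOME g. is_weak_grad p g)"

definition H1 :: "(point \<Rightarrow> real) set" where
  "H1 = {p \<in> L2. \<exists>g. is_weak_grad p g}"

definition H1_norm :: "(point \<Rightarrow> real) \<Rightarrow> real" where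
  "H1_norm p = sqrt ((L2_norm p)\<^sup>2 + (L2_norm (weak_grad p))\<^sup>2)"

definition V :: "(point \<Rightarrow> real) set" where
  "V = {p \<in> H1. \<forall>\<epsilon>>0. \<exists>\<phi>\<in>test_functions. H1_norm (\<lambda>z. p z - \<phi> z) < \<epsilon>}"

definition V_norm :: "(point \<Rightarrow> real) \<Rightarrow> real" where
  "V_norm p = L2_norm (weak_grad p)"

text \<open>Boundedness forces a functional to agree on functions that are equal almost everywhere.\<close>

definition V_dual :: "((point \<Rightarrow> real) \<Rightarrow> real) set" where
  "V_dual = {l. (\<forall>p\<in>V. \<forall>q\<in>V. l (\<lambda>z. p z + q z) = l p + l q) \<and>
     (\<forall>c. \<forall>p\<in>V. l (\<lambda>z. c * p z) = c * l p) \<and>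
     (\<exists>C. \<forall>p\<in>V. \<bar>l p\<bar> \<le> C * V_norm p)}"

text \<open>The second inequality says that the essential infimum, here minus the essential supremum
  of \<open>- \<kappa>\<close>, is positive.\<close>

definition coefficients :: "(point \<Rightarrow> real) set" where
  "coefficients = {\<kappa> \<in> borel_measurable lebD.
     esssup lebD (\<lambda>z. ereal \<bar>\<kappa> z\<bar>) < \<infinity> \<and> 0 < - esssup lebD (\<lambda>z. ereal (- \<kappa> z))}"

definition weak_solution ::
  "((point \<Rightarrow> real) \<Rightarrow> real) \<Rightarrow> (point \<Rightarrow> real) \<Rightarrow> (point \<Rightarrow> real) \<Rightarrow> bool" where
  "weak_solution f \<kappa> p \<longleftrightarrow> \<kappa> \<in> coefficients \<and> p \<in> V \<and>
     (\<forall>v\<in>V. (\<integral>z. \<kappa> z * (weak_grad p z \<bullet> weak_grad v z) \<partial>lebD) = f v)"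

definition solution_map ::
  "((point \<Rightarrow> real) \<Rightarrow> real) \<Rightarrow> (point \<Rightarrow> real) \<Rightarrow> point \<Rightarrow> real" where
  "solution_map f \<kappa> = (SOME p. weak_solution f \<kappa> p)"

definition permeability :: "nat \<Rightarrow> (nat \<Rightarrow> point set) \<Rightarrow> (nat \<Rightarrow> real) \<Rightarrow> point \<Rightarrow> real" where
  "permeability n R k z = (\<Sum>i=1..n. k i * indicator (R i) z)"

text \<open>The argument \<open>R\<close> sends the geometric parameter to the family of regions it determines.\<close>

definition forward_map ::
  "((point \<Rightarrow> real) \<Rightarrow> real) \<Rightarrow> ('j::finite \<Rightarrow> (point \<Rightarrow> real) \<Rightarrow> real) \<Rightarrow> nat \<Rightarrow>
   ('g \<Rightarrow> nat \<Rightarrow> point set) \<Rightarrow> 'g \<times> (nat \<Rightarrow> real) \<Rightarrow> real ^ 'j" where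
  "forward_map f l n R u =
     (\<chi> j. l j (solution_map f (permeability n (R (fst u)) (snd u))))"

definition sym_pos_def :: "real ^ 'j ^ 'j \<Rightarrow> bool" where
  "sym_pos_def A \<longleftrightarrow> transpose A = A \<and> (\<forall>x. x \<noteq> 0 \<longrightarrow> 0 < x \<bullet> (A *v x))"

definition inv_sqrt_matrix :: "real ^ 'j ^ 'j \<Rightarrow> real ^ 'j ^ 'j" where
  "inv_sqrt_matrix A = (THE B. sym_pos_def B \<and> B ** B = matrix_inv A)"

definition noise_norm :: "real ^ 'j ^ 'j \<Rightarrow> real ^ 'j \<Rightarrow> real" where
  "noise_norm \<Gamma> v = norm (inv_sqrt_matrix \<Gamma> *v v)"

definition misfit :: "real ^ 'j ^ 'j \<Rightarrow> ('u \<Rightarrow> real ^ 'j) \<Rightarrow> 'u \<Rightarrow> real ^ 'j \<Rightarrow> real" where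
  "misfit \<Gamma> G u y = (noise_norm \<Gamma> (y - G u))\<^sup>2 / 2"

text \<open>A vector indexed by \<open>1..m\<close> is an extensional function on that index set.\<close>

type_synonym layer_parameter = "(nat \<Rightarrow> real) \<times> (nat \<Rightarrow> real) \<times> real"

definition thickness_set :: "nat \<Rightarrow> (nat \<Rightarrow> real) set" where
  "thickness_set n = {x \<in> {1..n-1} \<rightarrow>\<^sub>E {0..}. (\<Sum>i=1..n-1. x i) \<le> 1}"

definition layer_parameters :: "nat \<Rightarrow> real \<Rightarrow> layer_parameter set" where
  "layer_parameters n cmax = thickness_set n \<times> thickness_set n \<times> {-cmax..cmax}"

fun interface_depth :: "nat \<Rightarrow> layer_parameter \<Rightarrow> nat \<Rightarrow> real \<Rightarrow> ereal" where
  "interface_depth n (a, b, c) i x =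
     (if i = 0 then -\<infinity>
      else if i = n then \<infinity>
      else ereal ((\<Sum>k=1..i. b k * (1 - x) + a k * x) + (if x < 1/2 then c else 0)))"

definition layer_region :: "nat \<Rightarrow> layer_parameter \<Rightarrow> nat \<Rightarrow> point set" where
  "layer_region n g i = {(x, y) \<in> unit_square. x \<noteq> 1/2 \<and>
     interface_depth n g (i - 1) x < ereal (1 - y) \<and> ereal (1 - y) < interface_depth n g i x}"

definition channel_parameters :: "(nat \<Rightarrow> real) \<Rightarrow> (nat \<Rightarrow> real) \<Rightarrow> (nat \<Rightarrow> real) set" where
  "channel_parameters dlo dhi = (\<Pi>\<^sub>E i\<in>{1..5}. {dlo i..dhi i})"

definition channel_curve :: "(nat \<Rightarrow> real) \<Rightarrow> real \<Rightarrow> real" where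
  "channel_curve d x = d 1 * sin (d 2 * x) + tan (d 3) * x + d 4"

definition channel :: "(nat \<Rightarrow> real) \<Rightarrow> point set" where
  "channel d = {(x, y) \<in> unit_square. channel_curve d x < y \<and> y < channel_curve d x + d 5}"

definition channel_region :: "(nat \<Rightarrow> real) \<Rightarrow> nat \<Rightarrow> point set" where
  "channel_region d i = (if i = 1 then channel d else unit_square - closure (channel d))"

definition lognormal_laws :: "nat \<Rightarrow> (nat \<Rightarrow> real measure) \<Rightarrow> bool" where
  "lognormal_laws n P \<longleftrightarrow> (\<exists>m \<sigma>. \<forall>i\<in>{1..n}. 0 < \<sigma> i \<and>
     P i = distr (density lborel (\<lambda>t. ennreal (normal_density (m i) (\<sigma> i) t))) borel exp)"

definition uniform_laws :: "nat \<Rightarrow> (nat \<Rightarrow> real measure) \<Rightarrow> bool" where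
  "uniform_laws n P \<longleftrightarrow> (\<exists>lo hi. \<forall>i\<in>{1..n}. 0 < lo i \<and> lo i < hi i \<and>
     P i = uniform_measure lborel {lo i..hi i})"

definition exponential_laws :: "nat \<Rightarrow> (nat \<Rightarrow> real measure) \<Rightarrow> bool" where
  "exponential_laws n P \<longleftrightarrow> (\<exists>r. \<forall>i\<in>{1..n}. 0 < r i \<and>
     P i = density lborel (\<lambda>t. ennreal (exponential_density (r i) t)))"

text \<open>Independence is expressed by product measures. The product lives on the ambient space of all
  real vectors and gives \<open>U\<^sub>g \<times> (0, \<infinity>)\<^sup>n\<close> full measure; restricting it to that set makes the
  parameter space the space of the prior.\<close>

definition prior :: "'g measure \<Rightarrow> 'g set \<Rightarrow> nat \<Rightarrow> (nat \<Rightarrow> real measure) \<Rightarrow>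
    ('g \<times> (nat \<Rightarrow> real)) measure" where
  "prior M Ug n P =
     restrict_space (uniform_measure M Ug \<Otimes>\<^sub>M PiM {1..n} P) (Ug \<times> ({1..n} \<rightarrow>\<^sub>E {0<..}))"

definition layer_prior :: "nat \<Rightarrow> real \<Rightarrow> (nat \<Rightarrow> real measure) \<Rightarrow>
    (layer_parameter \<times> (nat \<Rightarrow> real)) measure" where
  "layer_prior n cmax = prior
     (PiM {1..n-1} (\<lambda>_. lborel) \<Otimes>\<^sub>M PiM {1..n-1} (\<lambda>_. lborel) \<Otimes>\<^sub>M lborel)
     (layer_parameters n cmax) n"

definition channel_prior :: "(nat \<Rightarrow> real) \<Rightarrow> (nat \<Rightarrow> real) \<Rightarrow> (nat \<Rightarrow> real measure) \<Rightarrow>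
    ((nat \<Rightarrow> real) \<times> (nat \<Rightarrow> real)) measure" where
  "channel_prior dlo dhi = prior (PiM {1..5} (\<lambda>_. lborel)) (channel_parameters dlo dhi) 2"

definition posterior :: "'u measure \<Rightarrow> ('u \<Rightarrow> 'y \<Rightarrow> real) \<Rightarrow> 'y \<Rightarrow> 'u measure" where
  "posterior \<mu>0 \<Phi> y =
     density \<mu>0 (\<lambda>u. ennreal (exp (- \<Phi> u y) / (\<integral>w. exp (- \<Phi> w y) \<partial>\<mu>0)))"

text \<open>The distances do not depend on the dominating measure; they are stated with the reference
  measure as an explicit argument.\<close>

definition dominating :: "'u measure \<Rightarrow> 'u measure \<Rightarrow> 'u measure set" where
  "dominating M N = {\<nu>. sigma_finite_measure \<nu> \<and> sets \<nu> = sets M \<and> sets \<nu> = sets N \<and>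
     absolutely_continuous \<nu> M \<and> absolutely_continuous \<nu> N}"

definition tv_dist :: "'u measure \<Rightarrow> 'u measure \<Rightarrow> 'u measure \<Rightarrow> real" where
  "tv_dist \<nu> M N =
     (\<integral>u. \<bar>enn2real (RN_deriv \<nu> M u) - enn2real (RN_deriv \<nu> N u)\<bar> \<partial>\<nu>) / 2"

definition hellinger_dist :: "'u measure \<Rightarrow> 'u measure \<Rightarrow> 'u measure \<Rightarrow> real" where
  "hellinger_dist \<nu> M N = sqrt
     ((\<integral>u. (sqrt (enn2real (RN_deriv \<nu> M u)) - sqrt (enn2real (RN_deriv \<nu> N u)))\<^sup>2 \<partial>\<nu>) / 2)"

end

theory Submission
  imports Defs
begin

text \<open>
  The proof has an analytic half, which shows that the map from parameters to observations is
  measurable and bounds it by inverse permeabilities, and a probabilistic half, which turns moments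
  of that bound into continuity of the posterior in the data.

  For a coefficient between two positive constants \<open>m\<close> and \<open>M\<close> the diffusion equation has a
  solution \<open>p\<close> (\<open>weak_solution_exists\<close>), and testing the equation with \<open>p\<close> itself gives
  \<open>\<parallel>\<nabla>p\<parallel> \<le> C / m\<close> (\<open>weak_solution_norm_bound\<close>). Two solutions differ in the gradient norm by at
  most the \<open>L\<^sup>2\<close> norm of the coefficient difference times \<open>\<nabla>p\<close>, divided by \<open>m\<close>
  (\<open>weak_solution_perturbation\<close>); by dominated convergence the observations therefore depend
  continuously on the coefficient with respect to bounded convergence almost everywhere
  (\<open>weak_solution_continuous\<close>). In both geometries almost every point of the square
  lies strictly inside one region and stays in it when the geometric parameter moves a little
  (\<open>layer_regions_stable\<close>, \<open>channel_regions_stable\<close>). Hence the forward map \<open>G\<close> is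
  continuous on the parameter set, so measurable, and
  \<open>\<bar>G u\<bar> \<le> K (1 / \<kappa>\<^sub>1 + \<dots> + 1 / \<kappa>\<^sub>n)\<close> (\<open>forward_map_continuous\<close>, \<open>forward_map_bound\<close>).

  All of this rests on weak gradients being unique almost everywhere, which is the fundamental lemma of
  the calculus of variations (\<open>AE_eq_0_if_orthogonal_to_tests\<close>), on Poincare's inequality for test
  functions, and on the completeness of \<open>L\<^sup>2\<close>. Solutions are produced as limits of approximate
  minimisers of the energy among test functions.

  Let \<open>\<delta> = \<bar>y - y'\<bar>\<close> and \<open>\<psi> u = r + \<bar>G u\<bar>\<close>, in the noise seminorm. For data of size less than \<open>r\<close>
  the two misfits lie between \<open>0\<close> and \<open>\<psi>\<^sup>2 / 2\<close> and differ by at most \<open>\<delta> \<psi>\<close>. The first fact bounds the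
  normalising constants below by a positive constant depending on \<open>r\<close> only; the second, with
  \<open>\<bar>exp (- a) - exp (- b)\<bar> \<le> min 1 \<bar>a - b\<bar> \<le> \<bar>a - b\<bar>\<^sup>s\<close> for \<open>0 < s \<le> 1\<close>, bounds the total variation
  distance by a multiple of \<open>\<delta>\<^sup>s\<close> as soon as \<open>\<psi>\<close> has a finite moment of order \<open>s\<close>, that is, as soon as
  each \<open>\<kappa>\<^sub>i\<close> has a finite moment of order \<open>- s\<close> (\<open>posterior_hoelder\<close>, \<open>envelope_moment\<close>). The square
  of the Hellinger distance is at most the same bound, which costs half the exponent; second moments
  of \<open>\<psi>\<close> give the Lipschitz bound directly (\<open>posterior_hellinger_lipschitz\<close>). Lognormal and uniform laws have all
  negative moments. The exponential density is positive at the origin, so its negative moments exist only below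
  order one, and this is where the loss \<open>\<iota> < 1\<close> comes from.
\<close>

section \<open>Square integrable functions\<close>

lemma unit_square_box: "unit_square = box (0, 0) (1, 1)"
  by (auto simp: unit_square_def box_def Basis_prod_def)

lemma open_unit_square: "open unit_square"
  by (simp add: unit_square_box open_box)

lemma unit_square_borel [measurable, simp]: "unit_square \<in> sets borel"
  by (simp add: open_unit_square)

lemma space_lebD [simp]: "space lebD = unit_square"
  by (simp add: space_restrict_space)

lemma prob_space_lebD: "prob_space lebD"
proof
  have "emeasure lebD (space lebD) = emeasure lborel unit_square"
    by (simp add: emeasure_restrict_space)
  also have "\<dots> = 1"
    unfolding unit_square_box by (subst emeasure_lborel_box) (auto simp: Basis_prod_def)
  finally show "emeasure lebD (space lebD) = 1" .
qed

interpretation lebD: prob_space lebD by (rule prob_space_lebD)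

lemma borel_measurable_lebD: "f \<in> borel_measurable borel \<Longrightarrow> f \<in> borel_measurable lebD"
  by (simp add: measurable_restrict_space1)

lemma L2_measurable: "p \<in> L2 \<Longrightarrow> p \<in> borel_measurable lebD"
  and L2_integrable: "p \<in> L2 \<Longrightarrow> integrable lebD (\<lambda>z. (norm (p z))\<^sup>2)"
  by (auto simp: L2_def)

lemma L2_norm_nonneg [simp]: "0 \<le> L2_norm p"
  by (simp add: L2_norm_def)

lemma L2_norm_power2: "(L2_norm p)\<^sup>2 = (\<integral>z. (norm (p z))\<^sup>2 \<partial>lebD)"
  by (simp add: L2_norm_def)

lemma norm_lincomb_power2_le:
  fixes a b :: "'b::real_normed_vector"
  shows "(norm (a + c *\<^sub>R b))\<^sup>2 \<le> 2 * (norm a)\<^sup>2 + 2 * c\<^sup>2 * (norm b)\<^sup>2"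
proof -
  have "(norm (a + c *\<^sub>R b))\<^sup>2 \<le> (norm a + \<bar>c\<bar> * norm b)\<^sup>2"
    by (rule power_mono) (auto intro: norm_triangle_le)
  also have "\<dots> \<le> 2 * (norm a)\<^sup>2 + 2 * c\<^sup>2 * (norm b)\<^sup>2"
    using zero_le_power2[of "norm a - \<bar>c\<bar> * norm b"]
    by (simp add: power2_sum power2_diff power_mult_distrib)
  finally show ?thesis .
qed

lemma L2_lincomb:
  fixes p q :: "point \<Rightarrow> 'b::euclidean_space"
  assumes "p \<in> L2" "q \<in> L2"
  shows "(\<lambda>z. p z + c *\<^sub>R q z) \<in> L2"
proof -
  note [measurable] = assms[THEN L2_measurable]
  have "integrable lebD (\<lambda>z. (norm (p z + c *\<^sub>R q z))\<^sup>2)"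
  proof (rule Bochner_Integration.integrable_bound)
    show "integrable lebD (\<lambda>z. 2 * (norm (p z))\<^sup>2 + 2 * c\<^sup>2 * (norm (q z))\<^sup>2)"
      using assms[THEN L2_integrable] by auto
  qed (use norm_lincomb_power2_le in \<open>auto intro!: AE_I2 order_trans[OF _ abs_ge_self]\<close>)
  then show ?thesis
    by (simp add: L2_def)
qed

lemma L2_diff:
  fixes p q :: "point \<Rightarrow> 'b::euclidean_space"
  shows "p \<in> L2 \<Longrightarrow> q \<in> L2 \<Longrightarrow> (\<lambda>z. p z - q z) \<in> L2"
  using L2_lincomb[of p q "-1"] by simp

lemma L2_norm_zero [simp]: "L2_norm (\<lambda>z. 0 :: 'b::euclidean_space) = 0"
  by (simp add: L2_norm_def)

lemma L2_norm_cong_AE: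
  assumes "p \<in> borel_measurable lebD" "q \<in> borel_measurable lebD" "AE z in lebD. p z = q z"
  shows "L2_norm p = L2_norm q"
proof -
  have "(\<integral>z. (norm (p z))\<^sup>2 \<partial>lebD) = (\<integral>z. (norm (q z))\<^sup>2 \<partial>lebD)"
    using assms by (intro integral_cong_AE) auto
  then show ?thesis by (simp add: L2_norm_def)
qed

lemma L2_norm_minus_commute: "L2_norm (\<lambda>z. p z - q z) = L2_norm (\<lambda>z. q z - p z)"
  by (simp add: L2_norm_def norm_minus_commute)

lemma L2_norm_eq_0_AE:
  assumes "p \<in> L2" "L2_norm p = 0"
  shows "AE z in lebD. p z = 0"
proof -
  have "(\<integral>z. (norm (p z))\<^sup>2 \<partial>lebD) = 0"
    using assms L2_norm_power2[of p] by simp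
  then have "AE z in lebD. (norm (p z))\<^sup>2 = 0"
    by (subst (asm) integral_nonneg_eq_0_iff_AE[OF L2_integrable[OF assms(1)]]) auto
  then show ?thesis by simp
qed

lemma integrable_norm_mult:
  fixes p :: "point \<Rightarrow> 'b::euclidean_space" and q :: "point \<Rightarrow> 'c::euclidean_space"
  assumes "p \<in> L2" "q \<in> L2"
  shows "integrable lebD (\<lambda>z. norm (p z) * norm (q z))"
proof (rule Bochner_Integration.integrable_bound)
  note [measurable] = assms[THEN L2_measurable]
  show "integrable lebD (\<lambda>z. (norm (p z))\<^sup>2 + (norm (q z))\<^sup>2)"
    using assms[THEN L2_integrable] by auto
  show "(\<lambda>z. norm (p z) * norm (q z)) \<in> borel_measurable lebD"
    by measurable
  have "a * b \<le> a\<^sup>2 + b\<^sup>2" for a b :: real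
    using sum_squares_bound[of a b] zero_le_power2[of a] zero_le_power2[of b] by linarith
  then show "AE z in lebD. norm (norm (p z) * norm (q z)) \<le> norm ((norm (p z))\<^sup>2 + (norm (q z))\<^sup>2)"
    by (intro AE_I2) (simp add: abs_mult)
qed

text \<open>Cauchy--Schwarz by the arithmetic-geometric mean inequality with the weight that makes the two
  terms equal after integration.\<close>

lemma L2_Cauchy_Schwarz:
  fixes p :: "point \<Rightarrow> 'b::euclidean_space" and q :: "point \<Rightarrow> 'c::euclidean_space"
  assumes "p \<in> L2" "q \<in> L2"
  shows "(\<integral>z. norm (p z) * norm (q z) \<partial>lebD) \<le> L2_norm p * L2_norm q"
proof (cases "L2_norm p = 0 \<or> L2_norm q = 0")
  case True
  then have "AE z in lebD. norm (p z) * norm (q z) = 0"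
    using L2_norm_eq_0_AE[OF assms(1)] L2_norm_eq_0_AE[OF assms(2)] by auto
  then have "(\<integral>z. norm (p z) * norm (q z) \<partial>lebD) = 0"
    by (rule integral_eq_zero_AE)
  then show ?thesis by simp
next
  case False
  define a b where "a = L2_norm p" and "b = L2_norm q"
  have ab: "a > 0" "b > 0"
    using False by (auto simp: a_def b_def less_le)
  have "(\<integral>z. norm (p z) * norm (q z) \<partial>lebD)
      \<le> (\<integral>z. (b / (2 * a)) * (norm (p z))\<^sup>2 + (a / (2 * b)) * (norm (q z))\<^sup>2 \<partial>lebD)"
  proof (rule integral_mono[OF integrable_norm_mult[OF assms]])
    show "norm (p z) * norm (q z)
        \<le> (b / (2 * a)) * (norm (p z))\<^sup>2 + (a / (2 * b)) * (norm (q z))\<^sup>2" for z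
    proof -
      have "0 \<le> (b * norm (p z) - a * norm (q z))\<^sup>2" by simp
      then show ?thesis
        using ab by (simp add: power2_eq_square field_simps)
    qed
  qed (use assms[THEN L2_integrable] in auto)
  also have "\<dots> = (b / (2 * a)) * a\<^sup>2 + (a / (2 * b)) * b\<^sup>2"
    using assms[THEN L2_integrable] by (simp add: a_def b_def L2_norm_power2)
  also have "\<dots> = a * b"
    using ab by (simp add: power2_eq_square field_simps)
  finally show ?thesis by (simp add: a_def b_def)
qed

text \<open>Every bilinear integral below, scalar or vector valued, is estimated through this form.\<close>

lemma L2_Cauchy_Schwarz_dominated:
  fixes p :: "point \<Rightarrow> 'b::euclidean_space" and q :: "point \<Rightarrow> 'c::euclidean_space"
    and h :: "point \<Rightarrow> 'd::euclidean_space"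
  assumes pq: "p \<in> L2" "q \<in> L2" and h: "h \<in> borel_measurable lebD"
    and bound: "AE z in lebD. norm (h z) \<le> C * (norm (p z) * norm (q z))" and C: "0 \<le> C"
  shows "integrable lebD h" "norm (\<integral>z. h z \<partial>lebD) \<le> C * (L2_norm p * L2_norm q)"
proof -
  have int: "integrable lebD (\<lambda>z. C * (norm (p z) * norm (q z)))"
    using integrable_norm_mult[OF pq] by simp
  show h_int: "integrable lebD h"
    by (rule Bochner_Integration.integrable_bound[OF int h])
      (use bound C in \<open>auto simp: abs_mult elim!: eventually_mono\<close>)
  have "norm (\<integral>z. h z \<partial>lebD) \<le> (\<integral>z. C * (norm (p z) * norm (q z)) \<partial>lebD)"
    using integral_norm_bound[of lebD h] integral_mono_AE[OF integrable_norm[OF h_int] int bound] by linarith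
  also have "\<dots> \<le> C * (L2_norm p * L2_norm q)"
    using L2_Cauchy_Schwarz[OF pq] C by (simp add: mult_left_mono)
  finally show "norm (\<integral>z. h z \<partial>lebD) \<le> C * (L2_norm p * L2_norm q)" .
qed

lemma L2_integrable_scaleR:
  fixes p :: "point \<Rightarrow> real" and q :: "point \<Rightarrow> 'b::euclidean_space"
  assumes "p \<in> L2" "q \<in> L2"
  shows "integrable lebD (\<lambda>z. p z *\<^sub>R q z)"
    and "norm (\<integral>z. p z *\<^sub>R q z \<partial>lebD) \<le> L2_norm p * L2_norm q"
proof -
  have m: "(\<lambda>z. p z *\<^sub>R q z) \<in> borel_measurable lebD"
    using assms[THEN L2_measurable] by simp
  show "integrable lebD (\<lambda>z. p z *\<^sub>R q z)"
    using L2_Cauchy_Schwarz_dominated(1)[OF assms m, of 1] by simp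
  show "norm (\<integral>z. p z *\<^sub>R q z \<partial>lebD) \<le> L2_norm p * L2_norm q"
    using L2_Cauchy_Schwarz_dominated(2)[OF assms m, of 1] by simp
qed

lemma L2_norm_triangle:
  fixes p q :: "point \<Rightarrow> 'b::euclidean_space"
  assumes "p \<in> L2" "q \<in> L2"
  shows "L2_norm (\<lambda>z. p z + c *\<^sub>R q z) \<le> L2_norm p + \<bar>c\<bar> * L2_norm q"
proof (rule power2_le_imp_le)
  have "(L2_norm (\<lambda>z. p z + c *\<^sub>R q z))\<^sup>2
      = (\<integral>z. (norm (p z + c *\<^sub>R q z))\<^sup>2 \<partial>lebD)"
    by (rule L2_norm_power2)
  also have "\<dots> \<le> (\<integral>z. (norm (p z))\<^sup>2 + 2 * \<bar>c\<bar> * (norm (p z) * norm (q z)) + c\<^sup>2 * (norm (q z))\<^sup>2 \<partial>lebD)"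
  proof (rule integral_mono)
    show "(norm (p z + c *\<^sub>R q z))\<^sup>2
        \<le> (norm (p z))\<^sup>2 + 2 * \<bar>c\<bar> * (norm (p z) * norm (q z)) + c\<^sup>2 * (norm (q z))\<^sup>2" for z
    proof -
      have "(norm (p z + c *\<^sub>R q z))\<^sup>2 \<le> (norm (p z) + \<bar>c\<bar> * norm (q z))\<^sup>2"
        by (rule power_mono) (auto intro: norm_triangle_le)
      then show ?thesis
        by (simp add: power2_sum power_mult_distrib mult_ac)
    qed
  qed (use assms[THEN L2_integrable] integrable_norm_mult[OF assms] L2_integrable[OF L2_lincomb[OF assms]] in auto)
  also have "\<dots> = (L2_norm p)\<^sup>2 + 2 * \<bar>c\<bar> * (\<integral>z. norm (p z) * norm (q z) \<partial>lebD) + c\<^sup>2 * (L2_norm q)\<^sup>2"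
    using assms[THEN L2_integrable] integrable_norm_mult[OF assms] by (simp add: L2_norm_power2)
  also have "\<dots> \<le> (L2_norm p)\<^sup>2 + 2 * \<bar>c\<bar> * (L2_norm p * L2_norm q) + c\<^sup>2 * (L2_norm q)\<^sup>2"
    using L2_Cauchy_Schwarz[OF assms] by (simp add: mult_left_mono)
  also have "\<dots> = (L2_norm p + \<bar>c\<bar> * L2_norm q)\<^sup>2"
    by (simp add: power2_sum power_mult_distrib mult_ac)
  finally show "(L2_norm (\<lambda>z. p z + c *\<^sub>R q z))\<^sup>2 \<le> (L2_norm p + \<bar>c\<bar> * L2_norm q)\<^sup>2" .
qed simp

lemma integral_norm_le_L2_norm:
  fixes p :: "point \<Rightarrow> 'b::euclidean_space"
  assumes "p \<in> L2"
  shows "integrable lebD p" "(\<integral>z. norm (p z) \<partial>lebD) \<le> L2_norm p"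
proof -
  have one: "(\<lambda>z. 1::real) \<in> L2" "L2_norm (\<lambda>z. 1::real) = 1"
    using lebD.prob_space by (auto simp: L2_def L2_norm_def)
  show "integrable lebD p"
    using L2_Cauchy_Schwarz_dominated(1)[OF assms one(1) L2_measurable[OF assms], of 1] by simp
  show "(\<integral>z. norm (p z) \<partial>lebD) \<le> L2_norm p"
    using L2_Cauchy_Schwarz[OF assms one(1)] one(2) by simp
qed

text \<open>Completeness of \<open>L\<^sup>2\<close> for sequences with a summable modulus of convergence. The square is a
  probability space, so the increments are summable in \<open>L\<^sup>1\<close> and the sequence converges almost
  everywhere; Fatou's lemma carries the \<open>L\<^sup>2\<close> bounds over to the limit.\<close>

lemma L2_complete:
  fixes f :: "nat \<Rightarrow> point \<Rightarrow> 'b::euclidean_space"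
  assumes f: "\<And>k. f k \<in> L2" and e: "summable e"
    and close: "\<And>m n. m \<le> n \<Longrightarrow> L2_norm (\<lambda>z. f m z - f n z) \<le> e m"
  shows "\<exists>F\<in>L2. \<forall>m. L2_norm (\<lambda>z. f m z - F z) \<le> e m"
proof -
  note [measurable] = f[THEN L2_measurable]
  have e_nn: "0 \<le> e m" for m
    using close[of m m] L2_norm_nonneg order_trans by blast
  have "(\<integral>\<^sup>+z. (\<Sum>k. ennreal (norm (f k z - f (Suc k) z))) \<partial>lebD)
      = (\<Sum>k. \<integral>\<^sup>+z. ennreal (norm (f k z - f (Suc k) z)) \<partial>lebD)"
    by (rule nn_integral_suminf) measurable
  also have "\<dots> \<le> (\<Sum>k. ennreal (e k))"
  proof (rule suminf_le)
    fix k
    have "(\<integral>\<^sup>+z. ennreal (norm (f k z - f (Suc k) z)) \<partial>lebD)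
        = ennreal (\<integral>z. norm (f k z - f (Suc k) z) \<partial>lebD)"
      using integral_norm_le_L2_norm(1)[OF L2_diff[OF f f]]
      by (intro nn_integral_eq_integral) auto
    also have "\<dots> \<le> ennreal (e k)"
      using integral_norm_le_L2_norm(2)[OF L2_diff[OF f f, of k "Suc k"]] close[of k "Suc k"]
      by (intro ennreal_leI) linarith
    finally show "(\<integral>\<^sup>+z. ennreal (norm (f k z - f (Suc k) z)) \<partial>lebD) \<le> ennreal (e k)" .
  qed auto
  also have "\<dots> = ennreal (\<Sum>k. e k)"
    using e e_nn by (intro suminf_ennreal2) auto
  also have "\<dots> < \<infinity>" by simp
  finally have "AE z in lebD. (\<Sum>k. ennreal (norm (f k z - f (Suc k) z))) \<noteq> \<infinity>"
    by (intro nn_integral_PInf_AE) (auto simp: less_top)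
  then have conv: "AE z in lebD. convergent (\<lambda>n. f n z)"
  proof eventually_elim
    case (elim z)
    then have "summable (\<lambda>k. norm (f k z - f (Suc k) z))"
      by (intro summable_suminf_not_top) auto
    then have "summable (\<lambda>k. f k z - f (Suc k) z)"
      by (rule summable_norm_cancel)
    then have "convergent (\<lambda>n. \<Sum>k<n. f k z - f (Suc k) z)"
      by (simp add: summable_iff_convergent)
    then have "convergent (\<lambda>n. f 0 z - (\<Sum>k<n. f k z - f (Suc k) z))"
      by (intro convergent_diff convergent_const)
    moreover have "f 0 z - (\<Sum>k<n. f k z - f (Suc k) z) = f n z" for n
      using sum_lessThan_telescope'[of "\<lambda>k. f k z" n] by simp
    ultimately show ?case by simp
  qed
  define F where "F z = lim (\<lambda>n. f n z)" for z
  have F_m [measurable]: "F \<in> borel_measurable lebD"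
    unfolding F_def by (rule borel_measurable_lim_metric) measurable
  have lim: "AE z in lebD. (\<lambda>n. f n z) \<longlonglongrightarrow> F z"
    using conv unfolding F_def by eventually_elim (simp add: convergent_LIMSEQ_iff)
  have bound: "(\<integral>\<^sup>+z. ennreal ((norm (f m z - F z))\<^sup>2) \<partial>lebD) \<le> ennreal ((e m)\<^sup>2)" for m
  proof -
    have "(\<integral>\<^sup>+z. ennreal ((norm (f m z - F z))\<^sup>2) \<partial>lebD)
        = (\<integral>\<^sup>+z. liminf (\<lambda>n. ennreal ((norm (f m z - f n z))\<^sup>2)) \<partial>lebD)"
    proof (rule nn_integral_cong_AE, use lim in eventually_elim)
      case (elim z)
      then have "(\<lambda>n. ennreal ((norm (f m z - f n z))\<^sup>2)) \<longlonglongrightarrow> ennreal ((norm (f m z - F z))\<^sup>2)"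
        by (intro tendsto_intros)
      then show ?case
        by (intro lim_imp_Liminf[symmetric]) auto
    qed
    also have "\<dots> \<le> liminf (\<lambda>n. \<integral>\<^sup>+z. ennreal ((norm (f m z - f n z))\<^sup>2) \<partial>lebD)"
      by (rule nn_integral_liminf) measurable
    also have "\<dots> \<le> ennreal ((e m)\<^sup>2)"
    proof (rule Liminf_le)
      show "\<forall>\<^sub>F n in sequentially. (\<integral>\<^sup>+z. ennreal ((norm (f m z - f n z))\<^sup>2) \<partial>lebD) \<le> ennreal ((e m)\<^sup>2)"
      proof (rule eventually_sequentiallyI[of m])
        fix n assume "m \<le> n"
        have "(\<integral>\<^sup>+z. ennreal ((norm (f m z - f n z))\<^sup>2) \<partial>lebD) = ennreal ((L2_norm (\<lambda>z. f m z - f n z))\<^sup>2)"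
          unfolding L2_norm_power2 using L2_integrable[OF L2_diff[OF f f]]
          by (intro nn_integral_eq_integral) auto
        also have "\<dots> \<le> ennreal ((e m)\<^sup>2)"
          by (intro ennreal_leI power_mono close \<open>m \<le> n\<close>) simp
        finally show "(\<integral>\<^sup>+z. ennreal ((norm (f m z - f n z))\<^sup>2) \<partial>lebD) \<le> ennreal ((e m)\<^sup>2)" .
      qed
    qed simp
    finally show ?thesis .
  qed
  have diff: "(\<lambda>z. f m z - F z) \<in> L2" for m
  proof -
    have "integrable lebD (\<lambda>z. (norm (f m z - F z))\<^sup>2)"
      using bound[of m] by (intro integrableI_nonneg) (auto simp: le_less_trans)
    then show ?thesis by (simp add: L2_def)
  qed
  have "F \<in> L2"
    using L2_diff[OF f[of 0] diff[of 0]] by simp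
  moreover have "L2_norm (\<lambda>z. f m z - F z) \<le> e m" for m
  proof (rule power2_le_imp_le[OF _ e_nn])
    have "ennreal ((L2_norm (\<lambda>z. f m z - F z))\<^sup>2) = (\<integral>\<^sup>+z. ennreal ((norm (f m z - F z))\<^sup>2) \<partial>lebD)"
      unfolding L2_norm_power2 using L2_integrable[OF diff]
      by (intro nn_integral_eq_integral[symmetric]) auto
    then show "(L2_norm (\<lambda>z. f m z - F z))\<^sup>2 \<le> (e m)\<^sup>2"
      using bound[of m] by (metis ennreal_le_iff zero_le_power2)
  qed
  ultimately show ?thesis by blast
qed

section \<open>Test functions and the fundamental lemma\<close>

lemma integrable_lebD_of_lborel:
  fixes f :: "point \<Rightarrow> 'b::euclidean_space"
  assumes "integrable lborel f"
  shows "integrable lebD f"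
  using assms by (simp add: integrable_restrict_space integrable_mult_indicator)

lemma continuous_compact_support_L2:
  fixes h :: "point \<Rightarrow> 'b::euclidean_space"
  assumes cont: "continuous_on UNIV h" and K: "compact K" and supp: "\<And>z. z \<notin> K \<Longrightarrow> h z = 0"
  shows "h \<in> L2"
proof -
  have "integrable lborel (\<lambda>z. indicator K z *\<^sub>R (norm (h z))\<^sup>2)"
    using cont by (intro borel_integrable_compact K continuous_intros) (auto intro: continuous_on_subset)
  also have "(\<lambda>z. indicator K z *\<^sub>R (norm (h z))\<^sup>2) = (\<lambda>z. (norm (h z))\<^sup>2)"
    using supp by (auto simp: indicator_def intro!: ext)
  finally show ?thesis
    using cont by (auto simp: L2_def intro: integrable_lebD_of_lborel
        borel_measurable_lebD borel_measurable_continuous_onI)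
qed

lemma derivative_zero_off_support:
  fixes w :: "point \<Rightarrow> real"
  assumes "(w has_derivative D) (at z)" "compact K" "\<And>z. z \<notin> K \<Longrightarrow> w z = 0" "z \<notin> K"
  shows "D = (\<lambda>v. 0)"
proof (rule has_derivative_unique[OF assms(1)])
  have "((\<lambda>z. 0) has_derivative (\<lambda>v. 0)) (at z)" by simp
  then show "(w has_derivative (\<lambda>v. 0)) (at z)"
    by (rule has_derivative_transform_within_open[of _ _ _ _ "- K"])
      (use assms in \<open>auto simp: compact_imp_closed open_Compl\<close>)
qed

text \<open>The divergence theorem in the only form needed: on every line parallel to a coordinate axis
  the fundamental theorem of calculus makes the partial derivative of a compactly supported
  function integrate to zero.\<close>

lemma integral_partial_derivative_eq_0:
  fixes w :: "point \<Rightarrow> real"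
  assumes deriv: "\<And>z. (w has_derivative D z) (at z)" and e: "e = (1, 0) \<or> e = (0, 1)"
    and cont: "continuous_on UNIV (\<lambda>z. D z e)"
    and K: "compact K" "K \<subseteq> unit_square" and supp: "\<And>z. z \<notin> K \<Longrightarrow> w z = 0"
  shows "(\<integral>z. D z e \<partial>lebD) = 0"
proof -
  define h where "h z = D z e" for z
  have h_supp: "h z = 0" if "z \<notin> K" for z
    unfolding h_def using derivative_zero_off_support[OF deriv K(1) supp that] by simp
  have "integrable lborel (\<lambda>z. indicator K z *\<^sub>R h z)"
    using cont unfolding h_def by (intro borel_integrable_compact K(1)) (auto intro: continuous_on_subset)
  also have "(\<lambda>z. indicator K z *\<^sub>R h z) = h"
    using h_supp by (auto simp: indicator_def intro!: ext)
  finally have int: "integrable (lborel \<Otimes>\<^sub>M lborel) (\<lambda>(x, y). h (x, y))"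
    by (simp add: lborel_prod)
  have lin: "D z (t *\<^sub>R e) = h z * t" for z t
    using linear_scale[OF has_derivative_linear[OF deriv[of z]], of t e] by (simp add: h_def)
  have FTC: "(\<integral>t. g t \<partial>lborel) = 0"
    if g: "\<And>t. g t = h (c t)" and c: "\<And>t. (c has_derivative (\<lambda>s. s *\<^sub>R e)) (at t)"
      and out: "\<And>t. t \<notin> {0<..<1} \<Longrightarrow> c t \<notin> K" for c g
  proof -
    have "(\<integral>t. g t * indicator {0..1} t \<partial>lborel) = w (c 1) - w (c 0)"
    proof (rule integral_FTC_Icc_real)
      fix t :: real
      have "(w \<circ> c has_derivative D (c t) \<circ> (\<lambda>s. s *\<^sub>R e)) (at t)"
        by (rule diff_chain_at[OF c deriv])
      then show "DERIV (\<lambda>t. w (c t)) t :> g t"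
        by (simp add: has_field_derivative_def o_def lin g)
      have "isCont h (c t)"
        using cont continuous_on_eq_continuous_at[OF open_UNIV] unfolding h_def by blast
      then have "isCont (\<lambda>t. h (c t)) t"
        by (rule isCont_o2[OF has_derivative_continuous[OF c]])
      then show "isCont g t"
        unfolding g[abs_def] .
    qed simp
    also have "\<dots> = 0"
      using supp out[of 0] out[of 1] by simp
    also have "(\<lambda>t. g t * indicator {0..1} t) = g"
    proof
      fix t
      show "g t * indicator {0..1} t = g t"
        using h_supp[of "c t"] out[of t] g[of t] by (cases "t \<in> {0<..<1}") auto
    qed
    finally show ?thesis .
  qed
  have "(\<integral>z. h z \<partial>lebD) = (\<integral>z. indicator unit_square z *\<^sub>R h z \<partial>lborel)"
    by (rule integral_restrict_space) simp
  also have "(\<lambda>z. indicator unit_square z *\<^sub>R h z) = h"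
    using h_supp K(2) by (auto simp: indicator_def fun_eq_iff)
  also have "(\<integral>z. h z \<partial>lborel) = (\<integral>(x, y). h (x, y) \<partial>(lborel \<Otimes>\<^sub>M lborel))"
    by (simp add: lborel_prod)
  also have "\<dots> = 0"
    using e
  proof
    assume e1: "e = (1, 0)"
    have "(\<integral>x. h (x, y) \<partial>lborel) = 0" for y
      using K(2) by (rule_tac FTC[of _ "\<lambda>x. (x, y)"])
        (auto simp: e1 unit_square_def intro!: derivative_eq_intros)
    then show ?thesis
      using lborel_pair.integral_snd[OF int] by simp
  next
    assume e2: "e = (0, 1)"
    have "(\<integral>y. h (x, y) \<partial>lborel) = 0" for x
      using K(2) by (rule_tac FTC[of _ "\<lambda>y. (x, y)"])
        (auto simp: e2 unit_square_def intro!: derivative_eq_intros)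
    then show ?thesis
      using lborel_pair.integral_fst[OF int] by simp
  qed
  finally show ?thesis by (simp add: h_def)
qed

lemma test_support:
  assumes "\<phi> \<in> test_functions"
  obtains K where "compact K" "K \<subseteq> unit_square" "\<And>z. z \<notin> K \<Longrightarrow> \<phi> z = 0"
  using assms unfolding test_functions_def by blast

lemma test_has_derivative:
  assumes "\<phi> \<in> test_functions"
  shows "(\<phi> has_derivative (\<lambda>v. grad \<phi> z \<bullet> v)) (at z)"
proof -
  have "times_differentiable (Suc 0) \<phi>"
    using assms unfolding test_functions_def by blast
  then have D: "(\<phi> has_derivative frechet_derivative \<phi> (at z)) (at z)"
    by (simp only: times_differentiable.simps frechet_derivative_works)
  have "frechet_derivative \<phi> (at z) v = grad \<phi> z \<bullet> v" for v
  proof -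
    have "v = fst v *\<^sub>R (1, 0) + snd v *\<^sub>R (0, 1)" by (simp add: prod_eq_iff)
    then have "frechet_derivative \<phi> (at z) v
        = frechet_derivative \<phi> (at z) (fst v *\<^sub>R (1, 0) + snd v *\<^sub>R (0, 1))"
      by simp
    also have "\<dots> = fst v * frechet_derivative \<phi> (at z) (1, 0) + snd v * frechet_derivative \<phi> (at z) (0, 1)"
      unfolding linear_add[OF has_derivative_linear[OF D]] linear_scale[OF has_derivative_linear[OF D]]
      by simp
    finally show ?thesis
      by (simp add: grad_def inner_prod_def mult.commute)
  qed
  then have "frechet_derivative \<phi> (at z) = (\<lambda>v. grad \<phi> z \<bullet> v)" ..
  then show ?thesis using D by simp
qed

lemma test_continuous:
  assumes "\<phi> \<in> test_functions"
  shows "continuous_on UNIV \<phi>" "continuous_on UNIV (grad \<phi>)"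
proof -
  have "times_differentiable 0 \<phi>" "times_differentiable (Suc 0) \<phi>"
    using assms unfolding test_functions_def by blast+
  then show "continuous_on UNIV \<phi>" "continuous_on UNIV (grad \<phi>)"
    unfolding grad_def[abs_def] by (auto intro: continuous_on_Pair)
qed

lemma grad_eqI:
  assumes "(\<phi> has_derivative (\<lambda>v. g \<bullet> v)) (at z)"
  shows "grad \<phi> z = g"
  unfolding grad_def frechet_derivative_at[OF assms, symmetric] by (simp add: inner_prod_def)

lemma grad_lincomb:
  assumes "\<phi> \<in> test_functions" "\<psi> \<in> test_functions"
  shows "grad (\<lambda>z. \<phi> z + c * \<psi> z) z = grad \<phi> z + c *\<^sub>R grad \<psi> z"
  by (rule grad_eqI) (auto intro!: derivative_eq_intros test_has_derivative assms simp: inner_add_left)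

lemma times_differentiable_lincomb:
  "times_differentiable k \<phi> \<Longrightarrow> times_differentiable k \<psi> \<Longrightarrow>
    times_differentiable k (\<lambda>z. \<phi> z + c * \<psi> z)"
proof (induction k arbitrary: \<phi> \<psi>)
  case 0
  then show ?case by (simp add: continuous_on_add continuous_on_mult_left)
next
  case (Suc k)
  then have D: "(\<phi> has_derivative frechet_derivative \<phi> (at z)) (at z)"
      "(\<psi> has_derivative frechet_derivative \<psi> (at z)) (at z)" for z
    by (simp_all only: times_differentiable.simps frechet_derivative_works)
  have D2: "((\<lambda>z. \<phi> z + c * \<psi> z) has_derivative
      (\<lambda>v. frechet_derivative \<phi> (at z) v + c * frechet_derivative \<psi> (at z) v)) (at z)" for z
    by (auto intro!: derivative_eq_intros D)
  then have eq: "frechet_derivative (\<lambda>z. \<phi> z + c * \<psi> z) (at z)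
      = (\<lambda>v. frechet_derivative \<phi> (at z) v + c * frechet_derivative \<psi> (at z) v)" for z
    using frechet_derivative_at by metis
  show ?case
    unfolding times_differentiable.simps eq
  proof (intro conjI allI)
    show "(\<lambda>z. \<phi> z + c * \<psi> z) differentiable at z" for z
      by (rule differentiableI[OF D2])
    show "times_differentiable k (\<lambda>z. frechet_derivative \<phi> (at z) v + c * frechet_derivative \<psi> (at z) v)" for v
      using Suc.prems by (intro Suc.IH) (simp_all only: times_differentiable.simps)
  qed
qed

lemma test_lincomb:
  assumes "\<phi> \<in> test_functions" "\<psi> \<in> test_functions"
  shows "(\<lambda>z. \<phi> z + c * \<psi> z) \<in> test_functions"
proof -
  obtain K where K: "compact K" "K \<subseteq> unit_square" "\<And>z. z \<notin> K \<Longrightarrow> \<phi> z = 0"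
    using test_support[OF assms(1)] by metis
  obtain L where "compact L" "L \<subseteq> unit_square" "\<And>z. z \<notin> L \<Longrightarrow> \<psi> z = 0"
    using test_support[OF assms(2)] by metis
  with K have "compact (K \<union> L) \<and> K \<union> L \<subseteq> unit_square \<and> (\<forall>z. z \<notin> K \<union> L \<longrightarrow> \<phi> z + c * \<psi> z = 0)"
    by auto
  moreover have "times_differentiable k (\<lambda>z. \<phi> z + c * \<psi> z)" for k
    using assms by (auto simp: test_functions_def intro: times_differentiable_lincomb)
  ultimately show ?thesis
    unfolding test_functions_def by blast
qed

lemma test_diff:
  assumes "\<phi> \<in> test_functions" "\<psi> \<in> test_functions"
  shows "(\<lambda>z. \<phi> z - \<psi> z) \<in> test_functions" "grad (\<lambda>z. \<phi> z - \<psi> z) z = grad \<phi> z - grad \<psi> z"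
  using test_lincomb[OF assms, of "-1"] grad_lincomb[OF assms, of "-1" z] by auto

lemma test_L2:
  assumes "\<phi> \<in> test_functions"
  shows "\<phi> \<in> L2" "grad \<phi> \<in> L2"
proof -
  obtain K where K: "compact K" "\<And>z. z \<notin> K \<Longrightarrow> \<phi> z = 0"
    using test_support[OF assms] by metis
  show "\<phi> \<in> L2"
    using continuous_compact_support_L2[OF test_continuous(1)[OF assms] K] .
  have "grad \<phi> z = 0" if "z \<notin> K" for z
    using derivative_zero_off_support[OF test_has_derivative[OF assms] K that]
    by (metis inner_eq_zero_iff)
  then show "grad \<phi> \<in> L2"
    using continuous_compact_support_L2[OF test_continuous(2)[OF assms] K(1)] by blast
qed

text \<open>Integration by parts: the product of two test functions has compact support in the square, so
  the integrals of its partial derivatives vanish.\<close>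

lemma test_is_weak_grad:
  assumes \<phi>: "\<phi> \<in> test_functions"
  shows "is_weak_grad \<phi> (grad \<phi>)"
  unfolding is_weak_grad_def
proof (intro conjI ballI test_L2(2) \<phi>)
  fix \<psi> assume \<psi>: "\<psi> \<in> test_functions"
  obtain K where K: "compact K" "K \<subseteq> unit_square" "\<And>z. z \<notin> K \<Longrightarrow> \<phi> z = 0"
    using test_support[OF \<phi>] by metis
  have int: "integrable lebD (\<lambda>z. \<phi> z *\<^sub>R grad \<psi> z)" "integrable lebD (\<lambda>z. \<psi> z *\<^sub>R grad \<phi> z)"
    using L2_integrable_scaleR(1) test_L2 \<phi> \<psi> by blast+
  have zero: "(\<integral>z. (\<phi> z *\<^sub>R grad \<psi> z + \<psi> z *\<^sub>R grad \<phi> z) \<bullet> e \<partial>lebD) = 0"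
    if e: "e = (1, 0) \<or> e = (0, 1)" for e
  proof (rule integral_partial_derivative_eq_0[where w = "\<lambda>z. \<phi> z * \<psi> z" and K = K
        and D = "\<lambda>z v. (\<phi> z *\<^sub>R grad \<psi> z + \<psi> z *\<^sub>R grad \<phi> z) \<bullet> v"])
    show "((\<lambda>z. \<phi> z * \<psi> z) has_derivative (\<lambda>v. (\<phi> z *\<^sub>R grad \<psi> z + \<psi> z *\<^sub>R grad \<phi> z) \<bullet> v)) (at z)" for z
      by (auto intro!: derivative_eq_intros test_has_derivative \<phi> \<psi> simp: inner_add_left)
    show "continuous_on UNIV (\<lambda>z. (\<phi> z *\<^sub>R grad \<psi> z + \<psi> z *\<^sub>R grad \<phi> z) \<bullet> e)"
      using \<phi> \<psi> by (intro continuous_intros test_continuous) auto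
  qed (use K e in auto)
  have "(\<integral>z. \<phi> z *\<^sub>R grad \<psi> z + \<psi> z *\<^sub>R grad \<phi> z \<partial>lebD) = 0"
  proof (rule prod_eqI)
    note I = Bochner_Integration.integrable_add[OF int]
    show "fst (\<integral>z. \<phi> z *\<^sub>R grad \<psi> z + \<psi> z *\<^sub>R grad \<phi> z \<partial>lebD) = fst 0"
      using zero[of "(1, 0)"] by (simp add: inner_prod_def flip: integral_bounded_linear[OF bounded_linear_fst I])
    show "snd (\<integral>z. \<phi> z *\<^sub>R grad \<psi> z + \<psi> z *\<^sub>R grad \<phi> z \<partial>lebD) = snd 0"
      using zero[of "(0, 1)"] by (simp add: inner_prod_def flip: integral_bounded_linear[OF bounded_linear_snd I])
  qed
  then show "(\<integral>z. \<phi> z *\<^sub>R grad \<psi> z \<partial>lebD) = - (\<integral>z. \<psi> z *\<^sub>R grad \<phi> z \<partial>lebD)"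
    using int by (simp add: add_eq_0_iff)
qed

text \<open>Poincare's inequality: integrating \<open>\<partial>\<^sub>x (x \<phi>\<^sup>2) = \<phi>\<^sup>2 + 2 x \<phi> \<partial>\<^sub>x \<phi>\<close>, whose integral vanishes,
  bounds \<open>\<parallel>\<phi>\<parallel>\<^sup>2\<close> by \<open>2 \<parallel>\<phi>\<parallel> \<parallel>\<nabla>\<phi>\<parallel>\<close>.\<close>

lemma Poincare:
  assumes \<phi>: "\<phi> \<in> test_functions"
  shows "L2_norm \<phi> \<le> 2 * L2_norm (grad \<phi>)"
proof -
  obtain K where K: "compact K" "K \<subseteq> unit_square" "\<And>z. z \<notin> K \<Longrightarrow> \<phi> z = 0"
    using test_support[OF \<phi>] by metis
  define r where "r z = 2 * fst z * \<phi> z * (grad \<phi> z \<bullet> (1, 0))" for z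
  have "(\<integral>z. fst (1 :: real, 0 :: real) * (\<phi> z)\<^sup>2 + 2 * fst z * \<phi> z * (grad \<phi> z \<bullet> (1, 0)) \<partial>lebD) = 0"
  proof (rule integral_partial_derivative_eq_0[where w = "\<lambda>z. fst z * (\<phi> z)\<^sup>2" and K = K
        and D = "\<lambda>z v. fst v * (\<phi> z)\<^sup>2 + 2 * fst z * \<phi> z * (grad \<phi> z \<bullet> v)"])
    show "((\<lambda>z. fst z * (\<phi> z)\<^sup>2) has_derivative
        (\<lambda>v. fst v * (\<phi> z)\<^sup>2 + 2 * fst z * \<phi> z * (grad \<phi> z \<bullet> v))) (at z)" for z
      by (auto intro!: derivative_eq_intros test_has_derivative \<phi>)
    show "continuous_on UNIV (\<lambda>z. fst (1, 0) * (\<phi> z)\<^sup>2 + 2 * fst z * \<phi> z * (grad \<phi> z \<bullet> (1, 0)))"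
      using \<phi> by (intro continuous_intros test_continuous) auto
  qed (use K in auto)
  then have zero: "(\<integral>z. (\<phi> z)\<^sup>2 + r z \<partial>lebD) = 0"
    by (simp add: r_def)
  have r_m: "r \<in> borel_measurable lebD"
  proof -
    note [measurable] = test_L2[OF \<phi>, THEN L2_measurable]
    have [measurable]: "(fst :: point \<Rightarrow> real) \<in> borel_measurable lebD"
      by (intro borel_measurable_lebD borel_measurable_continuous_onI continuous_on_fst continuous_on_id)
    show ?thesis unfolding r_def by measurable
  qed
  have r_bound: "AE z in lebD. norm (r z) \<le> 2 * (norm (\<phi> z) * norm (grad \<phi> z))"
  proof (rule AE_I2)
    fix z assume "z \<in> space lebD"
    then have z: "\<bar>fst z\<bar> \<le> 1"
      unfolding space_lebD by (auto simp: unit_square_def)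
    have "\<bar>grad \<phi> z \<bullet> (1, 0)\<bar> \<le> norm (grad \<phi> z)"
      using Cauchy_Schwarz_ineq2[of "grad \<phi> z" "(1, 0)"] by (simp add: norm_prod_def)
    then have "\<bar>fst z\<bar> * (\<bar>\<phi> z\<bar> * \<bar>grad \<phi> z \<bullet> (1, 0)\<bar>) \<le> 1 * (\<bar>\<phi> z\<bar> * norm (grad \<phi> z))"
      using z by (intro mult_mono) auto
    then show "norm (r z) \<le> 2 * (norm (\<phi> z) * norm (grad \<phi> z))"
      by (simp add: r_def abs_mult)
  qed
  have r_int: "integrable lebD r" and r_le: "norm (\<integral>z. r z \<partial>lebD) \<le> 2 * (L2_norm \<phi> * L2_norm (grad \<phi>))"
    using L2_Cauchy_Schwarz_dominated[OF test_L2[OF \<phi>] r_m r_bound] by auto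
  have sq: "(L2_norm \<phi>)\<^sup>2 \<le> 2 * (L2_norm \<phi> * L2_norm (grad \<phi>))"
    using zero r_le r_int L2_integrable[OF test_L2(1)[OF \<phi>]] by (simp add: L2_norm_power2)
  show ?thesis
  proof (cases "L2_norm \<phi> = 0")
    case False
    then have "L2_norm \<phi> > 0" by (simp add: less_le)
    then show ?thesis using sq by (simp add: power2_eq_square)
  qed simp
qed

text \<open>The functions \<open>t \<mapsto> t\<^sup>-\<^sup>m exp (- 1 / t)\<close> on the positive half line, extended by zero, are closed
  under differentiation up to linear combinations; this makes the classical bump functions smooth.\<close>

definition exp_flat :: "nat \<Rightarrow> real \<Rightarrow> real" where
  "exp_flat m t = (if t > 0 then exp (- inverse t) * inverse t ^ m else 0)"

lemma exp_flat_tendsto_0: "(exp_flat m \<longlongrightarrow> 0) (at 0)"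
proof (rule filterlim_split_at_real)
  show "(exp_flat m \<longlongrightarrow> 0) (at_left 0)"
    by (rule Lim_transform_eventually[OF tendsto_const])
      (auto simp: exp_flat_def eventually_at_filter)
  have "((\<lambda>t. inverse t ^ m / exp (inverse t)) \<longlongrightarrow> (0::real)) (at_right 0)"
    by (rule filterlim_compose[OF tendsto_power_div_exp_0 filterlim_inverse_at_top_right])
  then show "(exp_flat m \<longlongrightarrow> 0) (at_right 0)"
    by (rule Lim_transform_eventually)
      (auto simp: exp_flat_def eventually_at_filter exp_minus field_simps)
qed

lemma exp_flat_deriv:
  "(exp_flat m has_real_derivative exp_flat (m + 2) t - real m * exp_flat (m + 1) t) (at t)"
proof -
  consider "t > 0" | "t = 0" | "t < 0" by linarith
  then show ?thesis
  proof cases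
    case 1
    have "((\<lambda>t. exp (- inverse t) * inverse t ^ m) has_real_derivative
        exp (- inverse t) * (inverse t)\<^sup>2 * inverse t ^ m
          - exp (- inverse t) * (real m * inverse t ^ (m - 1) * (inverse t)\<^sup>2)) (at t)"
      using 1 by (auto intro!: derivative_eq_intros simp: power2_eq_square)
    also have "exp (- inverse t) * (inverse t)\<^sup>2 * inverse t ^ m
          - exp (- inverse t) * (real m * inverse t ^ (m - 1) * (inverse t)\<^sup>2)
        = exp_flat (m + 2) t - real m * exp_flat (m + 1) t"
      using 1 by (cases m) (simp_all add: exp_flat_def power2_eq_square)
    finally have "((\<lambda>t. exp (- inverse t) * inverse t ^ m) has_real_derivative
        exp_flat (m + 2) t - real m * exp_flat (m + 1) t) (at t)" .
    then show ?thesis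
      by (rule has_field_derivative_transform_within_open[of _ _ _ "{0<..}"])
        (use 1 in \<open>auto simp: exp_flat_def\<close>)
  next
    case 2
    have "(\<lambda>h. (exp_flat m (0 + h) - exp_flat m 0) / h) = exp_flat (m + 1)"
      by (auto simp: exp_flat_def fun_eq_iff divide_inverse)
    then show ?thesis
      using exp_flat_tendsto_0[of "m + 1"] by (simp add: 2 DERIV_def exp_flat_def)
  next
    case 3
    have "((\<lambda>t. 0) has_real_derivative exp_flat (m + 2) t - real m * exp_flat (m + 1) t) (at t)"
      using 3 by (simp add: exp_flat_def)
    then show ?thesis
      by (rule has_field_derivative_transform_within_open[of _ _ _ "{..<0}"])
        (use 3 in \<open>auto simp: exp_flat_def\<close>)
  qed
qed

text \<open>A class of functions that contains the bump functions and visibly contains the directional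
  derivatives of its members.\<close>

inductive flat_generated :: "(point \<Rightarrow> real) \<Rightarrow> bool" where
  const: "flat_generated (\<lambda>z. c)"
| flat: "flat_generated (\<lambda>z. exp_flat m (a \<bullet> z + b))"
| add: "flat_generated \<phi> \<Longrightarrow> flat_generated \<psi> \<Longrightarrow> flat_generated (\<lambda>z. \<phi> z + \<psi> z)"
| mult: "flat_generated \<phi> \<Longrightarrow> flat_generated \<psi> \<Longrightarrow> flat_generated (\<lambda>z. \<phi> z * \<psi> z)"

lemma flat_generated_has_derivative:
  "flat_generated \<phi> \<Longrightarrow>
    \<exists>D. (\<forall>z. (\<phi> has_derivative D z) (at z)) \<and> (\<forall>v. flat_generated (\<lambda>z. D z v))"
proof (induction rule: flat_generated.induct)
  case (const c)
  then show ?case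
    by (intro exI[of _ "\<lambda>z v. 0"]) (auto intro: flat_generated.const)
next
  case (flat m a b)
  let ?D = "\<lambda>z v. (exp_flat (m + 2) (a \<bullet> z + b) + (- real m) * exp_flat (m + 1) (a \<bullet> z + b)) * (a \<bullet> v)"
  have "((\<lambda>z. exp_flat m (a \<bullet> z + b)) has_derivative ?D z) (at z)" for z
  proof -
    have "((\<lambda>z. a \<bullet> z + b) has_derivative (\<lambda>v. a \<bullet> v)) (at z)"
      by (auto intro!: derivative_eq_intros)
    from diff_chain_at[OF this exp_flat_deriv[of m "a \<bullet> z + b", unfolded has_field_derivative_def]]
    show ?thesis by (simp add: o_def)
  qed
  moreover have "flat_generated (\<lambda>z. ?D z v)" for v
    by (intro flat_generated.intros)
  ultimately show ?case by (intro exI[of _ ?D]) auto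
next
  case (add \<phi> \<psi>)
  then obtain D E where "\<forall>z. (\<phi> has_derivative D z) (at z)" "\<forall>v. flat_generated (\<lambda>z. D z v)"
    "\<forall>z. (\<psi> has_derivative E z) (at z)" "\<forall>v. flat_generated (\<lambda>z. E z v)"
    by blast
  then show ?case
    by (intro exI[of _ "\<lambda>z v. D z v + E z v"]) (auto intro!: derivative_intros flat_generated.intros)
next
  case (mult \<phi> \<psi>)
  then obtain D E where "\<forall>z. (\<phi> has_derivative D z) (at z)" "\<forall>v. flat_generated (\<lambda>z. D z v)"
    "\<forall>z. (\<psi> has_derivative E z) (at z)" "\<forall>v. flat_generated (\<lambda>z. E z v)"
    by blast
  with mult.hyps show ?case
    by (intro exI[of _ "\<lambda>z v. \<phi> z * E z v + D z v * \<psi> z"])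
      (auto intro!: has_derivative_mult flat_generated.intros)
qed

text \<open>Because the class is closed under directional derivatives, differentiability of any order follows
  by induction, without formulas for the higher derivatives.\<close>

lemma flat_generated_times_differentiable: "flat_generated \<phi> \<Longrightarrow> times_differentiable k \<phi>"
proof (induction k arbitrary: \<phi>)
  case 0
  then obtain D where "\<forall>z. (\<phi> has_derivative D z) (at z)"
    using flat_generated_has_derivative by blast
  then show ?case
    using continuous_on_eq_continuous_at[OF open_UNIV] has_derivative_continuous
    by (metis times_differentiable.simps(1))
next
  case (Suc k)
  then obtain D where D: "\<forall>z. (\<phi> has_derivative D z) (at z)" "\<forall>v. flat_generated (\<lambda>z. D z v)"
    using flat_generated_has_derivative by blast
  have eq: "frechet_derivative \<phi> (at z) = D z" for z
    using D(1) frechet_derivative_at by metis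
  show ?case
    unfolding times_differentiable.simps eq
  proof (intro conjI allI)
    show "\<phi> differentiable at z" for z
      using D(1) by (blast intro: differentiableI)
    show "times_differentiable k (\<lambda>z. D z v)" for v
      using D(2) by (intro Suc.IH) blast
  qed
qed

lemma box_indicator_limit_of_tests:
  assumes a: "0 \<le> fst a" "0 \<le> snd a" and b: "fst b \<le> 1" "snd b \<le> 1"
  shows "\<exists>\<phi>. (\<forall>n. \<phi> n \<in> test_functions) \<and> (\<forall>n z. \<bar>\<phi> n z\<bar> \<le> 1) \<and>
    (\<forall>z. (\<lambda>n. \<phi> n z) \<longlonglongrightarrow> indicator (box a b) z)"
proof -
  \<comment> \<open>The shift by one keeps the support of \<open>E n\<close> at distance \<open>1 / (n + 1)\<close> from the origin, so the bump
    functions have compact support in the square even for boxes that touch its boundary.\<close>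
  define E where "E n t = exp_flat 0 (real (Suc n) * t - 1)" for n t
  have E_bounds: "0 \<le> E n t" "E n t \<le> 1" for n t
    by (auto simp: E_def exp_flat_def)
  have E_zero: "E n t = 0" if "t < 1 / real (Suc n)" for n t
    using that by (auto simp: E_def exp_flat_def field_simps)
  have E_lim: "(\<lambda>n. E n t) \<longlonglongrightarrow> (if t > 0 then 1 else 0)" for t
  proof (cases "t > 0")
    case True
    have top: "filterlim (\<lambda>n. real (Suc n) * t - 1) at_top sequentially"
    proof -
      have "filterlim (\<lambda>n. real (Suc n)) at_top sequentially"
        by (rule filterlim_compose[OF filterlim_real_sequentially filterlim_Suc])
      then have "filterlim (\<lambda>n. t * real (Suc n)) at_top sequentially"
        by (rule filterlim_tendsto_pos_mult_at_top[OF tendsto_const True])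
      then have "filterlim (\<lambda>n. - 1 + t * real (Suc n)) at_top sequentially"
        by (rule filterlim_tendsto_add_at_top[OF tendsto_const])
      then show ?thesis by (simp add: algebra_simps)
    qed
    have "((\<lambda>s::real. exp (- inverse s)) \<longlongrightarrow> exp (- 0)) at_top"
      by (intro tendsto_intros tendsto_inverse_0_at_top filterlim_ident)
    from filterlim_compose[OF this top]
    have "(\<lambda>n. exp (- inverse (real (Suc n) * t - 1))) \<longlonglongrightarrow> 1" by simp
    moreover have "\<forall>\<^sub>F n in sequentially. 0 < real (Suc n) * t - 1"
      using filterlim_at_top_dense[THEN iffD1, OF top] by blast
    then have "\<forall>\<^sub>F n in sequentially. exp (- inverse (real (Suc n) * t - 1)) = E n t"
      by eventually_elim (simp add: E_def exp_flat_def)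
    ultimately have "(\<lambda>n. E n t) \<longlonglongrightarrow> 1"
      by (rule Lim_transform_eventually)
    then show ?thesis using True by simp
  next
    case False
    then have "E n t = 0" for n
      by (intro E_zero) (auto intro: le_less_trans[of _ 0])
    then show ?thesis using False by simp
  qed
  define \<phi> where "\<phi> n z = (E n (fst z - fst a) * E n (fst b - fst z)) *
      (E n (snd z - snd a) * E n (snd b - snd z))" for n and z :: point
  have "\<phi> n \<in> test_functions" for n
  proof -
    let ?N = "real (Suc n)"
    let ?K = "{fst a + 1 / ?N..fst b - 1 / ?N} \<times> {snd a + 1 / ?N..snd b - 1 / ?N}"
    have "flat_generated (\<phi> n)"
    proof -
      have "\<phi> n = (\<lambda>z. (exp_flat 0 ((?N, 0) \<bullet> z + (- ?N * fst a - 1)) * exp_flat 0 ((- ?N, 0) \<bullet> z + (?N * fst b - 1))) *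
          (exp_flat 0 ((0, ?N) \<bullet> z + (- ?N * snd a - 1)) * exp_flat 0 ((0, - ?N) \<bullet> z + (?N * snd b - 1))))"
        by (simp add: \<phi>_def E_def fun_eq_iff inner_prod_def algebra_simps)
      then show ?thesis
        by (simp only:) (intro flat_generated.intros)
    qed
    then have "\<forall>k. times_differentiable k (\<phi> n)"
      by (simp add: flat_generated_times_differentiable)
    moreover have "compact ?K"
      by (intro compact_Times compact_Icc)
    moreover have "{fst a + d..fst b - d} \<times> {snd a + d..snd b - d} \<subseteq> unit_square" if "0 < d" for d
      using a b that unfolding unit_square_def by (intro Sigma_mono) auto
    then have "?K \<subseteq> unit_square" by simp
    moreover have "\<phi> n z = 0" if "z \<notin> ?K" for z
    proof -
      have "fst z - fst a < 1 / ?N \<or> fst b - fst z < 1 / ?N \<or> snd z - snd a < 1 / ?N \<or> snd b - snd z < 1 / ?N"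
        using that by (cases z) auto
      then show ?thesis
        using E_zero unfolding \<phi>_def by auto
    qed
    ultimately show ?thesis
      unfolding test_functions_def by blast
  qed
  moreover have "\<bar>\<phi> n z\<bar> \<le> 1" for n z
    unfolding \<phi>_def using E_bounds by (auto simp: abs_mult intro!: mult_le_one mult_nonneg_nonneg)
  moreover have "(\<lambda>n. \<phi> n z) \<longlonglongrightarrow> indicator (box a b) z" for z
  proof -
    have "(\<lambda>n. \<phi> n z) \<longlonglongrightarrow> ((if fst z - fst a > 0 then 1 else 0) * (if fst b - fst z > 0 then 1 else 0)) *
        ((if snd z - snd a > 0 then 1 else 0) * (if snd b - snd z > 0 then 1 else 0))"
      (is "_ \<longlonglongrightarrow> ?L")
      unfolding \<phi>_def by (intro tendsto_mult E_lim)
    moreover have "?L = indicator (box a b) z"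
      by (auto simp: box_def Basis_prod_def indicator_def inner_prod_def)
    ultimately show ?thesis by simp
  qed
  ultimately show ?thesis by blast
qed

text \<open>The fundamental lemma of the calculus of variations. Indicators of boxes are
  bounded pointwise limits of test functions, so the integral over every box vanishes, and the boxes are an intersection-stable generator of the Borel sets.\<close>

lemma AE_eq_0_if_orthogonal_to_tests:
  fixes g :: "point \<Rightarrow> 'b::euclidean_space"
  assumes int: "integrable lebD g" and ortho: "\<And>\<phi>. \<phi> \<in> test_functions \<Longrightarrow> (\<integral>z. \<phi> z *\<^sub>R g z \<partial>lebD) = 0"
  shows "AE z in lebD. g z = 0"
proof (rule lebD.density_zero[OF int])
  have [measurable]: "g \<in> borel_measurable lebD" using int by auto
  have box: "(\<integral>z. indicator (box a b) z *\<^sub>R g z \<partial>lebD) = 0" for a b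
  proof -
    \<comment> \<open>Only the part of the box inside the square matters.\<close>
    let ?a = "(max 0 (fst a), max 0 (snd a))" and ?b = "(min 1 (fst b), min 1 (snd b))"
    obtain \<phi> where \<phi>: "\<And>n. \<phi> n \<in> test_functions" "\<And>n z. \<bar>\<phi> n z\<bar> \<le> 1"
        "\<And>z. (\<lambda>n. \<phi> n z) \<longlonglongrightarrow> indicator (box ?a ?b) z"
      using box_indicator_limit_of_tests[of ?a ?b] by auto
    have [measurable]: "\<phi> n \<in> borel_measurable lebD" for n
      using test_L2(1)[OF \<phi>(1)] by (rule L2_measurable)
    have "(\<lambda>n. \<integral>z. \<phi> n z *\<^sub>R g z \<partial>lebD) \<longlonglongrightarrow> (\<integral>z. indicator (box ?a ?b) z *\<^sub>R g z \<partial>lebD)"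
    proof (rule integral_dominated_convergence)
      show "integrable lebD (\<lambda>z. norm (g z))" using int by simp
      show "AE z in lebD. (\<lambda>n. \<phi> n z *\<^sub>R g z) \<longlonglongrightarrow> indicator (box ?a ?b) z *\<^sub>R g z"
        by (intro AE_I2 tendsto_intros \<phi>(3))
      show "AE z in lebD. norm (\<phi> n z *\<^sub>R g z) \<le> norm (g z)" for n
        using \<phi>(2) by (auto intro!: AE_I2 mult_left_le_one_le)
      show "(\<lambda>z. indicator (box ?a ?b) z *\<^sub>R g z) \<in> borel_measurable lebD"
        by (intro borel_measurable_scaleR borel_measurable_lebD[OF borel_measurable_indicator]) auto
    qed auto
    then have "(\<integral>z. indicator (box ?a ?b) z *\<^sub>R g z \<partial>lebD) = 0"
      using ortho[OF \<phi>(1)] by (simp add: LIMSEQ_const_iff)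
    also have "(\<integral>z. indicator (box ?a ?b) z *\<^sub>R g z \<partial>lebD) = (\<integral>z. indicator (box a b) z *\<^sub>R g z \<partial>lebD)"
    proof (rule Bochner_Integration.integral_cong[OF refl])
      fix z assume "z \<in> space lebD"
      then have "z \<in> unit_square" by (simp only: space_lebD)
      then show "indicator (box ?a ?b) z *\<^sub>R g z = indicator (box a b) z *\<^sub>R g z"
        by (auto simp: unit_square_def box_def Basis_prod_def indicator_def inner_prod_def)
    qed
    finally show ?thesis .
  qed
  have main: "(\<integral>z. indicator A z *\<^sub>R g z \<partial>lebD) = 0" if "A \<in> sets borel" for A
  proof -
    let ?G = "range (\<lambda>(a, b). box a b :: point set)"
    have borel: "sets borel = sigma_sets UNIV ?G"
      unfolding borel_eq_box by (rule sets_measure_of) simp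
    have restr: "A \<inter> unit_square \<in> sets lebD" if "A \<in> sets borel" for A
      using that by (auto simp: sets_restrict_space)
    have int_A: "integrable lebD (\<lambda>z. indicator A z *\<^sub>R g z)" if "A \<in> sets borel" for A
    proof -
      have "integrable lebD (\<lambda>z. indicator (A \<inter> unit_square) z *\<^sub>R g z)"
        by (rule integrable_mult_indicator[OF restr[OF that] int])
      then show ?thesis
        by (rule Bochner_Integration.integrable_cong[OF refl, THEN iffD1, rotated]) (auto simp: indicator_def)
    qed
    have "Int_stable ?G"
      by (auto simp: Int_stable_def box_Int_box)
    moreover have "?G \<subseteq> Pow UNIV" by simp
    moreover have "A \<in> sigma_sets UNIV ?G"
      using that borel by simp
    ultimately show ?thesis
    proof (induction rule: sigma_sets_induct_disjoint)
      case (basic A)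
      then show ?case using box by auto
    next
      case empty
      then show ?case by simp
    next
      case (compl A)
      have "(\<integral>z. g z \<partial>lebD) = (\<integral>z. indicator (box (0, 0) (1, 1)) z *\<^sub>R g z \<partial>lebD)"
        by (intro Bochner_Integration.integral_cong) (auto simp: unit_square_box)
      then have "(\<integral>z. g z \<partial>lebD) = 0" using box by simp
      moreover have "(\<integral>z. indicator (UNIV - A) z *\<^sub>R g z \<partial>lebD)
          = (\<integral>z. g z - indicator A z *\<^sub>R g z \<partial>lebD)"
        by (intro Bochner_Integration.integral_cong) (auto simp: indicator_def)
      ultimately show ?case
        using int int_A[of A] compl borel by simp
    next
      case (union A)
      have U: "(\<Union>i. A i) \<inter> unit_square = (\<Union>i. A i \<inter> unit_square)" by auto
      have eq: "(\<integral>z. indicator B z *\<^sub>R g z \<partial>lebD) = (\<integral>z. indicator (B \<inter> unit_square) z *\<^sub>R g z \<partial>lebD)" for B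
        by (intro Bochner_Integration.integral_cong) (auto simp: indicator_def)
      have "(LINT z:(\<Union>i. A i \<inter> unit_square)|lebD. g z) = (\<Sum>i. LINT z:(A i \<inter> unit_square)|lebD. g z)"
      proof (rule lebesgue_integral_countable_add)
        show "A i \<inter> unit_square \<in> sets lebD" for i
          using restr union.hyps(2) borel by auto
        then have "(\<Union>i. A i \<inter> unit_square) \<in> sets lebD" by blast
        then show "set_integrable lebD (\<Union>i. A i \<inter> unit_square) g"
          unfolding set_integrable_def by (rule integrable_mult_indicator[OF _ int])
        show "A i \<inter> unit_square \<inter> (A j \<inter> unit_square) = {}" if "i \<noteq> j" for i j
          using union.hyps(1) that by (auto simp: disjoint_family_on_def)
      qed
      moreover have "(LINT z:(A i \<inter> unit_square)|lebD. g z) = 0" for i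
        using eq[of "A i"] union.IH[of i] unfolding set_lebesgue_integral_def by argo
      ultimately have "(LINT z:(\<Union>i. A i \<inter> unit_square)|lebD. g z) = 0" by simp
      then show ?case
        using eq[of "\<Union>i. A i"] unfolding U set_lebesgue_integral_def by argo
    qed
  qed
  fix A assume "A \<in> sets lebD"
  then have "A \<in> sets borel"
    by (auto simp: sets_restrict_space)
  then show "set_lebesgue_integral lebD A g = 0"
    using main by (simp add: set_lebesgue_integral_def)
qed

text \<open>This makes the choice of a representative in \<open>weak_grad\<close> harmless.\<close>

lemma weak_grad_unique:
  assumes p: "is_weak_grad p g" "is_weak_grad p h"
  shows "AE z in lebD. g z = h z"
proof -
  have gh: "g \<in> L2" "h \<in> L2"
    using p by (auto simp: is_weak_grad_def)
  have "AE z in lebD. g z - h z = 0"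
  proof (rule AE_eq_0_if_orthogonal_to_tests)
    show "integrable lebD (\<lambda>z. g z - h z)"
      by (rule integral_norm_le_L2_norm(1)[OF L2_diff[OF gh]])
    fix \<phi> assume \<phi>: "\<phi> \<in> test_functions"
    have "- (\<integral>z. \<phi> z *\<^sub>R g z \<partial>lebD) = - (\<integral>z. \<phi> z *\<^sub>R h z \<partial>lebD)"
      using p \<phi> unfolding is_weak_grad_def by auto
    then have eq: "(\<integral>z. \<phi> z *\<^sub>R g z \<partial>lebD) = (\<integral>z. \<phi> z *\<^sub>R h z \<partial>lebD)"
      by (rule neg_equal_iff_equal[THEN iffD1])
    have "(\<integral>z. \<phi> z *\<^sub>R (g z - h z) \<partial>lebD) = (\<integral>z. \<phi> z *\<^sub>R g z \<partial>lebD) - (\<integral>z. \<phi> z *\<^sub>R h z \<partial>lebD)"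
      unfolding scaleR_diff_right
      by (intro Bochner_Integration.integral_diff L2_integrable_scaleR(1) test_L2(1) \<phi> gh)
    then show "(\<integral>z. \<phi> z *\<^sub>R (g z - h z) \<partial>lebD) = 0"
      using eq by simp
  qed
  then show ?thesis by simp
qed

lemma is_weak_grad_lincomb:
  assumes p: "p \<in> L2" "is_weak_grad p g" and q: "q \<in> L2" "is_weak_grad q h"
  shows "is_weak_grad (\<lambda>z. p z + c * q z) (\<lambda>z. g z + c *\<^sub>R h z)"
proof -
  have gh: "g \<in> L2" "h \<in> L2"
    using p q by (auto simp: is_weak_grad_def)
  have "(\<integral>z. (p z + c * q z) *\<^sub>R grad \<phi> z \<partial>lebD) = - (\<integral>z. \<phi> z *\<^sub>R (g z + c *\<^sub>R h z) \<partial>lebD)"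
    if \<phi>: "\<phi> \<in> test_functions" for \<phi>
  proof -
    have pq_eq: "(\<integral>z. p z *\<^sub>R grad \<phi> z \<partial>lebD) = - (\<integral>z. \<phi> z *\<^sub>R g z \<partial>lebD)"
      "(\<integral>z. q z *\<^sub>R grad \<phi> z \<partial>lebD) = - (\<integral>z. \<phi> z *\<^sub>R h z \<partial>lebD)"
      using p q \<phi> by (auto simp: is_weak_grad_def)
    have "(\<integral>z. (p z + c * q z) *\<^sub>R grad \<phi> z \<partial>lebD)
        = (\<integral>z. p z *\<^sub>R grad \<phi> z + c *\<^sub>R (q z *\<^sub>R grad \<phi> z) \<partial>lebD)"
      by (simp add: scaleR_add_left)
    also have "\<dots> = (\<integral>z. p z *\<^sub>R grad \<phi> z \<partial>lebD) + c *\<^sub>R (\<integral>z. q z *\<^sub>R grad \<phi> z \<partial>lebD)"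
      unfolding Bochner_Integration.integral_add[OF L2_integrable_scaleR(1)[OF p(1) test_L2(2)[OF \<phi>]]
          integrable_scaleR_right[OF L2_integrable_scaleR(1)[OF q(1) test_L2(2)[OF \<phi>]]]]
      by (simp only: integral_scaleR_right)
    also have "\<dots> = - ((\<integral>z. \<phi> z *\<^sub>R g z \<partial>lebD) + c *\<^sub>R (\<integral>z. \<phi> z *\<^sub>R h z \<partial>lebD))"
      by (simp add: pq_eq)
    also have "(\<integral>z. \<phi> z *\<^sub>R g z \<partial>lebD) + c *\<^sub>R (\<integral>z. \<phi> z *\<^sub>R h z \<partial>lebD)
        = (\<integral>z. \<phi> z *\<^sub>R g z + c *\<^sub>R (\<phi> z *\<^sub>R h z) \<partial>lebD)"
      unfolding Bochner_Integration.integral_add[OF L2_integrable_scaleR(1)[OF test_L2(1)[OF \<phi>] gh(1)]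
          integrable_scaleR_right[OF L2_integrable_scaleR(1)[OF test_L2(1)[OF \<phi>] gh(2)]]]
      by (simp only: integral_scaleR_right)
    finally show ?thesis
      by (simp add: scaleR_add_right mult.commute)
  qed
  then show ?thesis
    using L2_lincomb[OF gh] by (simp add: is_weak_grad_def)
qed

section \<open>The diffusion equation\<close>

lemma is_weak_grad_L2: "is_weak_grad p g \<Longrightarrow> g \<in> L2"
  by (simp add: is_weak_grad_def)

lemma weak_grad_AE:
  assumes "is_weak_grad p g"
  shows "AE z in lebD. weak_grad p z = g z" "is_weak_grad p (weak_grad p)"
    "weak_grad p \<in> L2"
proof -
  show *: "is_weak_grad p (weak_grad p)"
    unfolding weak_grad_def by (rule someI[of "is_weak_grad p"]) (rule assms)
  show "AE z in lebD. weak_grad p z = g z"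
    by (rule weak_grad_unique[OF * assms])
  show "weak_grad p \<in> L2"
    by (rule is_weak_grad_L2[OF *])
qed

lemma L2_norm_weak_grad: "is_weak_grad p g \<Longrightarrow> L2_norm (weak_grad p) = L2_norm g"
  by (intro L2_norm_cong_AE weak_grad_AE L2_measurable is_weak_grad_L2)

lemma is_weak_grad_diff:
  assumes "p \<in> L2" "is_weak_grad p g" "q \<in> L2" "is_weak_grad q h"
  shows "is_weak_grad (\<lambda>z. p z - q z) (\<lambda>z. g z - h z)"
  using is_weak_grad_lincomb[OF assms, of "-1"] by simp

text \<open>The norm in the definition of \<open>V\<close> refers to a chosen weak gradient of each difference. By
  uniqueness it may be computed from any fixed weak gradient \<open>g\<close> of \<open>p\<close>, which turns membership into a
  simultaneous \<open>L\<^sup>2\<close> approximation of \<open>p\<close> and \<open>g\<close>.\<close>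

lemma V_iff_approximable:
  assumes p: "p \<in> L2" "is_weak_grad p g"
  shows "p \<in> V \<longleftrightarrow> (\<forall>\<epsilon>>0. \<exists>\<phi>\<in>test_functions.
    L2_norm (\<lambda>z. p z - \<phi> z) < \<epsilon> \<and> L2_norm (\<lambda>z. g z - grad \<phi> z) < \<epsilon>)"
proof -
  have norm: "H1_norm (\<lambda>z. p z - \<phi> z)
      = sqrt ((L2_norm (\<lambda>z. p z - \<phi> z))\<^sup>2 + (L2_norm (\<lambda>z. g z - grad \<phi> z))\<^sup>2)"
    if "\<phi> \<in> test_functions" for \<phi>
    unfolding H1_norm_def
    using L2_norm_weak_grad[OF is_weak_grad_diff[OF p test_L2(1) test_is_weak_grad, OF that that]] by simp
  show ?thesis
  proof (intro iffI allI impI)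
    fix \<epsilon> :: real assume "p \<in> V" "\<epsilon> > 0"
    then obtain \<phi> where \<phi>: "\<phi> \<in> test_functions" "H1_norm (\<lambda>z. p z - \<phi> z) < \<epsilon>"
      unfolding V_def by blast
    then have "L2_norm (\<lambda>z. p z - \<phi> z) < \<epsilon>" "L2_norm (\<lambda>z. g z - grad \<phi> z) < \<epsilon>"
      unfolding norm[OF \<phi>(1)]
      using real_sqrt_sum_squares_ge1[of "L2_norm (\<lambda>z. p z - \<phi> z)" "L2_norm (\<lambda>z. g z - grad \<phi> z)"]
        real_sqrt_sum_squares_ge2[of "L2_norm (\<lambda>z. g z - grad \<phi> z)" "L2_norm (\<lambda>z. p z - \<phi> z)"]
      by linarith+
    then show "\<exists>\<phi>\<in>test_functions. L2_norm (\<lambda>z. p z - \<phi> z) < \<epsilon> \<and> L2_norm (\<lambda>z. g z - grad \<phi> z) < \<epsilon>"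
      using \<phi>(1) by blast
  next
    assume approx: "\<forall>\<epsilon>>0. \<exists>\<phi>\<in>test_functions.
      L2_norm (\<lambda>z. p z - \<phi> z) < \<epsilon> \<and> L2_norm (\<lambda>z. g z - grad \<phi> z) < \<epsilon>"
    have "\<exists>\<phi>\<in>test_functions. H1_norm (\<lambda>z. p z - \<phi> z) < \<epsilon>" if "\<epsilon> > 0" for \<epsilon>
    proof -
      obtain \<phi> where \<phi>: "\<phi> \<in> test_functions" "L2_norm (\<lambda>z. p z - \<phi> z) < \<epsilon> / 2"
        "L2_norm (\<lambda>z. g z - grad \<phi> z) < \<epsilon> / 2"
        using approx \<open>\<epsilon> > 0\<close> half_gt_zero by blast
      have "H1_norm (\<lambda>z. p z - \<phi> z) \<le> L2_norm (\<lambda>z. p z - \<phi> z) + L2_norm (\<lambda>z. g z - grad \<phi> z)"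
        unfolding norm[OF \<phi>(1)] by (intro sqrt_sum_squares_le_sum) auto
      then show ?thesis
        using \<phi> by (intro bexI[of _ \<phi>]) auto
    qed
    then show "p \<in> V"
      using p unfolding V_def H1_def by blast
  qed
qed

lemma V_D:
  assumes "p \<in> V"
  shows "p \<in> L2" "is_weak_grad p (weak_grad p)" "weak_grad p \<in> L2"
proof -
  show "p \<in> L2" using assms by (auto simp: V_def H1_def)
  obtain g where "is_weak_grad p g" using assms by (auto simp: V_def H1_def)
  then show "is_weak_grad p (weak_grad p)" "weak_grad p \<in> L2"
    by (rule weak_grad_AE)+
qed

lemma V_approx:
  assumes "p \<in> V" "\<epsilon> > 0"
  obtains \<phi> where "\<phi> \<in> test_functions" "L2_norm (\<lambda>z. p z - \<phi> z) < \<epsilon>"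
    "L2_norm (\<lambda>z. weak_grad p z - grad \<phi> z) < \<epsilon>"
  using assms(1)[unfolded V_iff_approximable[OF V_D(1,2)[OF assms(1)]]] assms(2) by blast

lemma test_in_V:
  assumes "\<phi> \<in> test_functions"
  shows "\<phi> \<in> V"
  unfolding V_iff_approximable[OF test_L2(1)[OF assms] test_is_weak_grad[OF assms]]
  using assms by (intro allI impI bexI[of _ \<phi>]) auto

text \<open>Approximations to \<open>p\<close> and \<open>q\<close> combine to an approximation of the linear combination;
  each is taken to within \<open>\<epsilon> / (1 + \<bar>c\<bar>)\<close>.\<close>

lemma V_lincomb:
  assumes p: "p \<in> V" and q: "q \<in> V"
  shows "(\<lambda>z. p z + c * q z) \<in> V"
    and "AE z in lebD. weak_grad (\<lambda>z. p z + c * q z) z = weak_grad p z + c *\<^sub>R weak_grad q z"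
proof -
  note P = V_D[OF p] and Q = V_D[OF q]
  have wg: "is_weak_grad (\<lambda>z. p z + c * q z) (\<lambda>z. weak_grad p z + c *\<^sub>R weak_grad q z)"
    by (rule is_weak_grad_lincomb[OF P(1,2) Q(1,2)])
  then show "AE z in lebD. weak_grad (\<lambda>z. p z + c * q z) z = weak_grad p z + c *\<^sub>R weak_grad q z"
    by (rule weak_grad_AE)
  have L2: "(\<lambda>z. p z + c * q z) \<in> L2"
    using L2_lincomb[OF P(1) Q(1), of c] by simp
  show "(\<lambda>z. p z + c * q z) \<in> V"
  proof (subst V_iff_approximable[OF L2 wg], intro allI impI)
    fix \<epsilon> :: real assume "\<epsilon> > 0"
    define \<delta> where "\<delta> = \<epsilon> / (1 + \<bar>c\<bar>)"
    have "\<delta> > 0" using \<open>\<epsilon> > 0\<close> by (simp add: \<delta>_def add_pos_nonneg)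
    obtain \<phi> where \<phi>: "\<phi> \<in> test_functions" "L2_norm (\<lambda>z. p z - \<phi> z) < \<delta>"
        "L2_norm (\<lambda>z. weak_grad p z - grad \<phi> z) < \<delta>"
      using V_approx[OF p \<open>\<delta> > 0\<close>] .
    obtain \<psi> where \<psi>: "\<psi> \<in> test_functions" "L2_norm (\<lambda>z. q z - \<psi> z) < \<delta>"
        "L2_norm (\<lambda>z. weak_grad q z - grad \<psi> z) < \<delta>"
      using V_approx[OF q \<open>\<delta> > 0\<close>] .
    have \<delta>_eq: "\<delta> + \<bar>c\<bar> * \<delta> = \<epsilon>"
    proof -
      have "1 + \<bar>c\<bar> > 0" by (simp add: add_pos_nonneg)
      then have "(1 + \<bar>c\<bar>) * \<delta> = \<epsilon>" by (simp add: \<delta>_def)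
      then show ?thesis by (simp only: distrib_right mult_1)
    qed
    have sum: "x < \<delta> \<Longrightarrow> y < \<delta> \<Longrightarrow> x + \<bar>c\<bar> * y < \<epsilon>" for x y
      using mult_left_mono[of y \<delta> "\<bar>c\<bar>"] \<delta>_eq by auto
    have "L2_norm (\<lambda>z. (p z + c * q z) - (\<phi> z + c * \<psi> z))
        \<le> L2_norm (\<lambda>z. p z - \<phi> z) + \<bar>c\<bar> * L2_norm (\<lambda>z. q z - \<psi> z)"
      using L2_norm_triangle[OF L2_diff[OF P(1) test_L2(1)[OF \<phi>(1)]] L2_diff[OF Q(1) test_L2(1)[OF \<psi>(1)]], of c]
      by (simp add: algebra_simps)
    moreover have "L2_norm (\<lambda>z. (weak_grad p z + c *\<^sub>R weak_grad q z) - grad (\<lambda>z. \<phi> z + c * \<psi> z) z)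
        \<le> L2_norm (\<lambda>z. weak_grad p z - grad \<phi> z) + \<bar>c\<bar> * L2_norm (\<lambda>z. weak_grad q z - grad \<psi> z)"
      using L2_norm_triangle[OF L2_diff[OF P(3) test_L2(2)[OF \<phi>(1)]] L2_diff[OF Q(3) test_L2(2)[OF \<psi>(1)]], of c]
      by (simp add: algebra_simps grad_lincomb[OF \<phi>(1) \<psi>(1)])
    ultimately show "\<exists>\<phi>\<in>test_functions. L2_norm (\<lambda>z. (p z + c * q z) - \<phi> z) < \<epsilon> \<and>
        L2_norm (\<lambda>z. (weak_grad p z + c *\<^sub>R weak_grad q z) - grad \<phi> z) < \<epsilon>"
      using test_lincomb[OF \<phi>(1) \<psi>(1), of c] sum[OF \<phi>(2) \<psi>(2)] sum[OF \<phi>(3) \<psi>(3)]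
      by (intro bexI[of _ "\<lambda>z. \<phi> z + c * \<psi> z"]) auto
  qed
qed

lemma V_diff:
  assumes "p \<in> V" "q \<in> V"
  shows "(\<lambda>z. p z - q z) \<in> V"
    and "AE z in lebD. weak_grad (\<lambda>z. p z - q z) z = weak_grad p z - weak_grad q z"
  using V_lincomb[OF assms, of "-1"] by auto

lemma V_norm_nonneg [simp]: "0 \<le> V_norm p"
  by (simp add: V_norm_def)

lemma V_norm_diff_test:
  assumes "p \<in> V" "\<phi> \<in> test_functions"
  shows "V_norm (\<lambda>z. p z - \<phi> z) = L2_norm (\<lambda>z. weak_grad p z - grad \<phi> z)"
  unfolding V_norm_def
  by (rule L2_norm_weak_grad is_weak_grad_diff V_D test_L2 test_is_weak_grad assms)+

lemma V_norm_test: "\<phi> \<in> test_functions \<Longrightarrow> V_norm \<phi> = L2_norm (grad \<phi>)"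
  unfolding V_norm_def by (rule L2_norm_weak_grad[OF test_is_weak_grad])

lemma V_dual_bound:
  assumes "l \<in> V_dual"
  obtains C where "0 \<le> C" "\<And>p. p \<in> V \<Longrightarrow> \<bar>l p\<bar> \<le> C * V_norm p"
proof -
  obtain C where C: "\<And>p. p \<in> V \<Longrightarrow> \<bar>l p\<bar> \<le> C * V_norm p"
    using assms unfolding V_dual_def by blast
  have "\<bar>l p\<bar> \<le> max 0 C * V_norm p" if "p \<in> V" for p
    using C[OF that] mult_right_mono[of C "max 0 C" "V_norm p"] by auto
  then show ?thesis by (intro that[of "max 0 C"]) auto
qed

lemma V_dual_lincomb:
  assumes l: "l \<in> V_dual" and pq: "p \<in> V" "q \<in> V"
  shows "l (\<lambda>z. p z + c * q z) = l p + c * l q"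
proof -
  have zero: "(\<lambda>z. 0 + c * q z) \<in> V"
  proof -
    have "(\<lambda>z. q z + (-1) * q z) \<in> V" by (rule V_lincomb(1)[OF pq(2) pq(2)])
    then have "(\<lambda>z. 0) \<in> V" by simp
    from V_lincomb(1)[OF this pq(2), of c] show ?thesis by simp
  qed
  then show ?thesis
    using l pq unfolding V_dual_def by simp
qed

lemma V_dual_diff:
  assumes l: "l \<in> V_dual" and pq: "p \<in> V" "q \<in> V"
  shows "l (\<lambda>z. p z - q z) = l p - l q"
  using V_dual_lincomb[OF assms, of "-1"] by simp

definition elliptic :: "(point \<Rightarrow> real) \<Rightarrow> real \<Rightarrow> real \<Rightarrow> bool" where
  "elliptic \<kappa> m M \<longleftrightarrow> \<kappa> \<in> borel_measurable lebD \<and> 0 < m \<and> (AE z in lebD. m \<le> \<kappa> z \<and> \<kappa> z \<le> M)"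

definition energy :: "(point \<Rightarrow> real) \<Rightarrow> (point \<Rightarrow> point) \<Rightarrow> (point \<Rightarrow> point) \<Rightarrow> real" where
  "energy \<kappa> g h = (\<integral>z. \<kappa> z * (g z \<bullet> h z) \<partial>lebD)"

lemma elliptic_coefficients:
  assumes "elliptic \<kappa> m M"
  shows "\<kappa> \<in> coefficients"
proof -
  have [measurable]: "\<kappa> \<in> borel_measurable lebD" and m: "0 < m"
    and AE: "AE z in lebD. m \<le> \<kappa> z \<and> \<kappa> z \<le> M"
    using assms by (auto simp: elliptic_def)
  have "esssup lebD (\<lambda>z. ereal \<bar>\<kappa> z\<bar>) \<le> ereal M"
  proof (intro esssup_I)
    show "AE z in lebD. ereal \<bar>\<kappa> z\<bar> \<le> ereal M"
      using AE by eventually_elim (use m in auto)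
  qed measurable
  moreover have "esssup lebD (\<lambda>z. ereal (- \<kappa> z)) \<le> ereal (- m)"
  proof (intro esssup_I)
    show "AE z in lebD. ereal (- \<kappa> z) \<le> ereal (- m)"
      using AE by eventually_elim auto
  qed measurable
  then have "ereal m \<le> - esssup lebD (\<lambda>z. ereal (- \<kappa> z))"
    using ereal_minus_le_minus by fastforce
  then have "0 < - esssup lebD (\<lambda>z. ereal (- \<kappa> z))"
    using m by (metis ereal_less(2) less_le_trans)
  ultimately show ?thesis
    by (auto simp: coefficients_def intro: le_less_trans)
qed

lemma elliptic_upper_pos: assumes "elliptic \<kappa> m M" shows "0 < M"
proof -
  have AE: "AE z in lebD. m \<le> \<kappa> z \<and> \<kappa> z \<le> M" and m: "0 < m"
    using assms by (auto simp: elliptic_def)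
  have "AE z in lebD. 0 < M"
    by (rule eventually_mono[OF AE]) (use m in linarith)
  then show ?thesis by simp
qed

lemma energy_estimates:
  assumes \<kappa>: "elliptic \<kappa> m M" and g: "g \<in> L2" and h: "h \<in> L2"
  shows "integrable lebD (\<lambda>z. \<kappa> z * (g z \<bullet> h z))"
    and "\<bar>energy \<kappa> g h\<bar> \<le> M * (L2_norm g * L2_norm h)"
proof -
  note [measurable] = g[THEN L2_measurable] h[THEN L2_measurable]
  have [measurable]: "\<kappa> \<in> borel_measurable lebD" and "0 < m"
    and AE: "AE z in lebD. m \<le> \<kappa> z \<and> \<kappa> z \<le> M"
    using \<kappa> by (auto simp: elliptic_def)
  have bound: "AE z in lebD. norm (\<kappa> z * (g z \<bullet> h z)) \<le> M * (norm (g z) * norm (h z))"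
    using AE
  proof eventually_elim
    case (elim z)
    then show ?case
      using \<open>0 < m\<close> Cauchy_Schwarz_ineq2[of "g z" "h z"] unfolding norm_mult
      by (intro mult_mono) auto
  qed
  have meas: "(\<lambda>z. \<kappa> z * (g z \<bullet> h z)) \<in> borel_measurable lebD" by measurable
  have "0 \<le> M" using elliptic_upper_pos[OF \<kappa>] by simp
  from L2_Cauchy_Schwarz_dominated[OF g h meas bound this]
  show "integrable lebD (\<lambda>z. \<kappa> z * (g z \<bullet> h z))"
    and "\<bar>energy \<kappa> g h\<bar> \<le> M * (L2_norm g * L2_norm h)"
    by (auto simp: energy_def)
qed

lemma energy_coercive:
  assumes \<kappa>: "elliptic \<kappa> m M" and g: "g \<in> L2"
  shows "m * (L2_norm g)\<^sup>2 \<le> energy \<kappa> g g"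
proof -
  have "(\<integral>z. m * (norm (g z))\<^sup>2 \<partial>lebD) \<le> (\<integral>z. \<kappa> z * (g z \<bullet> g z) \<partial>lebD)"
    using \<kappa> L2_integrable[OF g] energy_estimates(1)[OF \<kappa> g g]
    by (intro integral_mono_AE)
      (auto simp: elliptic_def power2_norm_eq_inner elim!: eventually_mono intro!: mult_right_mono)
  then show ?thesis
    by (simp add: energy_def L2_norm_power2)
qed

lemma energy_commute: "energy \<kappa> g h = energy \<kappa> h g"
  by (simp add: energy_def inner_commute)

lemma energy_lincomb:
  assumes \<kappa>: "elliptic \<kappa> m M" and "g \<in> L2" "h \<in> L2" "k \<in> L2"
  shows "energy \<kappa> (\<lambda>z. g z + c *\<^sub>R h z) k = energy \<kappa> g k + c * energy \<kappa> h k"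
proof -
  have "energy \<kappa> (\<lambda>z. g z + c *\<^sub>R h z) k = (\<integral>z. \<kappa> z * (g z \<bullet> k z) + c * (\<kappa> z * (h z \<bullet> k z)) \<partial>lebD)"
    by (simp add: energy_def inner_add_left algebra_simps)
  then show ?thesis
    using assms energy_estimates(1)[OF \<kappa>] by (simp add: energy_def)
qed

lemma energy_diff:
  assumes "elliptic \<kappa> m M" and "g \<in> L2" "h \<in> L2" "k \<in> L2"
  shows "energy \<kappa> (\<lambda>z. g z - h z) k = energy \<kappa> g k - energy \<kappa> h k"
  using energy_lincomb[OF assms, of "-1"] by simp

lemma energy_cong_AE:
  assumes \<kappa>: "\<kappa> \<in> borel_measurable lebD" and "g \<in> L2" "g' \<in> L2" "h \<in> L2" "h' \<in> L2"
    and "AE z in lebD. g z = g' z" "AE z in lebD. h z = h' z"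
  shows "energy \<kappa> g h = energy \<kappa> g' h'"
  unfolding energy_def using assms(2-5)[THEN L2_measurable] assms
  by (intro integral_cong_AE) (auto intro!: borel_measurable_times borel_measurable_inner)

text \<open>The direct method without compactness. If \<open>\<phi>\<close> minimises the quadratic functional up to
  \<open>\<epsilon>\<^sup>2\<close>, then perturbing it along \<open>\<psi>\<close> bounds the residual of the Euler-Lagrange equation by
  \<open>\<epsilon>\<close> times the energy norm of \<open>\<psi>\<close>.\<close>

lemma approximate_minimiser:
  assumes f: "f \<in> V_dual" and \<kappa>: "elliptic \<kappa> m M" and \<epsilon>: "\<epsilon> > 0"
  shows "\<exists>\<phi>\<in>test_functions. \<forall>\<psi>\<in>test_functions.
    (energy \<kappa> (grad \<phi>) (grad \<psi>) - f \<psi>)\<^sup>2 \<le> \<epsilon>\<^sup>2 * energy \<kappa> (grad \<psi>) (grad \<psi>)"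
proof -
  have m: "m > 0" using \<kappa> by (simp add: elliptic_def)
  obtain C where C: "0 \<le> C" "\<And>p. p \<in> V \<Longrightarrow> \<bar>f p\<bar> \<le> C * V_norm p"
    using V_dual_bound[OF f] by metis
  define J where "J \<phi> = energy \<kappa> (grad \<phi>) (grad \<phi>) - 2 * f \<phi>" for \<phi>
  have lower: "- C\<^sup>2 / m \<le> J \<phi>" if \<phi>: "\<phi> \<in> test_functions" for \<phi>
  proof -
    let ?s = "L2_norm (grad \<phi>)"
    have "0 \<le> (m * ?s - C)\<^sup>2 / m" using m by simp
    then have "- C\<^sup>2 / m \<le> m * ?s\<^sup>2 - 2 * (C * ?s)"
      using m by (simp add: power2_eq_square field_simps)
    also have "\<dots> \<le> J \<phi>"
      using energy_coercive[OF \<kappa> test_L2(2)[OF \<phi>]] C(2)[OF test_in_V[OF \<phi>]] V_norm_test[OF \<phi>]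
      by (simp add: J_def)
    finally show ?thesis .
  qed
  obtain \<phi> where "\<phi> 0 \<in> test_functions"
    using box_indicator_limit_of_tests[of "(0, 0)" "(1, 1)"] by auto
  then have ne: "J ` test_functions \<noteq> {}" by blast
  have bdd: "bdd_below (J ` test_functions)"
    using lower by (auto intro!: bdd_belowI2)
  have "Inf (J ` test_functions) < Inf (J ` test_functions) + \<epsilon>\<^sup>2" using \<epsilon> by simp
  then obtain \<phi> where \<phi>: "\<phi> \<in> test_functions" "J \<phi> < Inf (J ` test_functions) + \<epsilon>\<^sup>2"
    using cInf_lessD[OF ne] by blast
  show ?thesis
  proof (intro bexI[OF _ \<phi>(1)] ballI)
    fix \<psi> assume \<psi>: "\<psi> \<in> test_functions"
    define d Q where "d = energy \<kappa> (grad \<phi>) (grad \<psi>) - f \<psi>" and "Q = energy \<kappa> (grad \<psi>) (grad \<psi>)"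
    \<comment> \<open>Along the line through \<open>\<phi>\<close> in direction \<open>\<psi>\<close> the functional is a parabola that falls below
      \<open>J \<phi>\<close> by less than \<open>\<epsilon>\<^sup>2\<close>; \<open>t = - d / Q\<close> is its vertex.\<close>
    have near: "- \<epsilon>\<^sup>2 < 2 * t * d + t\<^sup>2 * Q" for t
    proof -
      have eq: "grad (\<lambda>z. \<phi> z + t * \<psi> z) = (\<lambda>z. grad \<phi> z + t *\<^sub>R grad \<psi> z)"
        by (rule ext) (rule grad_lincomb[OF \<phi>(1) \<psi>])
      note G = test_L2(2)[OF \<phi>(1)] test_L2(2)[OF \<psi>]
      have "J (\<lambda>z. \<phi> z + t * \<psi> z) = J \<phi> + (2 * t * d + t\<^sup>2 * Q)"
        unfolding J_def d_def Q_def eq energy_lincomb[OF \<kappa> G L2_lincomb[OF G]]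
          V_dual_lincomb[OF f test_in_V test_in_V, OF \<phi>(1) \<psi>]
        unfolding energy_commute[of \<kappa> _ "\<lambda>z. grad \<phi> z + t *\<^sub>R grad \<psi> z"]
          energy_lincomb[OF \<kappa> G G(1)] energy_lincomb[OF \<kappa> G G(2)] energy_commute[of \<kappa> "grad \<psi>" "grad \<phi>"]
        by (simp add: algebra_simps power2_eq_square)
      moreover have "Inf (J ` test_functions) \<le> J (\<lambda>z. \<phi> z + t * \<psi> z)"
        by (intro cInf_lower bdd imageI test_lincomb \<phi> \<psi>)
      ultimately show ?thesis using \<phi>(2) by simp
    qed
    have Q: "0 \<le> Q"
    proof -
      have "0 \<le> m * (L2_norm (grad \<psi>))\<^sup>2" using m by simp
      then show ?thesis
        using energy_coercive[OF \<kappa> test_L2(2)[OF \<psi>]] unfolding Q_def by linarith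
    qed
    have "d\<^sup>2 \<le> \<epsilon>\<^sup>2 * Q"
    proof (cases "Q = 0")
      case True
      have "d = 0"
      proof (rule ccontr)
        assume "d \<noteq> 0"
        then show False using near[of "- \<epsilon>\<^sup>2 / d"] True \<epsilon> by simp
      qed
      then show ?thesis using Q by simp
    next
      case False
      then have "Q > 0" using Q by simp
      then show ?thesis
        using near[of "- d / Q"] by (simp add: power2_eq_square field_simps)
    qed
    then show "(energy \<kappa> (grad \<phi>) (grad \<psi>) - f \<psi>)\<^sup>2 \<le> \<epsilon>\<^sup>2 * energy \<kappa> (grad \<psi>) (grad \<psi>)"
      by (simp add: d_def Q_def)
  qed
qed

text \<open>The Lax--Milgram theorem for the diffusion equation. Approximate minimisers are Cauchy in the
  gradient norm because their residuals are small along their own differences, and by Poincare's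
  inequality they are Cauchy in \<open>L\<^sup>2\<close> as well; the limit solves the equation.\<close>

lemma weak_solution_exists:
  assumes f: "f \<in> V_dual" and \<kappa>: "elliptic \<kappa> m M"
  shows "\<exists>p. weak_solution f \<kappa> p"
proof -
  have m: "m > 0" and \<kappa>_m: "\<kappa> \<in> borel_measurable lebD" using \<kappa> by (auto simp: elliptic_def)
  obtain C where C: "0 \<le> C" "\<And>p. p \<in> V \<Longrightarrow> \<bar>f p\<bar> \<le> C * V_norm p"
    using V_dual_bound[OF f] by metis
  \<comment> \<open>Geometric tolerances make the sequence converge with a summable modulus.\<close>
  define \<epsilon> :: "nat \<Rightarrow> real" where "\<epsilon> k = (1 / 2) ^ k" for k
  have \<epsilon>_pos: "\<epsilon> k > 0" for k by (simp add: \<epsilon>_def)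
  have "\<forall>k. \<exists>\<phi>. \<phi> \<in> test_functions \<and> (\<forall>\<psi>\<in>test_functions.
      (energy \<kappa> (grad \<phi>) (grad \<psi>) - f \<psi>)\<^sup>2 \<le> (\<epsilon> k)\<^sup>2 * energy \<kappa> (grad \<psi>) (grad \<psi>))"
    using approximate_minimiser[OF f \<kappa> \<epsilon>_pos] by blast
  then obtain \<phi> where \<phi>: "\<And>k. \<phi> k \<in> test_functions"
    and sq: "\<And>k \<psi>. \<psi> \<in> test_functions \<Longrightarrow>
      (energy \<kappa> (grad (\<phi> k)) (grad \<psi>) - f \<psi>)\<^sup>2 \<le> (\<epsilon> k)\<^sup>2 * energy \<kappa> (grad \<psi>) (grad \<psi>)"
    by metis
  note G = test_L2(2)[OF \<phi>]
  have E_nonneg: "0 \<le> energy \<kappa> (grad \<psi>) (grad \<psi>)" if "\<psi> \<in> test_functions" for \<psi>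
    using energy_coercive[OF \<kappa> test_L2(2)[OF that]] m
    by (smt (verit) mult_nonneg_nonneg zero_le_power2)
  have res: "\<bar>energy \<kappa> (grad (\<phi> k)) (grad \<psi>) - f \<psi>\<bar> \<le> \<epsilon> k * sqrt (energy \<kappa> (grad \<psi>) (grad \<psi>))"
    if \<psi>: "\<psi> \<in> test_functions" for k \<psi>
    using real_sqrt_le_mono[OF sq[OF \<psi>, of k]] \<epsilon>_pos[of k] by (simp add: real_sqrt_mult)
  define e where "e k = 2 / sqrt m * \<epsilon> k" for k
  have grad_close: "L2_norm (\<lambda>z. grad (\<phi> j) z - grad (\<phi> k) z) \<le> e j" if "j \<le> k" for j k
  proof -
    define \<psi> where "\<psi> = (\<lambda>z. \<phi> j z - \<phi> k z)"
    have \<psi>: "\<psi> \<in> test_functions" and grad_\<psi>: "grad \<psi> = (\<lambda>z. grad (\<phi> j) z - grad (\<phi> k) z)"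
      using test_diff[OF \<phi> \<phi>] unfolding \<psi>_def by auto
    define S where "S = sqrt (energy \<kappa> (grad \<psi>) (grad \<psi>))"
    have S: "0 \<le> S" "S\<^sup>2 = energy \<kappa> (grad \<psi>) (grad \<psi>)"
      using E_nonneg[OF \<psi>] by (auto simp: S_def)
    have "\<epsilon> k \<le> \<epsilon> j" using that by (simp add: \<epsilon>_def power_decreasing)
    have "energy \<kappa> (grad \<psi>) (grad \<psi>)
        = (energy \<kappa> (grad (\<phi> j)) (grad \<psi>) - f \<psi>) - (energy \<kappa> (grad (\<phi> k)) (grad \<psi>) - f \<psi>)"
      using energy_diff[OF \<kappa> G[of j] G[of k] test_L2(2)[OF \<psi>]] unfolding grad_\<psi>[symmetric] by linarith
    then have "S\<^sup>2 \<le> \<epsilon> j * S + \<epsilon> k * S"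
      using res[OF \<psi>, of j] res[OF \<psi>, of k] S unfolding S_def[symmetric] by linarith
    also have "\<dots> \<le> 2 * \<epsilon> j * S"
      using mult_right_mono[OF \<open>\<epsilon> k \<le> \<epsilon> j\<close> S(1)] by (simp add: mult.commute)
    finally have "S \<le> 2 * \<epsilon> j"
      using S(1) \<epsilon>_pos[of j] by (cases "S = 0") (auto simp: power2_eq_square)
    have "(sqrt m * L2_norm (grad \<psi>))\<^sup>2 \<le> S\<^sup>2"
      using energy_coercive[OF \<kappa> test_L2(2)[OF \<psi>]] m S by (simp add: power_mult_distrib)
    then have "sqrt m * L2_norm (grad \<psi>) \<le> S"
      using S(1) by (rule power2_le_imp_le)
    then have "sqrt m * L2_norm (grad \<psi>) \<le> 2 * \<epsilon> j"
      using \<open>S \<le> 2 * \<epsilon> j\<close> by simp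
    then show ?thesis
      using m by (simp add: e_def grad_\<psi> field_simps)
  qed
  have close: "L2_norm (\<lambda>z. \<phi> j z - \<phi> k z) \<le> 2 * e j" if "j \<le> k" for j k
  proof -
    have "grad (\<lambda>z. \<phi> j z - \<phi> k z) = (\<lambda>z. grad (\<phi> j) z - grad (\<phi> k) z)"
      by (rule ext) (rule test_diff(2)[OF \<phi> \<phi>])
    then show ?thesis
      using Poincare[OF test_diff(1)[OF \<phi> \<phi>], of j k] grad_close[OF that] by simp
  qed
  have e_sum: "summable e"
    unfolding e_def \<epsilon>_def by (intro summable_mult summable_geometric) auto
  then have e_lim: "e \<longlonglongrightarrow> 0" by (rule summable_LIMSEQ_zero)
  obtain g where g: "g \<in> L2" "\<And>k. L2_norm (\<lambda>z. grad (\<phi> k) z - g z) \<le> e k"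
    using L2_complete[OF G e_sum grad_close] by blast
  obtain p where p: "p \<in> L2" "\<And>k. L2_norm (\<lambda>z. \<phi> k z - p z) \<le> 2 * e k"
    using L2_complete[OF test_L2(1)[OF \<phi>] summable_mult[OF e_sum, of 2] close] by blast
  \<comment> \<open>The weak gradient identity passes to the limit because both sides are continuous in \<open>L\<^sup>2\<close>.\<close>
  have wg: "is_weak_grad p g"
    unfolding is_weak_grad_def
  proof (intro conjI ballI g(1))
    fix \<psi> assume \<psi>: "\<psi> \<in> test_functions"
    have "(\<lambda>k. \<integral>z. \<phi> k z *\<^sub>R grad \<psi> z \<partial>lebD) \<longlonglongrightarrow> (\<integral>z. p z *\<^sub>R grad \<psi> z \<partial>lebD)"
    proof (rule metric_tendsto_imp_tendsto)
      show "(\<lambda>k. 2 * e k * L2_norm (grad \<psi>)) \<longlonglongrightarrow> 0"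
        using e_lim by (auto intro!: tendsto_eq_intros)
      show "\<forall>\<^sub>F k in sequentially. dist (\<integral>z. \<phi> k z *\<^sub>R grad \<psi> z \<partial>lebD) (\<integral>z. p z *\<^sub>R grad \<psi> z \<partial>lebD)
          \<le> dist (2 * e k * L2_norm (grad \<psi>)) 0"
      proof (rule always_eventually, rule allI)
        fix k
        have "(\<integral>z. \<phi> k z *\<^sub>R grad \<psi> z \<partial>lebD) - (\<integral>z. p z *\<^sub>R grad \<psi> z \<partial>lebD)
            = (\<integral>z. (\<phi> k z - p z) *\<^sub>R grad \<psi> z \<partial>lebD)"
          unfolding scaleR_diff_left
          by (rule Bochner_Integration.integral_diff[symmetric])
            (rule L2_integrable_scaleR(1) test_L2 \<phi> \<psi> p(1))+
        also have "norm \<dots> \<le> L2_norm (\<lambda>z. \<phi> k z - p z) * L2_norm (grad \<psi>)"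
          by (rule L2_integrable_scaleR(2)[OF L2_diff[OF test_L2(1)[OF \<phi>] p(1)] test_L2(2)[OF \<psi>]])
        also have "\<dots> \<le> 2 * e k * L2_norm (grad \<psi>)"
          by (intro mult_right_mono p(2)) simp
        finally show "dist (\<integral>z. \<phi> k z *\<^sub>R grad \<psi> z \<partial>lebD) (\<integral>z. p z *\<^sub>R grad \<psi> z \<partial>lebD)
            \<le> dist (2 * e k * L2_norm (grad \<psi>)) 0"
          by (simp add: dist_norm)
      qed
    qed
    moreover have "(\<lambda>k. - (\<integral>z. \<psi> z *\<^sub>R grad (\<phi> k) z \<partial>lebD)) \<longlonglongrightarrow> - (\<integral>z. \<psi> z *\<^sub>R g z \<partial>lebD)"
    proof (rule tendsto_minus, rule metric_tendsto_imp_tendsto)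
      show "(\<lambda>k. L2_norm \<psi> * e k) \<longlonglongrightarrow> 0"
        using e_lim by (auto intro!: tendsto_eq_intros)
      show "\<forall>\<^sub>F k in sequentially. dist (\<integral>z. \<psi> z *\<^sub>R grad (\<phi> k) z \<partial>lebD) (\<integral>z. \<psi> z *\<^sub>R g z \<partial>lebD)
          \<le> dist (L2_norm \<psi> * e k) 0"
      proof (rule always_eventually, rule allI)
        fix k
        have "(\<integral>z. \<psi> z *\<^sub>R grad (\<phi> k) z \<partial>lebD) - (\<integral>z. \<psi> z *\<^sub>R g z \<partial>lebD)
            = (\<integral>z. \<psi> z *\<^sub>R (grad (\<phi> k) z - g z) \<partial>lebD)"
          unfolding scaleR_diff_right
          by (rule Bochner_Integration.integral_diff[symmetric])
            (rule L2_integrable_scaleR(1) test_L2 \<phi> \<psi> g(1))+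
        also have "norm \<dots> \<le> L2_norm \<psi> * L2_norm (\<lambda>z. grad (\<phi> k) z - g z)"
          by (rule L2_integrable_scaleR(2)[OF test_L2(1)[OF \<psi>] L2_diff[OF G g(1)]])
        also have "\<dots> \<le> L2_norm \<psi> * e k"
          by (intro mult_left_mono g(2)) simp
        finally show "dist (\<integral>z. \<psi> z *\<^sub>R grad (\<phi> k) z \<partial>lebD) (\<integral>z. \<psi> z *\<^sub>R g z \<partial>lebD)
            \<le> dist (L2_norm \<psi> * e k) 0"
          by (simp add: dist_norm)
      qed
    qed
    moreover have "(\<integral>z. \<phi> k z *\<^sub>R grad \<psi> z \<partial>lebD) = - (\<integral>z. \<psi> z *\<^sub>R grad (\<phi> k) z \<partial>lebD)" for k
      using test_is_weak_grad[OF \<phi>[of k]] \<psi> by (simp add: is_weak_grad_def)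
    ultimately show "(\<integral>z. p z *\<^sub>R grad \<psi> z \<partial>lebD) = - (\<integral>z. \<psi> z *\<^sub>R g z \<partial>lebD)"
      by (simp add: LIMSEQ_unique)
  qed
  have pV: "p \<in> V"
  proof (subst V_iff_approximable[OF p(1) wg], intro allI impI)
    fix \<delta> :: real assume "\<delta> > 0"
    then have "\<forall>\<^sub>F k in sequentially. dist (e k) 0 < \<delta> / 2"
      using e_lim[unfolded tendsto_iff] by (metis half_gt_zero)
    then obtain k where k: "\<bar>e k\<bar> < \<delta> / 2"
      by (auto simp: eventually_sequentially)
    then show "\<exists>\<phi>\<in>test_functions. L2_norm (\<lambda>z. p z - \<phi> z) < \<delta> \<and> L2_norm (\<lambda>z. g z - grad \<phi> z) < \<delta>"
      using p(2)[of k] g(2)[of k]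
      by (intro bexI[OF _ \<phi>[of k]])
        (auto simp: L2_norm_minus_commute[of p] L2_norm_minus_commute[of g])
  qed
  have eq_test: "energy \<kappa> g (grad \<psi>) = f \<psi>" if \<psi>: "\<psi> \<in> test_functions" for \<psi>
  proof -
    let ?S = "sqrt (energy \<kappa> (grad \<psi>) (grad \<psi>))" and ?N = "L2_norm (grad \<psi>)"
    have bound: "\<bar>energy \<kappa> g (grad \<psi>) - f \<psi>\<bar> \<le> \<epsilon> k * ?S + M * (e k * ?N)" for k
    proof -
      have "\<bar>energy \<kappa> (\<lambda>z. grad (\<phi> k) z - g z) (grad \<psi>)\<bar> \<le> M * (L2_norm (\<lambda>z. grad (\<phi> k) z - g z) * ?N)"
        by (rule energy_estimates(2)[OF \<kappa> L2_diff[OF G g(1)] test_L2(2)[OF \<psi>]])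
      also have "\<dots> \<le> M * (e k * ?N)"
        using elliptic_upper_pos[OF \<kappa>] by (intro mult_left_mono mult_right_mono g(2)) auto
      finally show ?thesis
        using res[OF \<psi>, of k] energy_diff[OF \<kappa> G g(1) test_L2(2)[OF \<psi>], of k] by linarith
    qed
    have "\<epsilon> \<longlonglongrightarrow> 0"
      unfolding \<epsilon>_def by (intro LIMSEQ_power_zero) simp
    then have "(\<lambda>k. \<epsilon> k * ?S + M * (e k * ?N)) \<longlonglongrightarrow> 0"
      using e_lim by (auto intro!: tendsto_eq_intros)
    then have "\<bar>energy \<kappa> g (grad \<psi>) - f \<psi>\<bar> \<le> 0"
      by (rule LIMSEQ_le_const) (use bound in auto)
    then show ?thesis by simp
  qed
  \<comment> \<open>Both sides are bounded functionals on \<open>V\<close>, and test functions are dense in \<open>V\<close>.\<close>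
  have "energy \<kappa> (weak_grad p) (weak_grad v) = f v" if v: "v \<in> V" for v
  proof -
    have "\<bar>energy \<kappa> g (weak_grad v) - f v\<bar> \<le> \<delta>" if "\<delta> > 0" for \<delta>
    proof -
      define \<eta> where "\<eta> = \<delta> / (M * L2_norm g + C + 1)"
      have D: "M * L2_norm g + C + 1 > 0"
        using elliptic_upper_pos[OF \<kappa>] C(1) by (simp add: add_nonneg_pos)
      then have "\<eta> > 0" using \<open>\<delta> > 0\<close> by (simp add: \<eta>_def)
      then obtain \<psi> where \<psi>: "\<psi> \<in> test_functions" "L2_norm (\<lambda>z. weak_grad v z - grad \<psi> z) < \<eta>"
        using V_approx[OF v] by metis
      have "energy \<kappa> g (weak_grad v) - f v
          = energy \<kappa> (\<lambda>z. weak_grad v z - grad \<psi> z) g - f (\<lambda>z. v z - \<psi> z)"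
        using energy_diff[OF \<kappa> V_D(3)[OF v] test_L2(2)[OF \<psi>(1)] g(1)] eq_test[OF \<psi>(1)]
          V_dual_diff[OF f v test_in_V[OF \<psi>(1)]]
        by (simp add: energy_commute[of \<kappa> g])
      moreover have "\<bar>energy \<kappa> (\<lambda>z. weak_grad v z - grad \<psi> z) g\<bar> \<le> M * (\<eta> * L2_norm g)"
      proof (rule order_trans[OF energy_estimates(2)[OF \<kappa> L2_diff[OF V_D(3)[OF v] test_L2(2)[OF \<psi>(1)]] g(1)]])
        show "M * (L2_norm (\<lambda>z. weak_grad v z - grad \<psi> z) * L2_norm g) \<le> M * (\<eta> * L2_norm g)"
          using elliptic_upper_pos[OF \<kappa>] \<psi>(2) by (intro mult_left_mono mult_right_mono) auto
      qed
      moreover have "\<bar>f (\<lambda>z. v z - \<psi> z)\<bar> \<le> C * \<eta>"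
        using C(2)[OF V_diff(1)[OF v test_in_V[OF \<psi>(1)]]] V_norm_diff_test[OF v \<psi>(1)] \<psi>(2)
          mult_left_mono[of "L2_norm (\<lambda>z. weak_grad v z - grad \<psi> z)" \<eta> C] C(1) by auto
      ultimately have "\<bar>energy \<kappa> g (weak_grad v) - f v\<bar> \<le> M * (\<eta> * L2_norm g) + C * \<eta>"
        by linarith
      also have "\<dots> \<le> (M * L2_norm g + C + 1) * \<eta>"
        using \<open>\<eta> > 0\<close> by (simp add: algebra_simps)
      also have "\<dots> = \<delta>"
        using D by (simp add: \<eta>_def)
      finally show ?thesis .
    qed
    then have "\<bar>energy \<kappa> g (weak_grad v) - f v\<bar> \<le> 0"
      by (rule field_le_epsilon, subst add_0) blast
    moreover have "energy \<kappa> (weak_grad p) (weak_grad v) = energy \<kappa> g (weak_grad v)"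
      by (rule energy_cong_AE[OF \<kappa>_m V_D(3)[OF pV] g(1) V_D(3)[OF v] V_D(3)[OF v] weak_grad_AE(1)[OF wg]]) simp
    ultimately show ?thesis by simp
  qed
  then have "weak_solution f \<kappa> p"
    using pV elliptic_coefficients[OF \<kappa>] by (simp add: weak_solution_def energy_def)
  then show ?thesis by (rule exI[of _ p])
qed

lemma weak_solution_D:
  assumes "weak_solution f \<kappa> p"
  shows "p \<in> V" "v \<in> V \<Longrightarrow> energy \<kappa> (weak_grad p) (weak_grad v) = f v"
  using assms by (auto simp: weak_solution_def energy_def)

text \<open>The equation tested with the solution itself.\<close>

lemma weak_solution_norm_bound:
  assumes C: "\<And>p. p \<in> V \<Longrightarrow> \<bar>f p\<bar> \<le> C * V_norm p" and C0: "0 \<le> C"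
    and \<kappa>: "elliptic \<kappa> m M" and p: "weak_solution f \<kappa> p"
  shows "V_norm p \<le> C / m"
proof -
  note pV = weak_solution_D(1)[OF p]
  have m: "m > 0" using \<kappa> by (simp add: elliptic_def)
  have "m * (V_norm p)\<^sup>2 \<le> C * V_norm p"
    using energy_coercive[OF \<kappa> V_D(3)[OF pV]] weak_solution_D(2)[OF p pV] C[OF pV]
    unfolding V_norm_def by linarith
  then show ?thesis
    using V_norm_nonneg[of p] m C0 by (cases "V_norm p = 0") (auto simp: power2_eq_square field_simps)
qed

text \<open>Subtracting the two equations and testing with the difference of the solutions.\<close>

lemma weak_solution_perturbation:
  assumes \<kappa>: "elliptic \<kappa> m M" and \<kappa>': "elliptic \<kappa>' m' M'"
    and p: "weak_solution f \<kappa> p" and p': "weak_solution f \<kappa>' p'"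
  shows "V_norm (\<lambda>z. p' z - p z) \<le> L2_norm (\<lambda>z. (\<kappa> z - \<kappa>' z) *\<^sub>R weak_grad p z) / m'"
proof -
  note pV = weak_solution_D(1)[OF p] weak_solution_D(1)[OF p']
  define w where "w = (\<lambda>z. p' z - p z)"
  have w: "w \<in> V" "AE z in lebD. weak_grad w z = weak_grad p' z - weak_grad p z"
    using V_diff[OF pV(2) pV(1)] by (auto simp: w_def)
  have m': "m' > 0" and [measurable]: "\<kappa>' \<in> borel_measurable lebD" "\<kappa> \<in> borel_measurable lebD"
    using \<kappa> \<kappa>' by (auto simp: elliptic_def)
  note [measurable] = V_D(3)[OF pV(1), THEN L2_measurable] V_D(3)[OF w(1), THEN L2_measurable]
  define r where "r = (\<lambda>z. (\<kappa> z - \<kappa>' z) *\<^sub>R weak_grad p z)"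
  have r: "r \<in> L2"
  proof -
    have bound: "AE z in lebD. norm ((norm (r z))\<^sup>2) \<le> norm ((M + M')\<^sup>2 * (norm (weak_grad p z))\<^sup>2)"
    proof -
      have "AE z in lebD. \<bar>\<kappa> z - \<kappa>' z\<bar> \<le> M + M'"
        using \<kappa> \<kappa>' unfolding elliptic_def by (auto elim!: eventually_elim2)
      then show ?thesis
      proof eventually_elim
        case (elim z)
        then have "\<bar>\<kappa> z - \<kappa>' z\<bar>\<^sup>2 \<le> (M + M')\<^sup>2" by (intro power_mono) auto
        then show ?case
          by (auto simp: r_def power_mult_distrib intro!: mult_right_mono)
      qed
    qed
    have [measurable]: "r \<in> borel_measurable lebD"
      unfolding r_def by measurable
    have "integrable lebD (\<lambda>z. (M + M')\<^sup>2 * (norm (weak_grad p z))\<^sup>2)"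
      using L2_integrable[OF V_D(3)[OF pV(1)]] by simp
    then have "integrable lebD (\<lambda>z. (norm (r z))\<^sup>2)"
      by (rule Bochner_Integration.integrable_bound[OF _ _ bound]) measurable
    then show ?thesis by (simp add: L2_def)
  qed
  have "energy \<kappa>' (weak_grad w) (weak_grad w)
      = energy \<kappa>' (\<lambda>z. weak_grad p' z - weak_grad p z) (weak_grad w)"
    using w by (intro energy_cong_AE V_D L2_diff pV) auto
  also have "\<dots> = f w - energy \<kappa>' (weak_grad p) (weak_grad w)"
    using energy_diff[OF \<kappa>' V_D(3)[OF pV(2)] V_D(3)[OF pV(1)] V_D(3)[OF w(1)]]
      weak_solution_D(2)[OF p' w(1)] by simp
  also have "\<dots> = energy \<kappa> (weak_grad p) (weak_grad w) - energy \<kappa>' (weak_grad p) (weak_grad w)"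
    using weak_solution_D(2)[OF p w(1)] by simp
  also have "\<dots> = (\<integral>z. r z \<bullet> weak_grad w z \<partial>lebD)"
    unfolding energy_def
    using energy_estimates(1)[OF \<kappa> V_D(3)[OF pV(1)] V_D(3)[OF w(1)]]
      energy_estimates(1)[OF \<kappa>' V_D(3)[OF pV(1)] V_D(3)[OF w(1)]]
    by (simp add: r_def left_diff_distrib flip: Bochner_Integration.integral_diff)
  also have "\<dots> \<le> L2_norm r * L2_norm (weak_grad w)"
    using L2_Cauchy_Schwarz_dominated(2)[OF r V_D(3)[OF w(1)], of "\<lambda>z. r z \<bullet> weak_grad w z" 1]
      L2_measurable[OF r] by (auto simp: Cauchy_Schwarz_ineq2)
  finally have "m' * (V_norm w)\<^sup>2 \<le> L2_norm r * V_norm w"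
    using energy_coercive[OF \<kappa>' V_D(3)[OF w(1)]] by (simp add: V_norm_def)
  then have "m' * V_norm w \<le> L2_norm r"
    using V_norm_nonneg[of w] by (cases "V_norm w = 0") (auto simp: power2_eq_square)
  then show ?thesis
    using m' by (simp add: w_def r_def field_simps)
qed

text \<open>The perturbation estimate compares with the gradient of the limiting solution, which does not
  depend on the index, so dominated convergence applies.\<close>

lemma weak_solution_continuous:
  assumes \<kappa>: "elliptic \<kappa> m M" and \<kappa>': "\<And>k. elliptic (\<kappa>' k) m M"
    and lim: "AE z in lebD. (\<lambda>k. \<kappa>' k z) \<longlonglongrightarrow> \<kappa> z"
    and p: "weak_solution f \<kappa> p" and p': "\<And>k. weak_solution f (\<kappa>' k) (p' k)"
    and l: "l \<in> V_dual"
  shows "(\<lambda>k. l (p' k)) \<longlonglongrightarrow> l p"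
proof -
  note pV = weak_solution_D(1)[OF p] weak_solution_D(1)[OF p']
  have m: "m > 0" and [measurable]: "\<And>k. \<kappa>' k \<in> borel_measurable lebD" "\<kappa> \<in> borel_measurable lebD"
    using \<kappa> \<kappa>' by (auto simp: elliptic_def)
  note [measurable] = V_D(3)[OF pV(1), THEN L2_measurable]
  let ?r = "\<lambda>k z. (\<kappa> z - \<kappa>' k z) *\<^sub>R weak_grad p z"
  have "(\<lambda>k. \<integral>z. (norm (?r k z))\<^sup>2 \<partial>lebD) \<longlonglongrightarrow> (\<integral>z. 0 \<partial>lebD)"
  proof (rule integral_dominated_convergence)
    show "integrable lebD (\<lambda>z. M\<^sup>2 * (norm (weak_grad p z))\<^sup>2)"
      using L2_integrable[OF V_D(3)[OF pV(1)]] by simp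
    show "AE z in lebD. (\<lambda>k. (norm (?r k z))\<^sup>2) \<longlonglongrightarrow> 0"
      using lim by eventually_elim (auto intro!: tendsto_eq_intros)
    show "AE z in lebD. norm ((norm (?r k z))\<^sup>2) \<le> M\<^sup>2 * (norm (weak_grad p z))\<^sup>2" for k
    proof -
      have "AE z in lebD. \<bar>\<kappa> z - \<kappa>' k z\<bar> \<le> M"
        using \<kappa> \<kappa>'[of k] unfolding elliptic_def by (auto elim!: eventually_elim2)
      then show ?thesis
      proof eventually_elim
        case (elim z)
        then have "\<bar>\<kappa> z - \<kappa>' k z\<bar>\<^sup>2 \<le> M\<^sup>2" by (intro power_mono) auto
        then show ?case
          by (auto simp: power_mult_distrib intro!: mult_right_mono)
      qed
    qed
  qed measurable
  then have "(\<lambda>k. L2_norm (?r k)) \<longlonglongrightarrow> sqrt 0"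
    unfolding L2_norm_def by (intro tendsto_real_sqrt) simp
  then have r: "(\<lambda>k. L2_norm (?r k)) \<longlonglongrightarrow> 0" by simp
  obtain C where C: "0 \<le> C" "\<And>p. p \<in> V \<Longrightarrow> \<bar>l p\<bar> \<le> C * V_norm p"
    using V_dual_bound[OF l] by metis
  have "norm (l (p' k) - l p) \<le> C * (L2_norm (?r k) / m)" for k
  proof -
    have "l (p' k) - l p = l (\<lambda>z. p' k z - p z)"
      using V_dual_diff[OF l pV(2) pV(1)] by simp
    also have "\<bar>\<dots>\<bar> \<le> C * V_norm (\<lambda>z. p' k z - p z)"
      by (rule C(2)[OF V_diff(1)[OF pV(2) pV(1)]])
    also have "\<dots> \<le> C * (L2_norm (?r k) / m)"
      by (rule mult_left_mono[OF weak_solution_perturbation[OF \<kappa> \<kappa>' p p'] C(1)])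
    finally show ?thesis by simp
  qed
  then have bound: "\<forall>\<^sub>F k in sequentially. norm (l (p' k) - l p) \<le> C * (L2_norm (?r k) / m)"
    by (intro always_eventually allI)
  have "(\<lambda>k. C * (L2_norm (?r k) / m)) \<longlonglongrightarrow> 0"
    using r m by (auto intro!: tendsto_eq_intros)
  with bound have "(\<lambda>k. l (p' k) - l p) \<longlonglongrightarrow> 0"
    by (rule Lim_null_comparison)
  then show ?thesis by (rule LIM_zero_cancel)
qed

section \<open>The forward map\<close>

text \<open>What the well-posedness argument uses of a geometry: almost every point of the square lies in
  exactly one region, and in the same one for all nearby parameters.\<close>

definition stable_regions :: "nat \<Rightarrow> 'g::topological_space set \<Rightarrow> ('g \<Rightarrow> nat \<Rightarrow> point set) \<Rightarrow> bool" where
  "stable_regions n Ug R \<longleftrightarrow> (\<forall>g\<in>Ug. (\<forall>i. R g i \<in> sets borel) \<and>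
     (AE z in lebD. \<exists>i\<in>{1..n}. \<forall>\<^sub>F g' in inf (nhds g) (principal Ug). \<forall>j\<in>{1..n}. z \<in> R g' j \<longleftrightarrow> j = i))"

lemma permeability_eq:
  assumes "i \<in> {1..n}" "\<forall>j\<in>{1..n}. z \<in> R j \<longleftrightarrow> j = i"
  shows "permeability n R k z = k i"
proof -
  have "permeability n R k z = (\<Sum>j=1..n. if j = i then k j else 0)"
    unfolding permeability_def using assms(2) by (intro sum.cong) (auto simp: indicator_def)
  then show ?thesis using assms(1) by simp
qed

text \<open>A parameter is itself one of its neighbours, so stability of the regions already says that almost
  every point lies in exactly one of them.\<close>

lemma elliptic_permeability:
  assumes R: "stable_regions n Ug R" and g: "g \<in> Ug"
    and m: "0 < m" and k: "\<And>i. i \<in> {1..n} \<Longrightarrow> m \<le> k i \<and> k i \<le> M"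
  shows "elliptic (permeability n (R g) k) m M"
proof -
  have [measurable]: "\<And>i. R g i \<in> sets borel"
    using R g by (auto simp: stable_regions_def)
  have "permeability n (R g) k \<in> borel_measurable lebD"
    unfolding permeability_def[abs_def] by (intro borel_measurable_lebD) measurable
  moreover have "AE z in lebD. \<exists>i\<in>{1..n}. \<forall>\<^sub>F g' in inf (nhds g) (principal Ug). \<forall>j\<in>{1..n}. z \<in> R g' j \<longleftrightarrow> j = i"
    using R g by (auto simp: stable_regions_def)
  then have "AE z in lebD. m \<le> permeability n (R g) k z \<and> permeability n (R g) k z \<le> M"
  proof eventually_elim
    case (elim z)
    then obtain i where i: "i \<in> {1..n}"
      and ev: "\<forall>\<^sub>F g' in inf (nhds g) (principal Ug). \<forall>j\<in>{1..n}. z \<in> R g' j \<longleftrightarrow> j = i"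
      by blast
    have "\<forall>j\<in>{1..n}. z \<in> R g j \<longleftrightarrow> j = i"
      using eventually_nhds_x_imp_x[OF ev[unfolded eventually_inf_principal]] g by blast
    then show ?case
      using permeability_eq[OF i] k[OF i] by auto
  qed
  ultimately show ?thesis
    using m by (simp add: elliptic_def)
qed

abbreviation parameters :: "'g set \<Rightarrow> nat \<Rightarrow> ('g \<times> (nat \<Rightarrow> real)) set" where
  "parameters Ug n \<equiv> Ug \<times> ({1..n} \<rightarrow>\<^sub>E {0<..})"

text \<open>The energy estimate bounds the solution by the reciprocal of the smallest permeability; replacing
  that reciprocal by the sum of all of them makes the bound a sum of functions of one coordinate.\<close>

lemma forward_map_bound:
  assumes f: "f \<in> V_dual" and l: "\<And>j. l j \<in> V_dual" and R: "stable_regions n Ug R" and n: "1 \<le> n"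
  shows "\<exists>K\<ge>0. \<forall>u\<in>parameters Ug n. norm (forward_map f l n R u :: real ^ 'j::finite) \<le> K * (\<Sum>i=1..n. 1 / snd u i)"
proof -
  obtain C where C: "0 \<le> C" "\<And>p. p \<in> V \<Longrightarrow> \<bar>f p\<bar> \<le> C * V_norm p"
    using V_dual_bound[OF f] by metis
  have "\<forall>j. \<exists>c\<ge>0. \<forall>p\<in>V. \<bar>l j p\<bar> \<le> c * V_norm p"
    using V_dual_bound[OF l] by metis
  then obtain c where c: "\<And>j. 0 \<le> c j" "\<And>j p. p \<in> V \<Longrightarrow> \<bar>l j p\<bar> \<le> c j * V_norm p"
    by metis
  have "norm (forward_map f l n R u :: real ^ 'j) \<le> ((\<Sum>j\<in>UNIV. c j) * C) * (\<Sum>i=1..n. 1 / snd u i)"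
    if u: "u \<in> parameters Ug n" for u
  proof -
    let ?I = "{1..n}"
    have pos: "0 < snd u i" if "i \<in> ?I" for i
      using u that by (auto simp: PiE_def Pi_def mem_Times_iff)
    have ne: "snd u ` ?I \<noteq> {}" "finite (snd u ` ?I)" using n by auto
    define m M where "m = Min (snd u ` ?I)" and "M = Max (snd u ` ?I)"
    have "m \<in> snd u ` ?I" unfolding m_def using ne by (intro Min_in)
    then obtain i where i: "i \<in> ?I" "m = snd u i" by blast
    have m: "0 < m" using i pos by simp
    have ell: "elliptic (permeability n (R (fst u)) (snd u)) m M"
      using u m ne by (intro elliptic_permeability[OF R]) (auto simp: m_def M_def mem_Times_iff)
    let ?p = "solution_map f (permeability n (R (fst u)) (snd u))"
    have p: "weak_solution f (permeability n (R (fst u)) (snd u)) ?p"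
      unfolding solution_map_def using weak_solution_exists[OF f ell] by (rule someI_ex)
    have "1 / m \<le> (\<Sum>i=1..n. 1 / snd u i)"
      unfolding i(2) using i(1) pos by (intro member_le_sum) (auto intro: less_imp_le)
    then have "V_norm ?p \<le> C * (\<Sum>i=1..n. 1 / snd u i)"
      using weak_solution_norm_bound[OF C(2,1) ell p] mult_left_mono[OF _ C(1)] by fastforce
    then have "\<bar>l j ?p\<bar> \<le> c j * (C * (\<Sum>i=1..n. 1 / snd u i))" for j
      using c(2)[OF weak_solution_D(1)[OF p], of j] mult_left_mono[OF _ c(1)[of j]] order_trans by blast
    then have "(\<Sum>j\<in>UNIV. \<bar>l j ?p\<bar>) \<le> (\<Sum>j\<in>UNIV. c j * (C * (\<Sum>i=1..n. 1 / snd u i)))"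
      by (intro sum_mono)
    moreover have "norm (forward_map f l n R u) \<le> (\<Sum>j\<in>UNIV. \<bar>l j ?p\<bar>)"
      using norm_le_l1_cart[of "forward_map f l n R u"] by (simp add: forward_map_def)
    ultimately show ?thesis
      by (simp add: sum_distrib_right mult.assoc)
  qed
  moreover have "0 \<le> (\<Sum>j\<in>UNIV. c j) * C"
    using c(1) C(1) by (intro mult_nonneg_nonneg sum_nonneg) auto
  ultimately show ?thesis by blast
qed

text \<open>Along a convergent sequence of parameters the coefficients converge almost everywhere, since the
  region containing a point is eventually constant, and they eventually share ellipticity bounds.\<close>

lemma forward_map_continuous:
  fixes Ug :: "'g::{first_countable_topology, t2_space} set" and l :: "'j::finite \<Rightarrow> (point \<Rightarrow> real) \<Rightarrow> real"
  assumes f: "f \<in> V_dual" and l: "\<And>j. l j \<in> V_dual" and R: "stable_regions n Ug R" and n: "1 \<le> n"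
  shows "continuous_on (parameters Ug n) (forward_map f l n R)"
proof (rule continuous_on_sequentiallyI)
  fix u a assume u: "\<forall>k. u k \<in> parameters Ug n" and a: "a \<in> parameters Ug n" and lim: "u \<longlonglongrightarrow> a"
  let ?I = "{1..n}"
  have fst_lim: "filterlim (\<lambda>k. fst (u k)) (inf (nhds (fst a)) (principal Ug)) sequentially"
    using u tendsto_fst[OF lim] by (auto simp: filterlim_inf filterlim_principal mem_Times_iff)
  have snd_lim: "(\<lambda>k. snd (u k) i) \<longlonglongrightarrow> snd a i" for i
    using continuous_on_tendsto_compose[OF continuous_on_product_coordinates tendsto_snd[OF lim], of i] by simp
  have pos: "0 < snd a i" if "i \<in> ?I" for i
    using a that by (auto simp: PiE_def Pi_def mem_Times_iff)
  have ne: "snd a ` ?I \<noteq> {}" "finite (snd a ` ?I)" using n by auto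
  define m M where "m = Min (snd a ` ?I) / 2" and "M = Max (snd a ` ?I) + 1"
  have m: "0 < m" and a_bounds: "i \<in> ?I \<Longrightarrow> m < snd a i \<and> snd a i < M" for i
  proof -
    show "0 < m" using ne pos by (simp add: m_def)
    assume "i \<in> ?I"
    then have "Min (snd a ` ?I) \<le> snd a i" "snd a i \<le> Max (snd a ` ?I)"
      using ne by auto
    then show "m < snd a i \<and> snd a i < M"
      using \<open>0 < m\<close> unfolding m_def M_def by linarith
  qed
  have "\<forall>\<^sub>F k in sequentially. \<forall>i\<in>?I. m < snd (u k) i \<and> snd (u k) i < M"
    by (intro eventually_ball_finite ballI eventually_conj order_tendstoD[OF snd_lim])
      (use a_bounds in auto)
  then obtain N where N: "\<And>k i. k \<ge> N \<Longrightarrow> i \<in> ?I \<Longrightarrow> m < snd (u k) i \<and> snd (u k) i < M"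
    unfolding eventually_sequentially by blast
  define \<kappa> where "\<kappa> v = permeability n (R (fst v)) (snd v)" for v
  have ell: "elliptic (\<kappa> (u (k + N))) m M" for k
  proof -
    have "fst (u (k + N)) \<in> Ug" using u by (auto simp: mem_Times_iff)
    moreover have "m \<le> snd (u (k + N)) i \<and> snd (u (k + N)) i \<le> M" if "i \<in> ?I" for i
      using N[of "k + N" i] that by auto
    ultimately show ?thesis
      unfolding \<kappa>_def by (intro elliptic_permeability[OF R] m)
  qed
  have ell_a: "elliptic (\<kappa> a) m M"
  proof -
    have "fst a \<in> Ug" using a by (auto simp: mem_Times_iff)
    moreover have "m \<le> snd a i \<and> snd a i \<le> M" if "i \<in> ?I" for i
      using a_bounds[OF that] by auto
    ultimately show ?thesis
      unfolding \<kappa>_def by (intro elliptic_permeability[OF R] m)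
  qed
  have sol: "weak_solution f \<kappa>' (solution_map f \<kappa>')" if "elliptic \<kappa>' m M" for \<kappa>'
    unfolding solution_map_def using weak_solution_exists[OF f that] by (rule someI_ex)
  have "AE z in lebD. \<exists>i\<in>?I. \<forall>\<^sub>F g' in inf (nhds (fst a)) (principal Ug). \<forall>j\<in>?I. z \<in> R g' j \<longleftrightarrow> j = i"
    using R a by (auto simp: stable_regions_def mem_Times_iff)
  then have \<kappa>_lim: "AE z in lebD. (\<lambda>k. \<kappa> (u (k + N)) z) \<longlonglongrightarrow> \<kappa> a z"
  proof eventually_elim
    case (elim z)
    then obtain i where i: "i \<in> ?I"
      and ev: "\<forall>\<^sub>F g' in inf (nhds (fst a)) (principal Ug). \<forall>j\<in>?I. z \<in> R g' j \<longleftrightarrow> j = i"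
      by blast
    have "fst a \<in> Ug" using a by (auto simp: mem_Times_iff)
    then have "\<forall>j\<in>?I. z \<in> R (fst a) j \<longleftrightarrow> j = i"
      using eventually_nhds_x_imp_x[OF ev[unfolded eventually_inf_principal]] by blast
    then have \<kappa>_a: "\<kappa> a z = snd a i"
      unfolding \<kappa>_def by (rule permeability_eq[OF i])
    have "\<forall>\<^sub>F k in sequentially. \<forall>j\<in>?I. z \<in> R (fst (u k)) j \<longleftrightarrow> j = i"
      using fst_lim ev by (rule eventually_compose_filterlim[rotated])
    then have "\<forall>\<^sub>F k in sequentially. snd (u k) i = \<kappa> (u k) z"
      by (rule eventually_mono) (simp add: \<kappa>_def permeability_eq[OF i])
    with snd_lim have "(\<lambda>k. \<kappa> (u k) z) \<longlonglongrightarrow> \<kappa> a z"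
      unfolding \<kappa>_a by (rule Lim_transform_eventually)
    then show ?case by (rule LIMSEQ_ignore_initial_segment)
  qed
  have "(\<lambda>k. l j (solution_map f (\<kappa> (u (k + N))))) \<longlonglongrightarrow> l j (solution_map f (\<kappa> a))" for j
    by (rule weak_solution_continuous[OF ell_a ell \<kappa>_lim sol[OF ell_a] sol[OF ell] l])
  then have "(\<lambda>k. l j (solution_map f (\<kappa> (u k)))) \<longlonglongrightarrow> l j (solution_map f (\<kappa> a))" for j
    by (rule LIMSEQ_offset)
  then show "(\<lambda>k. forward_map f l n R (u k)) \<longlonglongrightarrow> forward_map f l n R a"
    unfolding forward_map_def \<kappa>_def by (intro tendsto_vec_lambda)
qed

text \<open>By Fubini's theorem: every vertical section of the graph is a single point.\<close>

lemma AE_not_on_graph: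
  assumes [measurable]: "\<phi> \<in> borel_measurable borel"
  shows "AE z in lebD. snd z \<noteq> \<phi> (fst z)" (is "AE z in _. ?P z")
proof -
  have "AE x in lborel. AE y in lborel. y \<noteq> \<phi> x"
    by (intro AE_I2 AE_lborel_singleton)
  then have "AE z in lborel \<Otimes>\<^sub>M lborel. snd z \<noteq> \<phi> (fst z)"
    by (subst (asm) lborel_pair.AE_pair_iff) measurable
  then have "AE z in lborel. ?P z"
    unfolding lborel_prod .
  then show ?thesis
    by (subst AE_restrict_space_iff) auto
qed

lemma AE_not_on_vertical: "AE z in lebD. fst z \<noteq> c" (is "AE z in _. ?P z")
proof -
  have "AE x in lborel. AE y in lborel. x \<noteq> c"
    using AE_lborel_singleton[of c] by eventually_elim simp
  then have "AE z in lborel \<Otimes>\<^sub>M lborel. fst z \<noteq> c"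
    by (subst (asm) lborel_pair.AE_pair_iff) measurable
  then have "AE z in lborel. ?P z"
    unfolding lborel_prod .
  then show ?thesis
    by (subst AE_restrict_space_iff) auto
qed

text \<open>The value of \<open>interface_depth\<close> for the interfaces at finite depth.\<close>

definition real_depth :: "layer_parameter \<Rightarrow> nat \<Rightarrow> real \<Rightarrow> real" where
  "real_depth g i x = (\<Sum>k=1..i. fst (snd g) k * (1 - x) + fst g k * x) + (if x < 1/2 then snd (snd g) else 0)"

lemma interface_depth_eq:
  "interface_depth n g i x = (if i = 0 then -\<infinity> else if i = n then \<infinity> else ereal (real_depth g i x))"
  by (cases g) (simp add: real_depth_def)

lemma isCont_tendsto_nhds: "isCont h a \<Longrightarrow> (h \<longlongrightarrow> h a) (nhds a)"
  unfolding isCont_def by (simp add: tendsto_at_iff_tendsto_nhds[of h a])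

lemma isCont_coordinate:
  fixes h :: "'a::t2_space \<Rightarrow> nat \<Rightarrow> real"
  assumes "isCont h a"
  shows "isCont (\<lambda>x. h x k) a"
proof -
  have "continuous_on UNIV (\<lambda>v::nat \<Rightarrow> real. v k)"
    by (rule continuous_on_product_coordinates)
  then have "isCont (\<lambda>v::nat \<Rightarrow> real. v k) (h a)"
    by (rule continuous_on_interior) simp
  then show ?thesis
    by (rule isCont_o2[OF assms])
qed

lemma interface_depth_mono:
  assumes g: "g \<in> layer_parameters n cmax" and x: "0 < x" "x < 1" and "i \<le> j" "j \<le> n"
  shows "interface_depth n g i x \<le> interface_depth n g j x"
proof -
  obtain a b c where abc: "g = (a, b, c)" by (cases g)
  have nn: "0 \<le> a k" "0 \<le> b k" if "k \<in> {1..n-1}" for k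
    using g that by (auto simp: abc layer_parameters_def thickness_set_def PiE_def Pi_def)
  have "real_depth g i x \<le> real_depth g j x" if "j < n"
    unfolding real_depth_def abc using that x \<open>i \<le> j\<close>
    by (intro add_right_mono sum_mono2) (auto intro!: add_nonneg_nonneg mult_nonneg_nonneg nn)
  then show ?thesis
    using assms(4,5) by (auto simp: interface_depth_eq)
qed

lemma layer_region_iff:
  "z \<in> layer_region n g i \<longleftrightarrow> z \<in> unit_square \<and> fst z \<noteq> 1/2 \<and>
    interface_depth n g (i - 1) (fst z) < ereal (1 - snd z) \<and> ereal (1 - snd z) < interface_depth n g i (fst z)"
  by (cases z) (simp add: layer_region_def del: interface_depth.simps)

text \<open>Thicknesses are nonnegative, so the interfaces are ordered by depth.\<close>

lemma layer_region_disjoint: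
  assumes g: "g \<in> layer_parameters n cmax" and ij: "i \<in> {1..n}" "j \<in> {1..n}"
    and z: "z \<in> layer_region n g i" "z \<in> layer_region n g j"
  shows "i = j"
proof (rule ccontr)
  have x: "0 < fst z" "fst z < 1"
    using z by (auto simp: layer_region_iff unit_square_def)
  have *: False
    if "i < j" "j \<in> {1..n}" "z \<in> layer_region n g i" "z \<in> layer_region n g j" for i j
  proof -
    have "interface_depth n g i (fst z) \<le> interface_depth n g (j - 1) (fst z)"
      using that by (intro interface_depth_mono[OF g x]) auto
    then show False
      using that unfolding layer_region_iff by (meson less_le_trans less_trans less_irrefl)
  qed
  assume "i \<noteq> j"
  then show False
    using *[of i j] *[of j i] ij z by (meson linorder_neqE_nat)
qed

text \<open>Away from the interfaces and from the fault a point is separated from the two interfaces that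
  enclose it by strict inequalities, and these persist for nearby parameters.\<close>

lemma layer_regions_stable:
  assumes n: "2 \<le> n"
  shows "stable_regions n (layer_parameters n cmax) (layer_region n)"
  unfolding stable_regions_def
proof (intro ballI conjI allI)
  fix g assume g: "g \<in> layer_parameters n cmax"
  have [measurable]: "(fst :: point \<Rightarrow> real) \<in> borel_measurable borel" "(snd :: point \<Rightarrow> real) \<in> borel_measurable borel"
    by (auto intro!: borel_measurable_continuous_onI continuous_intros)
  have depth_m [measurable]: "real_depth g i \<in> borel_measurable borel" for i
    unfolding real_depth_def[abs_def] by measurable
  show "layer_region n g i \<in> sets borel" for i
  proof -
    have [measurable]: "(\<lambda>z::point. interface_depth n g i (fst z)) \<in> borel_measurable borel" for i
      unfolding interface_depth_eq by measurable
    have "layer_region n g i = {z \<in> space borel. z \<in> unit_square \<and> fst z \<noteq> 1/2 \<and>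
        interface_depth n g (i - 1) (fst z) < ereal (1 - snd z) \<and> ereal (1 - snd z) < interface_depth n g i (fst z)}"
      by (auto simp only: layer_region_iff space_borel)
    also have "\<dots> \<in> sets borel" by measurable
    finally show ?thesis .
  qed
  have "AE z in lebD. \<forall>i\<in>{1..n-1}. snd z \<noteq> 1 - real_depth g i (fst z)"
    by (intro AE_finite_allI AE_not_on_graph) measurable
  with AE_not_on_vertical[of "1/2"] AE_space
  show "AE z in lebD. \<exists>i\<in>{1..n}. \<forall>\<^sub>F g' in inf (nhds g) (principal (layer_parameters n cmax)).
      \<forall>j\<in>{1..n}. z \<in> layer_region n g' j \<longleftrightarrow> j = i"
  proof eventually_elim
    case (elim z)
    then have z: "z \<in> unit_square" by (simp only: space_lebD)
    define t where "t = ereal (1 - snd z)"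
    \<comment> \<open>The layer of \<open>z\<close> is the first one whose lower interface lies below \<open>z\<close>; it exists since the
      last interface is at infinite depth.\<close>
    define i where "i = (LEAST i. t < interface_depth n g i (fst z))"
    have "t < interface_depth n g n (fst z)"
      using n by (simp add: interface_depth_eq t_def)
    then have i1: "t < interface_depth n g i (fst z)" "i \<le> n"
      unfolding i_def by (rule LeastI, rule Least_le)
    have "i \<noteq> 0"
      using i1(1) by (metis interface_depth_eq less_ereal.simps(3) t_def)
    then have "\<not> t < interface_depth n g (i - 1) (fst z)"
      unfolding i_def by (intro not_less_Least) simp
    moreover have "t \<noteq> interface_depth n g (i - 1) (fst z)"
    proof (cases "i = 1")
      case False
      then have "i - 1 \<in> {1..n-1}" "i - 1 \<noteq> 0" "i - 1 \<noteq> n" using i1(2) \<open>i \<noteq> 0\<close> by auto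
      moreover from this have "1 - snd z \<noteq> real_depth g (i - 1) (fst z)"
        using bspec[OF elim(3)] by fastforce
      ultimately
      show ?thesis
        by (simp only: interface_depth_eq t_def if_False ereal.inject not_False_eq_True)
    qed (simp add: interface_depth_eq t_def)
    ultimately have i2: "interface_depth n g (i - 1) (fst z) < t" by simp
    have I: "i \<in> {1..n}" using i1(2) \<open>i \<noteq> 0\<close> by simp
    have cont: "((\<lambda>g'. interface_depth n g' k (fst z)) \<longlongrightarrow> interface_depth n g k (fst z)) (nhds g)" for k
    proof -
      have coord: "isCont (\<lambda>g'. fst g' i) g" "isCont (\<lambda>g'. fst (snd g') i) g" for i
        by (intro isCont_coordinate continuous_intros)+
      have "isCont (\<lambda>g'. real_depth g' k (fst z)) g"
        unfolding real_depth_def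
        by (cases "fst z < 1/2") (auto intro!: continuous_intros coord)
      then have "((\<lambda>g'. real_depth g' k (fst z)) \<longlongrightarrow> real_depth g k (fst z)) (nhds g)"
        by (rule isCont_tendsto_nhds)
      then show ?thesis
        by (simp add: interface_depth_eq)
    qed
    have "\<forall>\<^sub>F g' in nhds g. interface_depth n g' (i - 1) (fst z) < t \<and> t < interface_depth n g' i (fst z)"
      by (intro eventually_conj order_tendstoD[OF cont] i1(1) i2)
    then have "\<forall>\<^sub>F g' in inf (nhds g) (principal (layer_parameters n cmax)).
        \<forall>j\<in>{1..n}. z \<in> layer_region n g' j \<longleftrightarrow> j = i"
      unfolding eventually_inf_principal
    proof eventually_elim
      case (elim g')
      then have "z \<in> layer_region n g' i"
        using z \<open>fst z \<noteq> 1/2\<close> by (simp add: layer_region_iff t_def del: interface_depth.simps)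
      then show ?case
        using layer_region_disjoint I by metis
    qed
    then show ?case using I by blast
  qed
qed

lemma continuous_channel_curve: "continuous_on UNIV (channel_curve d)"
  unfolding channel_curve_def[abs_def] by (intro continuous_intros)

lemma closure_channel_subset:
  "closure (channel d) \<subseteq> {z. channel_curve d (fst z) \<le> snd z \<and> snd z \<le> channel_curve d (fst z) + d 5}"
proof (rule closure_minimal)
  have "continuous_on UNIV (\<lambda>z::point. channel_curve d (fst z))"
    by (rule continuous_on_compose2[OF continuous_channel_curve]) (auto intro: continuous_intros)
  then show "closed {z. channel_curve d (fst z) \<le> snd z \<and> snd z \<le> channel_curve d (fst z) + d 5}"
    by (intro closed_Collect_conj closed_Collect_le continuous_intros) auto
qed (auto simp: channel_def)

text \<open>A point off the two boundary curves satisfies a strict inequality that persists for nearby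
  parameters. For points outside the channel it must also exclude the closure of the channel, which is
  why the closure is enclosed between the curves.\<close>

lemma channel_regions_stable:
  assumes d3: "- pi / 2 < dlo 3" "dhi 3 < pi / 2"
  shows "stable_regions 2 (channel_parameters dlo dhi) channel_region"
  unfolding stable_regions_def
proof (intro ballI conjI allI)
  fix d assume d: "d \<in> channel_parameters dlo dhi"
  have [measurable]: "(fst :: point \<Rightarrow> real) \<in> borel_measurable borel" "(snd :: point \<Rightarrow> real) \<in> borel_measurable borel"
    by (auto intro!: borel_measurable_continuous_onI continuous_intros)
  have curve_m [measurable]: "channel_curve d \<in> borel_measurable borel"
    by (rule borel_measurable_continuous_onI[OF continuous_channel_curve])
  have [measurable]: "channel d \<in> sets borel"
  proof -
    have "channel d = {z \<in> space borel. z \<in> unit_square \<and>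
        channel_curve d (fst z) < snd z \<and> snd z < channel_curve d (fst z) + d 5}"
      by (auto simp: channel_def)
    also have "\<dots> \<in> sets borel" by measurable
    finally show ?thesis .
  qed
  show "channel_region d i \<in> sets borel" for i
    by (simp add: channel_region_def)
  have curve_cont: "((\<lambda>d'. channel_curve d' x) \<longlongrightarrow> channel_curve d x) (nhds d)" for x
  proof -
    have "d 3 \<in> {dlo 3..dhi 3}" using d by (auto simp: channel_parameters_def PiE_def Pi_def)
    then have cos: "cos (d 3) \<noteq> 0"
      using d3 cos_gt_zero_pi[of "d 3"] by auto
    have coord: "isCont (\<lambda>d'::nat \<Rightarrow> real. d' k) d" for k
      by (intro isCont_coordinate continuous_ident)
    have "isCont (\<lambda>d'. tan (d' 3)) d"
      by (rule isCont_o2[where f = "\<lambda>d'. d' 3" and g = tan, OF coord isCont_tan[OF cos]])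
    with coord have "isCont (\<lambda>d'. channel_curve d' x) d"
      unfolding channel_curve_def by (intro continuous_intros)
    then show ?thesis by (rule isCont_tendsto_nhds)
  qed
  have upper_cont: "((\<lambda>d'. channel_curve d' x + d' 5) \<longlongrightarrow> channel_curve d x + d 5) (nhds d)" for x
  proof (intro tendsto_add curve_cont)
    have "isCont (\<lambda>d'::nat \<Rightarrow> real. d' 5) d"
      by (intro isCont_coordinate continuous_ident)
    then show "((\<lambda>d'. d' 5) \<longlongrightarrow> d 5) (nhds d)"
      by (rule isCont_tendsto_nhds)
  qed
  have "AE z in lebD. snd z \<noteq> channel_curve d (fst z)" "AE z in lebD. snd z \<noteq> channel_curve d (fst z) + d 5"
    by (intro AE_not_on_graph; measurable)+
  with AE_space
  show "AE z in lebD. \<exists>i\<in>{1..2}. \<forall>\<^sub>F d' in inf (nhds d) (principal (channel_parameters dlo dhi)).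
      \<forall>j\<in>{1..2}. z \<in> channel_region d' j \<longleftrightarrow> j = i"
  proof eventually_elim
    case (elim z)
    then have z: "z \<in> unit_square" by (simp only: space_lebD)
    have two: "{1..2::nat} = {1, 2}" by auto
    consider "channel_curve d (fst z) < snd z" "snd z < channel_curve d (fst z) + d 5"
      | "snd z < channel_curve d (fst z)" | "channel_curve d (fst z) + d 5 < snd z"
      using elim by linarith
    then show ?case
    proof cases
      case 1
      have "\<forall>\<^sub>F d' in nhds d. channel_curve d' (fst z) < snd z \<and> snd z < channel_curve d' (fst z) + d' 5"
        by (intro eventually_conj order_tendstoD[OF curve_cont] order_tendstoD[OF upper_cont] 1)
      then have "\<forall>\<^sub>F d' in nhds d. z \<in> channel d'"
        by eventually_elim (use z in \<open>auto simp: channel_def\<close>)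
      then have "\<forall>\<^sub>F d' in inf (nhds d) (principal (channel_parameters dlo dhi)).
          \<forall>j\<in>{1..2}. z \<in> channel_region d' j \<longleftrightarrow> j = 1"
        unfolding eventually_inf_principal
        by eventually_elim (auto simp: two channel_region_def dest: closure_subset[THEN subsetD])
      then show ?thesis by (intro bexI[of _ 1]) auto
    next
      case 2
      have "\<forall>\<^sub>F d' in nhds d. snd z < channel_curve d' (fst z)"
        by (intro order_tendstoD[OF curve_cont] 2)
      then have "\<forall>\<^sub>F d' in nhds d. z \<notin> closure (channel d')"
        by eventually_elim (use closure_channel_subset in fastforce)
      then have "\<forall>\<^sub>F d' in inf (nhds d) (principal (channel_parameters dlo dhi)).
          \<forall>j\<in>{1..2}. z \<in> channel_region d' j \<longleftrightarrow> j = 2"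
        unfolding eventually_inf_principal
        by eventually_elim (use z in \<open>auto simp: two channel_region_def dest: closure_subset[THEN subsetD]\<close>)
      then show ?thesis by (intro bexI[of _ 2]) auto
    next
      case 3
      have "\<forall>\<^sub>F d' in nhds d. channel_curve d' (fst z) + d' 5 < snd z"
        by (intro order_tendstoD[OF upper_cont] 3)
      then have "\<forall>\<^sub>F d' in nhds d. z \<notin> closure (channel d')"
        by eventually_elim (use closure_channel_subset in fastforce)
      then have "\<forall>\<^sub>F d' in inf (nhds d) (principal (channel_parameters dlo dhi)).
          \<forall>j\<in>{1..2}. z \<in> channel_region d' j \<longleftrightarrow> j = 2"
        unfolding eventually_inf_principal
        by eventually_elim (use z in \<open>auto simp: two channel_region_def dest: closure_subset[THEN subsetD]\<close>)
      then show ?thesis by (intro bexI[of _ 2]) auto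
    qed
  qed
qed

section \<open>Posterior distributions\<close>

text \<open>Both distances integrate a function of two densities that is homogeneous of degree one. The density
  of \<open>\<mu>\<close> with respect to the reference measure is therefore a common factor, and the integral becomes
  one against \<open>\<mu>\<close>.\<close>

lemma integral_RN_derivs_eq:
  fixes F :: "real \<Rightarrow> real \<Rightarrow> real" and \<mu> :: "'u measure"
  assumes \<mu>: "sigma_finite_measure \<mu>"
    and [measurable]: "g \<in> borel_measurable \<mu>" "h \<in> borel_measurable \<mu>"
    and pos: "\<And>u. 0 < g u" "\<And>u. 0 < h u"
    and \<nu>: "\<nu> \<in> dominating (density \<mu> (\<lambda>u. ennreal (g u))) (density \<mu> (\<lambda>u. ennreal (h u)))"
    and F [measurable]: "(\<lambda>(a, b). F a b) \<in> borel_measurable borel"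
    and homogeneous: "\<And>c a b. 0 \<le> c \<Longrightarrow> F (c * a) (c * b) = c * F a b"
  shows "(\<integral>u. F (enn2real (RN_deriv \<nu> (density \<mu> (\<lambda>u. ennreal (g u))) u))
      (enn2real (RN_deriv \<nu> (density \<mu> (\<lambda>u. ennreal (h u))) u)) \<partial>\<nu>) = (\<integral>u. F (g u) (h u) \<partial>\<mu>)"
proof -
  interpret \<nu>: sigma_finite_measure \<nu> using \<nu> by (simp add: dominating_def)
  have sets_\<nu>: "sets \<nu> = sets \<mu>"
    and ac_g: "absolutely_continuous \<nu> (density \<mu> (\<lambda>u. ennreal (g u)))"
    using \<nu> by (auto simp: dominating_def)
  have ac: "absolutely_continuous \<nu> \<mu>"
  proof -
    have "null_sets (density \<mu> (\<lambda>u. ennreal (g u))) \<subseteq> null_sets \<mu>"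
    proof
      fix A assume "A \<in> null_sets (density \<mu> (\<lambda>u. ennreal (g u)))"
      then have A: "A \<in> sets \<mu>" "AE u in \<mu>. u \<in> A \<longrightarrow> ennreal (g u) = 0"
        by (auto simp: null_sets_density_iff)
      have "AE u in \<mu>. u \<notin> A"
        using A(2) by eventually_elim (use pos(1) in \<open>auto simp: ennreal_eq_0_iff not_le[symmetric]\<close>)
      then show "A \<in> null_sets \<mu>"
        using A(1) by (simp add: AE_iff_null_sets)
    qed
    then show ?thesis
      using ac_g by (auto simp: absolutely_continuous_def)
  qed
  define \<rho> where "\<rho> = RN_deriv \<nu> \<mu>"
  have [measurable]: "\<rho> \<in> borel_measurable \<nu>" by (simp add: \<rho>_def)
  have [measurable]: "g \<in> borel_measurable \<nu>" "h \<in> borel_measurable \<nu>"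
    using assms(2,3) sets_\<nu> by (auto cong: measurable_cong_sets)
  have dens: "density \<nu> \<rho> = \<mu>"
    unfolding \<rho>_def by (rule \<nu>.density_RN_deriv[OF ac]) (simp add: sets_\<nu>)
  have fin: "AE u in \<nu>. \<rho> u \<noteq> \<infinity>"
    unfolding \<rho>_def by (rule \<nu>.RN_deriv_finite[OF \<mu> ac]) (simp add: sets_\<nu>)
  have RN: "AE u in \<nu>. enn2real (RN_deriv \<nu> (density \<mu> (\<lambda>u. ennreal (k u))) u) = enn2real (\<rho> u) * k u"
    if [measurable]: "k \<in> borel_measurable \<nu>" and k: "\<And>u. 0 < k u" for k
  proof -
    have "density \<nu> (\<lambda>u. \<rho> u * ennreal (k u)) = density \<mu> (\<lambda>u. ennreal (k u))"
      by (subst density_density_eq[symmetric]) (auto simp: dens)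
    then have "AE u in \<nu>. \<rho> u * ennreal (k u) = RN_deriv \<nu> (density \<mu> (\<lambda>u. ennreal (k u))) u"
      by (intro \<nu>.RN_deriv_unique) measurable
    then show ?thesis
    proof eventually_elim
      case (elim u)
      then show ?case
        using k[of u] by (simp add: enn2real_mult flip: elim)
    qed
  qed
  have F_comp: "(\<lambda>u. F (p u) (q u)) \<in> borel_measurable \<nu>"
    if "p \<in> borel_measurable \<nu>" "q \<in> borel_measurable \<nu>" for p q
    using measurable_compose[OF borel_measurable_Pair[OF that] F] by simp
  have "(\<integral>u. F (enn2real (RN_deriv \<nu> (density \<mu> (\<lambda>u. ennreal (g u))) u))
      (enn2real (RN_deriv \<nu> (density \<mu> (\<lambda>u. ennreal (h u))) u)) \<partial>\<nu>)
      = (\<integral>u. enn2real (\<rho> u) *\<^sub>R F (g u) (h u) \<partial>\<nu>)"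
  proof (rule integral_cong_AE)
    show "AE u in \<nu>. F (enn2real (RN_deriv \<nu> (density \<mu> (\<lambda>u. ennreal (g u))) u))
        (enn2real (RN_deriv \<nu> (density \<mu> (\<lambda>u. ennreal (h u))) u)) = enn2real (\<rho> u) *\<^sub>R F (g u) (h u)"
      using RN[of g] RN[of h] pos by (auto simp: homogeneous elim!: eventually_elim2)
  qed (auto intro!: F_comp borel_measurable_times)
  also have "\<dots> = (\<integral>u. F (g u) (h u) \<partial>(density \<nu> (\<lambda>u. ennreal (enn2real (\<rho> u)))))"
    by (rule integral_density[symmetric]) (auto intro: F_comp)
  also have "density \<nu> (\<lambda>u. ennreal (enn2real (\<rho> u))) = density \<nu> \<rho>"
    by (rule density_cong) (use fin in \<open>auto simp: less_top elim!: eventually_mono\<close>)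
  finally show ?thesis by (simp only: dens)
qed

lemma tv_dist_density:
  assumes "sigma_finite_measure \<mu>" "g \<in> borel_measurable \<mu>" "h \<in> borel_measurable \<mu>"
    "\<And>u. 0 < g u" "\<And>u. 0 < h u"
    "\<nu> \<in> dominating (density \<mu> (\<lambda>u. ennreal (g u))) (density \<mu> (\<lambda>u. ennreal (h u)))"
  shows "tv_dist \<nu> (density \<mu> (\<lambda>u. ennreal (g u))) (density \<mu> (\<lambda>u. ennreal (h u)))
    = (\<integral>u. \<bar>g u - h u\<bar> \<partial>\<mu>) / 2"
  unfolding tv_dist_def
proof (subst integral_RN_derivs_eq[OF assms, where F = "\<lambda>a b. \<bar>a - b\<bar>"])
  show "(\<lambda>(a, b). \<bar>a - b\<bar>) \<in> borel_measurable (borel :: (real \<times> real) measure)"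
    by (intro borel_measurable_continuous_onI) (auto intro!: continuous_intros simp: case_prod_beta)
  show "\<bar>c * a - c * b\<bar> = c * \<bar>a - b\<bar>" if "0 \<le> c" for a b c :: real
    using that by (simp add: abs_mult flip: right_diff_distrib)
qed (rule refl)

lemma hellinger_dist_density:
  assumes "sigma_finite_measure \<mu>" "g \<in> borel_measurable \<mu>" "h \<in> borel_measurable \<mu>"
    "\<And>u. 0 < g u" "\<And>u. 0 < h u"
    "\<nu> \<in> dominating (density \<mu> (\<lambda>u. ennreal (g u))) (density \<mu> (\<lambda>u. ennreal (h u)))"
  shows "hellinger_dist \<nu> (density \<mu> (\<lambda>u. ennreal (g u))) (density \<mu> (\<lambda>u. ennreal (h u)))
    = sqrt ((\<integral>u. (sqrt (g u) - sqrt (h u))\<^sup>2 \<partial>\<mu>) / 2)"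
  unfolding hellinger_dist_def
proof (subst integral_RN_derivs_eq[OF assms, where F = "\<lambda>a b. (sqrt a - sqrt b)\<^sup>2"])
  show "(\<lambda>(a, b). (sqrt a - sqrt b)\<^sup>2) \<in> borel_measurable (borel :: (real \<times> real) measure)"
    by (intro borel_measurable_continuous_onI) (auto intro!: continuous_intros simp: case_prod_beta)
  show "(sqrt (c * a) - sqrt (c * b))\<^sup>2 = c * (sqrt a - sqrt b)\<^sup>2" if "0 \<le> c" for a b c :: real
    using that by (simp add: real_sqrt_mult power_mult_distrib flip: right_diff_distrib)
qed (rule refl)

lemma noise_norm_nonneg [simp]: "0 \<le> noise_norm \<Gamma> v"
  by (simp add: noise_norm_def)

lemma noise_norm_triangle: "noise_norm \<Gamma> (v + w) \<le> noise_norm \<Gamma> v + noise_norm \<Gamma> w"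
  by (simp add: noise_norm_def matrix_vector_right_distrib norm_triangle_ineq)

lemma noise_norm_minus: "noise_norm \<Gamma> (- v) = noise_norm \<Gamma> v"
proof -
  have "inv_sqrt_matrix \<Gamma> *v (- v) = - (inv_sqrt_matrix \<Gamma> *v v)"
    using matrix_vector_mult_diff_distrib[of "inv_sqrt_matrix \<Gamma>" 0 v] by simp
  then show ?thesis by (simp add: noise_norm_def)
qed

lemma noise_norm_triangle_diff: "noise_norm \<Gamma> (v - w) \<le> noise_norm \<Gamma> v + noise_norm \<Gamma> w"
  using noise_norm_triangle[of \<Gamma> v "- w"] by (simp add: noise_norm_minus)

lemma continuous_noise_norm: "continuous_on UNIV (noise_norm \<Gamma>)"
  unfolding noise_norm_def[abs_def]
  by (intro continuous_on_norm linear_continuous_on matrix_vector_mul_bounded_linear)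

lemma noise_norm_le: "noise_norm \<Gamma> v \<le> onorm ((*v) (inv_sqrt_matrix \<Gamma>)) * norm v"
  unfolding noise_norm_def by (rule onorm[OF matrix_vector_mul_bounded_linear])

text \<open>On the nonnegative reals \<open>exp (- x)\<close> is Lipschitz with constant one and takes values in the unit
  interval, and \<open>min 1 x \<le> x\<^sup>s\<close>.\<close>

lemma abs_exp_minus_diff_le:
  fixes a b s :: real
  assumes "0 \<le> a" "0 \<le> b" "0 < s" "s \<le> 1"
  shows "\<bar>exp (- a) - exp (- b)\<bar> \<le> \<bar>a - b\<bar> powr s"
proof -
  have *: "\<bar>exp (- a) - exp (- b)\<bar> \<le> \<bar>a - b\<bar> powr s" if "0 \<le> a" "a \<le> b" for a b :: real
  proof -
    have le: "exp (- b) \<le> exp (- a)" using that by simp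
    have eq: "exp (- b) = exp (- a) * exp (- (b - a))" by (simp flip: exp_add)
    have "exp (- a) - exp (- b) = exp (- a) * (1 - exp (- (b - a)))"
      unfolding eq by (simp add: right_diff_distrib)
    also have "\<dots> \<le> 1 * (1 - exp (- (b - a)))"
      using that by (intro mult_right_mono) auto
    finally have 1: "exp (- a) - exp (- b) \<le> 1 - exp (- (b - a))" by simp
    have "1 - exp (- (b - a)) \<le> (b - a) powr s"
    proof (cases "b - a \<le> 1")
      case True
      have "1 - exp (- (b - a)) \<le> b - a"
        using exp_ge_add_one_self[of "- (b - a)"] by linarith
      also have "\<dots> \<le> (b - a) powr s"
        using True that assms powr_mono'[of s 1 "b - a"] by (cases "a = b") auto
      finally show ?thesis .
    next
      case False
      then have "1 \<le> (b - a) powr s"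
        using assms by (intro ge_one_powr_ge_zero) auto
      then show ?thesis by (smt (verit) exp_gt_zero)
    qed
    then show ?thesis using 1 le that by simp
  qed
  show ?thesis
    using *[of a b] *[of b a] assms by (cases "a \<le> b") (auto simp: abs_minus_commute)
qed

lemma square_sqrt_diff_le:
  fixes a b :: real
  assumes "0 \<le> a" "0 \<le> b"
  shows "(sqrt a - sqrt b)\<^sup>2 \<le> \<bar>a - b\<bar>"
proof -
  have "(sqrt a - sqrt b)\<^sup>2 = \<bar>sqrt a - sqrt b\<bar> * \<bar>sqrt a - sqrt b\<bar>"
    by (simp add: power2_eq_square flip: abs_mult)
  also have "\<dots> \<le> \<bar>sqrt a - sqrt b\<bar> * \<bar>sqrt a + sqrt b\<bar>"
  proof (intro mult_left_mono)
    have "0 \<le> sqrt a" "0 \<le> sqrt b" using assms by auto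
    then show "\<bar>sqrt a - sqrt b\<bar> \<le> \<bar>sqrt a + sqrt b\<bar>" by linarith
  qed simp
  also have "\<dots> = \<bar>a - b\<bar>"
  proof -
    have "(sqrt a - sqrt b) * (sqrt a + sqrt b) = a - b"
      using assms by (simp add: algebra_simps)
    then show ?thesis by (metis abs_mult)
  qed
  finally show ?thesis .
qed

text \<open>The Bayesian estimates need only a likelihood bounded by one whose normalising constants stay
  away from zero; the potential enters through the pointwise modulus of continuity of the likelihood.\<close>

locale two_likelihoods = prob_space \<mu> for \<mu> :: "'u measure" +
  fixes A B :: "'u \<Rightarrow> real" and c :: real
  assumes A_meas [measurable]: "A \<in> borel_measurable \<mu>" and B_meas [measurable]: "B \<in> borel_measurable \<mu>"
    and A: "\<And>u. 0 < A u" "\<And>u. A u \<le> 1" and B: "\<And>u. 0 < B u" "\<And>u. B u \<le> 1"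
    and c: "0 < c" "c \<le> expectation A" "c \<le> expectation B"
begin

lemma integrable_likelihoods: "integrable \<mu> A" "integrable \<mu> B"
proof -
  show "integrable \<mu> A"
    by (rule integrable_const_bound[of _ 1]) (use A in \<open>auto simp: less_imp_le\<close>)
  show "integrable \<mu> B"
    by (rule integrable_const_bound[of _ 1]) (use B in \<open>auto simp: less_imp_le\<close>)
qed

abbreviation "ZA \<equiv> expectation A"
abbreviation "ZB \<equiv> expectation B"

lemma Z_pos: "0 < ZA" "0 < ZB"
  using c by auto

lemma Z_diff: "\<bar>ZA - ZB\<bar> \<le> expectation (\<lambda>u. \<bar>A u - B u\<bar>)"
proof -
  have "\<bar>ZA - ZB\<bar> = \<bar>expectation (\<lambda>u. A u - B u)\<bar>"
    using integrable_likelihoods by simp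
  also have "\<dots> \<le> expectation (\<lambda>u. \<bar>A u - B u\<bar>)"
    by (rule integral_abs_bound)
  finally show ?thesis .
qed

text \<open>The error in the normalising constants is at most the error in the likelihoods, hence the factor two.\<close>

lemma L1_normalised: "expectation (\<lambda>u. \<bar>A u / ZA - B u / ZB\<bar>) \<le> 2 * expectation (\<lambda>u. \<bar>A u - B u\<bar>) / c"
proof -
  have "expectation (\<lambda>u. \<bar>A u / ZA - B u / ZB\<bar>) \<le> expectation (\<lambda>u. \<bar>A u - B u\<bar> / ZA + B u * (\<bar>ZA - ZB\<bar> / (ZA * ZB)))"
  proof (rule integral_mono)
    fix u
    have "A u / ZA - B u / ZB = (A u - B u) / ZA + B u * ((ZB - ZA) / (ZA * ZB))"
      using Z_pos by (simp add: field_simps)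
    then have "\<bar>A u / ZA - B u / ZB\<bar> \<le> \<bar>(A u - B u) / ZA\<bar> + \<bar>B u * ((ZB - ZA) / (ZA * ZB))\<bar>"
      by (simp only: abs_triangle_ineq)
    also have "\<dots> = \<bar>A u - B u\<bar> / ZA + B u * (\<bar>ZA - ZB\<bar> / (ZA * ZB))"
      using Z_pos B(1)[of u] by (simp add: abs_mult abs_minus_commute)
    finally show "\<bar>A u / ZA - B u / ZB\<bar> \<le> \<bar>A u - B u\<bar> / ZA + B u * (\<bar>ZA - ZB\<bar> / (ZA * ZB))" .
  qed (use integrable_likelihoods in auto)
  also have "\<dots> = expectation (\<lambda>u. \<bar>A u - B u\<bar>) / ZA + \<bar>ZA - ZB\<bar> / ZA"
    using integrable_likelihoods Z_pos by (simp add: field_simps)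
  also have "\<dots> \<le> expectation (\<lambda>u. \<bar>A u - B u\<bar>) / c + expectation (\<lambda>u. \<bar>A u - B u\<bar>) / c"
    using Z_diff c by (intro add_mono frac_le) auto
  finally show ?thesis by simp
qed

lemma tv_le:
  assumes "\<nu> \<in> dominating (density \<mu> (\<lambda>u. ennreal (A u / ZA))) (density \<mu> (\<lambda>u. ennreal (B u / ZB)))"
  shows "tv_dist \<nu> (density \<mu> (\<lambda>u. ennreal (A u / ZA))) (density \<mu> (\<lambda>u. ennreal (B u / ZB)))
    \<le> expectation (\<lambda>u. \<bar>A u - B u\<bar>) / c"
  using L1_normalised A(1) B(1) Z_pos
  by (subst tv_dist_density[OF _ _ _ _ _ assms]) (auto intro: sigma_finite_measure_axioms simp: mult.commute)

lemma hellinger_le_sqrt: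
  assumes "\<nu> \<in> dominating (density \<mu> (\<lambda>u. ennreal (A u / ZA))) (density \<mu> (\<lambda>u. ennreal (B u / ZB)))"
  shows "hellinger_dist \<nu> (density \<mu> (\<lambda>u. ennreal (A u / ZA))) (density \<mu> (\<lambda>u. ennreal (B u / ZB)))
    \<le> sqrt (expectation (\<lambda>u. \<bar>A u - B u\<bar>) / c)"
proof -
  have int: "integrable \<mu> (\<lambda>u. \<bar>A u / ZA - B u / ZB\<bar>)"
    using integrable_likelihoods by auto
  have "expectation (\<lambda>u. (sqrt (A u / ZA) - sqrt (B u / ZB))\<^sup>2) \<le> expectation (\<lambda>u. \<bar>A u / ZA - B u / ZB\<bar>)"
  proof (rule integral_mono')
    show "(sqrt (A u / ZA) - sqrt (B u / ZB))\<^sup>2 \<le> \<bar>A u / ZA - B u / ZB\<bar>" for u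
      using A(1)[of u] B(1)[of u] Z_pos by (intro square_sqrt_diff_le) auto
  qed (use int in auto)
  with L1_normalised show ?thesis
    using A(1) B(1) Z_pos
    by (subst hellinger_dist_density[OF _ _ _ _ _ assms]) (auto intro: sigma_finite_measure_axioms simp: mult.commute)
qed

text \<open>The square roots of the normalised likelihoods differ by a part from the likelihoods and a part from
  the normalising constants; the latter is quadratic in the \<open>L\<^sup>1\<close> error.\<close>

lemma hellinger_le_lipschitz:
  assumes \<nu>: "\<nu> \<in> dominating (density \<mu> (\<lambda>u. ennreal (A u / ZA))) (density \<mu> (\<lambda>u. ennreal (B u / ZB)))"
    and int: "integrable \<mu> (\<lambda>u. (sqrt (A u) - sqrt (B u))\<^sup>2)"
  shows "hellinger_dist \<nu> (density \<mu> (\<lambda>u. ennreal (A u / ZA))) (density \<mu> (\<lambda>u. ennreal (B u / ZB)))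
    \<le> sqrt (expectation (\<lambda>u. (sqrt (A u) - sqrt (B u))\<^sup>2) / c + (expectation (\<lambda>u. \<bar>A u - B u\<bar>))\<^sup>2 / c\<^sup>2)"
proof -
  have sq: "(x + y)\<^sup>2 \<le> 2 * x\<^sup>2 + 2 * y\<^sup>2" for x y :: real
    using sum_squares_bound[of x y] by (simp add: power2_sum)
  define d where "d = (1 / sqrt ZA - 1 / sqrt ZB)\<^sup>2"
  have "expectation (\<lambda>u. (sqrt (A u / ZA) - sqrt (B u / ZB))\<^sup>2)
      \<le> expectation (\<lambda>u. 2 * (sqrt (A u) - sqrt (B u))\<^sup>2 / ZA + 2 * B u * d)"
  proof (rule integral_mono')
    fix u
    have "sqrt (A u / ZA) - sqrt (B u / ZB)
        = (sqrt (A u) - sqrt (B u)) / sqrt ZA + sqrt (B u) * (1 / sqrt ZA - 1 / sqrt ZB)"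
      by (simp add: real_sqrt_divide diff_divide_distrib right_diff_distrib)
    also have "\<dots>\<^sup>2 \<le> 2 * ((sqrt (A u) - sqrt (B u)) / sqrt ZA)\<^sup>2 + 2 * (sqrt (B u) * (1 / sqrt ZA - 1 / sqrt ZB))\<^sup>2"
      by (rule sq)
    also have "\<dots> = 2 * (sqrt (A u) - sqrt (B u))\<^sup>2 / ZA + 2 * B u * d"
      using Z_pos B(1)[of u] by (simp add: d_def power_divide power_mult_distrib)
    finally show "(sqrt (A u / ZA) - sqrt (B u / ZB))\<^sup>2 \<le> 2 * (sqrt (A u) - sqrt (B u))\<^sup>2 / ZA + 2 * B u * d" .
    show "0 \<le> 2 * (sqrt (A u) - sqrt (B u))\<^sup>2 / ZA + 2 * B u * d"
      using B(1)[of u] Z_pos by (simp add: d_def)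
  qed (use integrable_likelihoods int in auto)
  also have "\<dots> = 2 * expectation (\<lambda>u. (sqrt (A u) - sqrt (B u))\<^sup>2) / ZA + 2 * (ZB * d)"
    using integrable_likelihoods int by simp
  also have "2 * expectation (\<lambda>u. (sqrt (A u) - sqrt (B u))\<^sup>2) / ZA \<le> 2 * expectation (\<lambda>u. (sqrt (A u) - sqrt (B u))\<^sup>2) / c"
    using c by (intro divide_left_mono) auto
  also have "ZB * d \<le> (expectation (\<lambda>u. \<bar>A u - B u\<bar>))\<^sup>2 / c\<^sup>2"
  proof -
    define a b where "a = sqrt ZA" and "b = sqrt ZB"
    have ab: "0 < a" "0 < b" "ZA = a\<^sup>2" "ZB = b\<^sup>2"
      using Z_pos by (auto simp: a_def b_def)
    have "ZB * d = (a - b)\<^sup>2 / a\<^sup>2"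
      unfolding d_def a_def[symmetric] b_def[symmetric] ab(4)
      using ab(1,2) by (simp add: power_divide field_simps power2_eq_square)
    also have "\<dots> \<le> (a - b)\<^sup>2 * ((a + b)\<^sup>2 / a\<^sup>2) / a\<^sup>2"
    proof -
      have "a\<^sup>2 \<le> (a + b)\<^sup>2" using ab by (intro power_mono) auto
      then have "1 \<le> (a + b)\<^sup>2 / a\<^sup>2" using ab by simp
      then have "(a - b)\<^sup>2 * 1 \<le> (a - b)\<^sup>2 * ((a + b)\<^sup>2 / a\<^sup>2)"
        by (rule mult_left_mono) simp
      then have "(a - b)\<^sup>2 * 1 / a\<^sup>2 \<le> (a - b)\<^sup>2 * ((a + b)\<^sup>2 / a\<^sup>2) / a\<^sup>2"
        by (rule divide_right_mono) simp
      then show ?thesis by (simp only: mult_1_right)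
    qed
    also have "\<dots> = (ZA - ZB)\<^sup>2 / ZA\<^sup>2"
      unfolding ab(3,4) by (simp add: power2_eq_square field_simps)
    also have "\<dots> \<le> (expectation (\<lambda>u. \<bar>A u - B u\<bar>))\<^sup>2 / c\<^sup>2"
    proof (rule frac_le)
      show "(ZA - ZB)\<^sup>2 \<le> (expectation (\<lambda>u. \<bar>A u - B u\<bar>))\<^sup>2"
        using power_mono[OF Z_diff, of 2] by simp
      show "c\<^sup>2 \<le> ZA\<^sup>2" using c by (intro power_mono) auto
    qed (use c in auto)
    finally show ?thesis .
  qed
  finally have "expectation (\<lambda>u. (sqrt (A u / ZA) - sqrt (B u / ZB))\<^sup>2) / 2
      \<le> expectation (\<lambda>u. (sqrt (A u) - sqrt (B u))\<^sup>2) / c + (expectation (\<lambda>u. \<bar>A u - B u\<bar>))\<^sup>2 / c\<^sup>2"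
    by (simp add: mult.commute)
  then show ?thesis
    using A(1) B(1) Z_pos
    by (subst hellinger_dist_density[OF _ _ _ _ _ \<nu>]) (auto intro: sigma_finite_measure_axioms)
qed

end


lemma misfit_bounds:
  assumes "noise_norm \<Gamma> y < r"
  shows "0 \<le> misfit \<Gamma> G u y" "misfit \<Gamma> G u y \<le> (r + noise_norm \<Gamma> (G u))\<^sup>2 / 2"
proof -
  show "0 \<le> misfit \<Gamma> G u y" by (simp add: misfit_def)
  have "noise_norm \<Gamma> (y - G u) \<le> r + noise_norm \<Gamma> (G u)"
    using noise_norm_triangle_diff[of \<Gamma> y "G u"] assms by simp
  then show "misfit \<Gamma> G u y \<le> (r + noise_norm \<Gamma> (G u))\<^sup>2 / 2"
    by (simp add: misfit_def power_mono)
qed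

text \<open>A difference of squares, with both factors estimated by the triangle inequality.\<close>

lemma misfit_diff:
  assumes "noise_norm \<Gamma> y < r" "noise_norm \<Gamma> y' < r"
  shows "\<bar>misfit \<Gamma> G u y - misfit \<Gamma> G u y'\<bar> \<le> noise_norm \<Gamma> (y - y') * (r + noise_norm \<Gamma> (G u))"
proof -
  define a b where "a = noise_norm \<Gamma> (y - G u)" and "b = noise_norm \<Gamma> (y' - G u)"
  have "a \<le> b + noise_norm \<Gamma> (y - y')"
    using noise_norm_triangle[of \<Gamma> "y' - G u" "y - y'"] by (simp add: a_def b_def)
  moreover have "b \<le> a + noise_norm \<Gamma> (y - y')"
    using noise_norm_triangle[of \<Gamma> "y - G u" "y' - y"] noise_norm_minus[of \<Gamma> "y - y'"]
    by (simp add: a_def b_def)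
  ultimately have diff: "\<bar>a - b\<bar> \<le> noise_norm \<Gamma> (y - y')" by linarith
  have ab: "0 \<le> a" "0 \<le> b" "a \<le> r + noise_norm \<Gamma> (G u)" "b \<le> r + noise_norm \<Gamma> (G u)"
    using noise_norm_triangle_diff[of \<Gamma> y "G u"] noise_norm_triangle_diff[of \<Gamma> y' "G u"] assms
    by (simp_all add: a_def b_def)
  have "misfit \<Gamma> G u y - misfit \<Gamma> G u y' = (a - b) * ((a + b) / 2)"
    by (simp add: misfit_def a_def b_def power2_eq_square algebra_simps diff_divide_distrib)
  then have "\<bar>misfit \<Gamma> G u y - misfit \<Gamma> G u y'\<bar> = \<bar>a - b\<bar> * \<bar>(a + b) / 2\<bar>"
    by (simp only: abs_mult)
  also have "\<dots> \<le> noise_norm \<Gamma> (y - y') * (r + noise_norm \<Gamma> (G u))"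
    using diff ab by (intro mult_mono) auto
  finally show ?thesis .
qed

locale bayesian_model = prob_space \<mu> for \<mu> :: "'u measure" +
  fixes G :: "'u \<Rightarrow> real ^ 'j::finite" and \<Gamma> :: "real ^ 'j ^ 'j"
  assumes G_meas [measurable]: "G \<in> borel_measurable \<mu>"
begin

text \<open>A bound for the distance of the observation to any data of size less than \<open>r\<close>.\<close>

definition envelope :: "real \<Rightarrow> 'u \<Rightarrow> real" where
  "envelope r u = r + noise_norm \<Gamma> (G u)"

lemma envelope_measurable [measurable]: "envelope r \<in> borel_measurable \<mu>"
  unfolding envelope_def[abs_def]
  by (intro borel_measurable_add borel_measurable_const borel_measurable_continuous_on[OF continuous_noise_norm G_meas])

lemma envelope_nonneg: "0 < r \<Longrightarrow> 0 \<le> envelope r u"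
  by (simp add: envelope_def)

text \<open>A lower bound for the normalising constants of all data of size less than \<open>r\<close>.\<close>

definition floor_constant :: "real \<Rightarrow> real" where
  "floor_constant r = expectation (\<lambda>u. exp (- (envelope r u)\<^sup>2 / 2))"

lemma floor_constant_pos: "0 < floor_constant r"
proof -
  have "integrable \<mu> (\<lambda>u. exp (- (envelope r u)\<^sup>2 / 2))"
    by (rule integrable_const_bound[of _ 1]) auto
  then have "expectation (\<lambda>u. exp (- (envelope r u)\<^sup>2 / 2)) \<noteq> 0"
    by (subst integral_nonneg_eq_0_iff_AE) auto
  moreover have "0 \<le> floor_constant r"
    unfolding floor_constant_def by (rule Bochner_Integration.integral_nonneg) simp
  ultimately show ?thesis unfolding floor_constant_def by linarith
qed

lemma misfit_measurable [measurable]: "(\<lambda>u. misfit \<Gamma> G u y) \<in> borel_measurable \<mu>"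
proof -
  have "(\<lambda>u. noise_norm \<Gamma> (y - G u)) \<in> borel_measurable \<mu>"
    by (rule borel_measurable_continuous_on[OF continuous_noise_norm]) measurable
  then show ?thesis unfolding misfit_def by measurable
qed

lemma likelihoods:
  assumes "0 < r" "noise_norm \<Gamma> y < r" "noise_norm \<Gamma> y' < r"
  shows "two_likelihoods \<mu> (\<lambda>u. exp (- misfit \<Gamma> G u y)) (\<lambda>u. exp (- misfit \<Gamma> G u y')) (floor_constant r)"
proof -
  have floor: "floor_constant r \<le> expectation (\<lambda>u. exp (- misfit \<Gamma> G u y))" if "noise_norm \<Gamma> y < r" for y
    unfolding floor_constant_def
  proof (rule integral_mono)
    show "exp (- (envelope r u)\<^sup>2 / 2) \<le> exp (- misfit \<Gamma> G u y)" for u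
      using misfit_bounds(2)[OF that] by (simp add: envelope_def)
    show "integrable \<mu> (\<lambda>u. exp (- (envelope r u)\<^sup>2 / 2))"
      by (rule integrable_const_bound[of _ 1]) auto
    show "integrable \<mu> (\<lambda>u. exp (- misfit \<Gamma> G u y))"
      by (rule integrable_const_bound[of _ 1]) (use misfit_bounds(1)[OF that] in \<open>auto intro!: AE_I2\<close>)
  qed
  show ?thesis
    by unfold_locales (use floor assms floor_constant_pos misfit_bounds(1) in auto)
qed

lemma posterior_hoelder:
  assumes r: "0 < r" and s: "0 < s" "s \<le> 1" and moment: "integrable \<mu> (\<lambda>u. envelope r u powr s)"
  shows "\<exists>K\<ge>0. \<forall>y y'. max (noise_norm \<Gamma> y) (noise_norm \<Gamma> y') < r \<longrightarrow>
    (\<forall>\<nu>\<in>dominating (posterior \<mu> (misfit \<Gamma> G) y) (posterior \<mu> (misfit \<Gamma> G) y').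
      tv_dist \<nu> (posterior \<mu> (misfit \<Gamma> G) y) (posterior \<mu> (misfit \<Gamma> G) y')
        \<le> K * noise_norm \<Gamma> (y - y') powr s \<and>
      hellinger_dist \<nu> (posterior \<mu> (misfit \<Gamma> G) y) (posterior \<mu> (misfit \<Gamma> G) y')
        \<le> sqrt K * noise_norm \<Gamma> (y - y') powr (s / 2))"
proof (intro exI[of _ "expectation (\<lambda>u. envelope r u powr s) / floor_constant r"] conjI allI impI ballI)
  let ?K = "expectation (\<lambda>u. envelope r u powr s) / floor_constant r"
  show "0 \<le> ?K"
    using floor_constant_pos[of r] by (intro divide_nonneg_pos Bochner_Integration.integral_nonneg) auto
  fix y y' \<nu>
  assume "max (noise_norm \<Gamma> y) (noise_norm \<Gamma> y') < r"
    and \<nu>: "\<nu> \<in> dominating (posterior \<mu> (misfit \<Gamma> G) y) (posterior \<mu> (misfit \<Gamma> G) y')"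
  then have y: "noise_norm \<Gamma> y < r" "noise_norm \<Gamma> y' < r" by auto
  interpret L: two_likelihoods \<mu> "\<lambda>u. exp (- misfit \<Gamma> G u y)" "\<lambda>u. exp (- misfit \<Gamma> G u y')" "floor_constant r"
    by (rule likelihoods[OF r y])
  let ?d = "noise_norm \<Gamma> (y - y')"
  let ?E = "expectation (\<lambda>u. \<bar>exp (- misfit \<Gamma> G u y) - exp (- misfit \<Gamma> G u y')\<bar>)"
  have "?E \<le> expectation (\<lambda>u. ?d powr s * envelope r u powr s)"
  proof (rule integral_mono)
    fix u
    have "\<bar>exp (- misfit \<Gamma> G u y) - exp (- misfit \<Gamma> G u y')\<bar> \<le> \<bar>misfit \<Gamma> G u y - misfit \<Gamma> G u y'\<bar> powr s"
      by (intro abs_exp_minus_diff_le misfit_bounds(1)[OF y(1)] misfit_bounds(1)[OF y(2)] s)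
    also have "\<dots> \<le> (?d * envelope r u) powr s"
      using misfit_diff[OF y] s by (intro powr_mono2) (auto simp: envelope_def)
    also have "\<dots> = ?d powr s * envelope r u powr s"
      by (rule powr_mult)
    finally show "\<bar>exp (- misfit \<Gamma> G u y) - exp (- misfit \<Gamma> G u y')\<bar> \<le> ?d powr s * envelope r u powr s" .
  qed (use moment L.integrable_likelihoods in auto)
  then have E: "?E \<le> ?d powr s * expectation (\<lambda>u. envelope r u powr s)"
    by simp
  then have E': "?E / floor_constant r \<le> ?K * ?d powr s"
    using floor_constant_pos[of r] by (simp add: field_simps)
  show "tv_dist \<nu> (posterior \<mu> (misfit \<Gamma> G) y) (posterior \<mu> (misfit \<Gamma> G) y') \<le> ?K * ?d powr s"
    using L.tv_le[OF \<nu>[unfolded posterior_def]] E' by (simp add: posterior_def)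
  have "hellinger_dist \<nu> (posterior \<mu> (misfit \<Gamma> G) y) (posterior \<mu> (misfit \<Gamma> G) y') \<le> sqrt (?E / floor_constant r)"
    using L.hellinger_le_sqrt[OF \<nu>[unfolded posterior_def]] by (simp add: posterior_def)
  also have "\<dots> \<le> sqrt (?K * ?d powr s)"
    using E' by (rule real_sqrt_le_mono)
  also have "\<dots> = sqrt ?K * ?d powr (s / 2)"
  proof -
    have "?d powr s = (?d powr (s / 2))\<^sup>2"
      by (simp add: power2_eq_square flip: powr_add)
    then have "sqrt (?d powr s) = ?d powr (s / 2)"
      by (simp add: real_sqrt_abs)
    then show ?thesis by (simp only: real_sqrt_mult)
  qed
  finally show "hellinger_dist \<nu> (posterior \<mu> (misfit \<Gamma> G) y) (posterior \<mu> (misfit \<Gamma> G) y')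
      \<le> sqrt ?K * ?d powr (s / 2)" .
qed

lemma posterior_hellinger_lipschitz:
  assumes r: "0 < r" and moments: "integrable \<mu> (envelope r)" "integrable \<mu> (\<lambda>u. (envelope r u)\<^sup>2)"
  shows "\<exists>K. \<forall>y y'. max (noise_norm \<Gamma> y) (noise_norm \<Gamma> y') < r \<longrightarrow>
    (\<forall>\<nu>\<in>dominating (posterior \<mu> (misfit \<Gamma> G) y) (posterior \<mu> (misfit \<Gamma> G) y').
      hellinger_dist \<nu> (posterior \<mu> (misfit \<Gamma> G) y) (posterior \<mu> (misfit \<Gamma> G) y')
        \<le> K * noise_norm \<Gamma> (y - y'))"
proof -
  let ?c = "floor_constant r" and ?E1 = "expectation (envelope r)" and ?E2 = "expectation (\<lambda>u. (envelope r u)\<^sup>2)"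
  let ?K = "?E2 / (4 * ?c) + ?E1\<^sup>2 / ?c\<^sup>2"
  have "hellinger_dist \<nu> (posterior \<mu> (misfit \<Gamma> G) y) (posterior \<mu> (misfit \<Gamma> G) y')
      \<le> sqrt ?K * noise_norm \<Gamma> (y - y')"
    if max: "max (noise_norm \<Gamma> y) (noise_norm \<Gamma> y') < r"
      and \<nu>: "\<nu> \<in> dominating (posterior \<mu> (misfit \<Gamma> G) y) (posterior \<mu> (misfit \<Gamma> G) y')" for y y' \<nu>
  proof -
    have y: "noise_norm \<Gamma> y < r" "noise_norm \<Gamma> y' < r" using max by auto
    interpret L: two_likelihoods \<mu> "\<lambda>u. exp (- misfit \<Gamma> G u y)" "\<lambda>u. exp (- misfit \<Gamma> G u y')" ?c
      by (rule likelihoods[OF r y])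
    let ?d = "noise_norm \<Gamma> (y - y')"
    let ?D1 = "\<lambda>u. \<bar>exp (- misfit \<Gamma> G u y) - exp (- misfit \<Gamma> G u y')\<bar>"
    let ?D2 = "\<lambda>u. (sqrt (exp (- misfit \<Gamma> G u y)) - sqrt (exp (- misfit \<Gamma> G u y')))\<^sup>2"
    have sqrt_exp: "sqrt (exp (- x)) = exp (- (x / 2))" for x :: real
      by (rule real_sqrt_unique) (simp_all add: power2_eq_square flip: exp_add)
    have D1: "?D1 u \<le> ?d * envelope r u" for u
    proof -
      have "?D1 u \<le> \<bar>misfit \<Gamma> G u y - misfit \<Gamma> G u y'\<bar> powr 1"
        by (intro abs_exp_minus_diff_le misfit_bounds(1)[OF y(1)] misfit_bounds(1)[OF y(2)]) auto
      then show ?thesis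
        using misfit_diff[OF y, of G u] by (simp add: envelope_def)
    qed
    have D2: "?D2 u \<le> ?d\<^sup>2 / 4 * (envelope r u)\<^sup>2" for u
    proof -
      have "\<bar>exp (- (misfit \<Gamma> G u y / 2)) - exp (- (misfit \<Gamma> G u y' / 2))\<bar>
          \<le> \<bar>misfit \<Gamma> G u y / 2 - misfit \<Gamma> G u y' / 2\<bar> powr 1"
        using misfit_bounds(1)[OF y(1), of G u] misfit_bounds(1)[OF y(2), of G u]
        by (intro abs_exp_minus_diff_le) auto
      also have "\<dots> \<le> ?d * envelope r u / 2"
        using misfit_diff[OF y, of G u] by (simp add: envelope_def flip: diff_divide_distrib)
      finally have "\<bar>exp (- (misfit \<Gamma> G u y / 2)) - exp (- (misfit \<Gamma> G u y' / 2))\<bar>\<^sup>2 \<le> (?d * envelope r u / 2)\<^sup>2"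
        by (rule power_mono) simp
      then show ?thesis
        unfolding sqrt_exp by (simp add: power_mult_distrib power_divide)
    qed
    have "expectation ?D1 \<le> expectation (\<lambda>u. ?d * envelope r u)"
      by (rule integral_mono[OF _ _ D1]) (use moments L.integrable_likelihoods in auto)
    then have E1: "expectation ?D1 \<le> ?d * ?E1" by simp
    have int2: "integrable \<mu> ?D2"
    proof (rule Bochner_Integration.integrable_bound)
      show "integrable \<mu> (\<lambda>u. ?d\<^sup>2 / 4 * (envelope r u)\<^sup>2)" using moments(2) by simp
      show "AE u in \<mu>. norm (?D2 u) \<le> norm (?d\<^sup>2 / 4 * (envelope r u)\<^sup>2)"
        using D2 by (auto intro!: AE_I2)
    qed measurable
    have "expectation ?D2 \<le> expectation (\<lambda>u. ?d\<^sup>2 / 4 * (envelope r u)\<^sup>2)"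
      by (rule integral_mono[OF int2 _ D2]) (use moments(2) in simp)
    then have E2: "expectation ?D2 \<le> ?d\<^sup>2 / 4 * ?E2" by simp
    have "expectation ?D2 / ?c + (expectation ?D1)\<^sup>2 / ?c\<^sup>2 \<le> (?d\<^sup>2 / 4 * ?E2) / ?c + (?d * ?E1)\<^sup>2 / ?c\<^sup>2"
      using E1 E2 floor_constant_pos[of r]
      by (intro add_mono divide_right_mono power_mono Bochner_Integration.integral_nonneg) auto
    also have "\<dots> = ?K * ?d\<^sup>2"
      by (simp add: power_mult_distrib algebra_simps)
    finally have "sqrt (expectation ?D2 / ?c + (expectation ?D1)\<^sup>2 / ?c\<^sup>2) \<le> sqrt (?K * ?d\<^sup>2)"
      by (rule real_sqrt_le_mono)
    also have "\<dots> = sqrt ?K * ?d"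
      by (simp only: real_sqrt_mult real_sqrt_abs) simp
    finally show ?thesis
      using L.hellinger_le_lipschitz[OF \<nu>[unfolded posterior_def] int2] by (simp add: posterior_def)
  qed
  then show ?thesis by blast
qed

end

text \<open>For exponents below one Minkowski's inequality is not available; comparing a sum with twice its
  larger term works for all exponents.\<close>

lemma integrable_powr_add:
  fixes a b :: "'u \<Rightarrow> real"
  assumes [measurable]: "a \<in> borel_measurable M" "b \<in> borel_measurable M"
    and nn: "\<And>u. u \<in> space M \<Longrightarrow> 0 \<le> a u" "\<And>u. u \<in> space M \<Longrightarrow> 0 \<le> b u" and s: "0 < s"
    and int: "integrable M (\<lambda>u. a u powr s)" "integrable M (\<lambda>u. b u powr s)"
  shows "integrable M (\<lambda>u. (a u + b u) powr s)"
proof (rule Bochner_Integration.integrable_bound)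
  show "integrable M (\<lambda>u. 2 powr s * (a u powr s + b u powr s))" using int by simp
  show "AE u in M. norm ((a u + b u) powr s) \<le> norm (2 powr s * (a u powr s + b u powr s))"
  proof (rule AE_I2)
    fix u assume u: "u \<in> space M"
    have "(a u + b u) powr s \<le> (2 * max (a u) (b u)) powr s"
      using nn[OF u] s by (intro powr_mono2) auto
    also have "\<dots> = 2 powr s * max (a u) (b u) powr s"
      by (rule powr_mult)
    also have "max (a u) (b u) powr s \<le> a u powr s + b u powr s"
      by (auto simp: max_def)
    finally show "norm ((a u + b u) powr s) \<le> norm (2 powr s * (a u powr s + b u powr s))"
      by simp
  qed
qed measurable

lemma integrable_powr_sum:
  fixes a :: "'i \<Rightarrow> 'u \<Rightarrow> real"
  assumes "finite I" and "\<And>i. i \<in> I \<Longrightarrow> a i \<in> borel_measurable M"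
    and "\<And>i u. i \<in> I \<Longrightarrow> u \<in> space M \<Longrightarrow> 0 \<le> a i u" and s: "0 < s"
    and "\<And>i. i \<in> I \<Longrightarrow> integrable M (\<lambda>u. a i u powr s)"
  shows "integrable M (\<lambda>u. (\<Sum>i\<in>I. a i u) powr s)"
  using assms(1-3,5)
proof (induction I rule: finite_induct)
  case empty
  then show ?case using s by simp
next
  case (insert i I)
  have "integrable M (\<lambda>u. (a i u + (\<Sum>i\<in>I. a i u)) powr s)"
    by (intro integrable_powr_add s insert.IH borel_measurable_sum sum_nonneg) (use insert.prems in auto)
  then show ?case using insert.hyps by simp
qed

section \<open>Priors\<close>

definition positive_laws :: "nat \<Rightarrow> (nat \<Rightarrow> real measure) \<Rightarrow> bool" where
  "positive_laws n P \<longleftrightarrow>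
     (\<forall>i\<in>{1..n}. prob_space (P i) \<and> sets (P i) = sets borel \<and> (AE t in P i. 0 < t))"

definition inverse_moment :: "real \<Rightarrow> nat \<Rightarrow> (nat \<Rightarrow> real measure) \<Rightarrow> bool" where
  "inverse_moment s n P \<longleftrightarrow> (\<forall>i\<in>{1..n}. integrable (P i) (\<lambda>t. t powr - s))"

text \<open>This links the product \<open>\<sigma>\<close>-algebra of extensional functions with the topology of pointwise
  convergence on all functions: coordinates off the index set are constant.\<close>

lemma measurable_PiM_borel:
  fixes P :: "'i::countable \<Rightarrow> real measure"
  assumes "\<And>i. i \<in> I \<Longrightarrow> sets (P i) = sets borel"
  shows "(\<lambda>x. x) \<in> PiM I P \<rightarrow>\<^sub>M borel"
proof (rule measurable_coordinatewise_then_product)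
  fix i
  show "(\<lambda>x. x i) \<in> borel_measurable (PiM I P)"
  proof (cases "i \<in> I")
    case True
    then have "(\<lambda>x. x i) \<in> PiM I P \<rightarrow>\<^sub>M P i" by simp
    then show ?thesis
      using assms[OF True] by (simp cong: measurable_cong_sets)
  next
    case False
    then have "(\<lambda>x. x i) \<in> borel_measurable (PiM I P) \<longleftrightarrow> (\<lambda>x. undefined :: real) \<in> borel_measurable (PiM I P)"
      by (intro measurable_cong) (auto simp: space_PiM PiE_def extensional_def)
    then show ?thesis by simp
  qed
qed

locale prior_setting =
  fixes M :: "'g::{second_countable_topology, t2_space} measure" and Ug :: "'g set" and n :: nat
    and P :: "nat \<Rightarrow> real measure"
  assumes Ug: "Ug \<in> sets M" "emeasure M Ug \<noteq> 0" "emeasure M Ug \<noteq> \<infinity>"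
    and M_borel: "(\<lambda>g. g) \<in> M \<rightarrow>\<^sub>M borel"
    and laws: "positive_laws n P"
begin

abbreviation geometry where "geometry \<equiv> uniform_measure M Ug"
abbreviation permeabilities where "permeabilities \<equiv> PiM {1..n} P"

lemma law:
  assumes "i \<in> {1..n}"
  shows "prob_space (P i)" "sets (P i) = sets borel" "AE t in P i. 0 < t"
  using assms laws by (auto simp: positive_laws_def)

sublocale geometry: prob_space geometry
  by (rule prob_space_uniform_measure) (use Ug in auto)

sublocale permeabilities: prob_space permeabilities
  by (rule prob_space_PiM) (use law in auto)

lemma parameters_sets: "parameters Ug n \<in> sets (geometry \<Otimes>\<^sub>M permeabilities)"
proof -
  have "({1..n} \<rightarrow>\<^sub>E {0<..}) \<in> sets permeabilities"
    by (rule sets_PiM_I_finite) (use law(2) in auto)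
  then show ?thesis
    using Ug(1) by (intro pair_measureI) auto
qed

lemma emeasure_parameters: "emeasure (geometry \<Otimes>\<^sub>M permeabilities) (parameters Ug n) = 1"
proof -
  have V: "({1..n} \<rightarrow>\<^sub>E {0<..}) \<in> sets permeabilities"
    by (rule sets_PiM_I_finite) (use law(2) in auto)
  have "AE x in permeabilities. \<forall>i\<in>{1..n}. 0 < x i"
    by (intro AE_finite_allI AE_PiM_component) (use law in auto)
  with AE_space have "AE x in permeabilities. x \<in> {1..n} \<rightarrow>\<^sub>E {0<..}"
    by eventually_elim (auto simp: space_PiM PiE_def)
  then have "emeasure permeabilities ({1..n} \<rightarrow>\<^sub>E {0<..}) = 1"
    using V by (intro permeabilities.emeasure_eq_1_AE)
  moreover have "emeasure geometry Ug = 1"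
    using Ug by (auto simp: emeasure_uniform_measure less_top ennreal_divide_self)
  ultimately show ?thesis
    using V Ug(1) by (subst permeabilities.emeasure_pair_measure_Times) auto
qed

lemma prob_space_prior: "prob_space (prior M Ug n P)"
  unfolding prior_def by (rule prob_space_restrict_space[OF parameters_sets emeasure_parameters])

lemma space_prior: "space (prior M Ug n P) \<subseteq> parameters Ug n"
  by (auto simp: prior_def space_restrict_space)

text \<open>This is how continuity of the forward map yields its measurability.\<close>

lemma continuous_on_measurable_prior:
  fixes F :: "'g \<times> (nat \<Rightarrow> real) \<Rightarrow> 'b::topological_space"
  assumes "continuous_on (parameters Ug n) F"
  shows "F \<in> borel_measurable (prior M Ug n P)"
proof -
  have "(\<lambda>u. (fst u, snd u)) \<in> borel_measurable (geometry \<Otimes>\<^sub>M permeabilities)"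
  proof (rule borel_measurable_Pair)
    have "(\<lambda>g. g) \<in> geometry \<rightarrow>\<^sub>M borel"
      using M_borel by (simp cong: measurable_cong_sets)
    then show "fst \<in> borel_measurable (geometry \<Otimes>\<^sub>M permeabilities)"
      by (rule measurable_compose[OF measurable_fst])
    have "(\<lambda>x. x) \<in> permeabilities \<rightarrow>\<^sub>M borel"
      by (rule measurable_PiM_borel) (use law(2) in auto)
    then show "snd \<in> borel_measurable (geometry \<Otimes>\<^sub>M permeabilities)"
      by (rule measurable_compose[OF measurable_snd])
  qed
  then have "(\<lambda>u. u) \<in> prior M Ug n P \<rightarrow>\<^sub>M restrict_space borel (parameters Ug n)"
    unfolding prior_def by (intro measurable_restrict_space3) auto
  moreover have "F \<in> borel_measurable (restrict_space borel (parameters Ug n))"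
    by (rule borel_measurable_continuous_on_restrict[OF assms])
  ultimately show ?thesis
    by (rule measurable_compose)
qed

text \<open>The \<open>i\<close>-th permeability has law \<open>P i\<close> under the product measure.\<close>

lemma integrable_inverse_powr_prior:
  assumes i: "i \<in> {1..n}" and moment: "inverse_moment s n P"
  shows "integrable (prior M Ug n P) (\<lambda>u. (1 / snd u i) powr s)"
proof -
  have comp: "(\<lambda>u. snd u i) \<in> (geometry \<Otimes>\<^sub>M permeabilities) \<rightarrow>\<^sub>M P i"
    using measurable_compose[OF measurable_snd measurable_component_singleton[OF i]] .
  have "distr (geometry \<Otimes>\<^sub>M permeabilities) (P i) (\<lambda>u. snd u i) = P i"
  proof -
    have "distr (geometry \<Otimes>\<^sub>M permeabilities) (P i) (\<lambda>u. snd u i)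
        = distr (distr (geometry \<Otimes>\<^sub>M permeabilities) permeabilities snd) (P i) (\<lambda>x. x i)"
      by (subst distr_distr) (use i in \<open>auto simp: o_def\<close>)
    also have "distr (geometry \<Otimes>\<^sub>M permeabilities) permeabilities snd = permeabilities"
    proof (rule measure_eqI)
      fix A assume "A \<in> sets (distr (geometry \<Otimes>\<^sub>M permeabilities) permeabilities snd)"
      then have A: "A \<in> sets permeabilities" by simp
      have "snd -` A \<inter> space (geometry \<Otimes>\<^sub>M permeabilities) = space geometry \<times> A"
        using sets.sets_into_space[OF A] by (auto simp: space_pair_measure)
      then have "emeasure (distr (geometry \<Otimes>\<^sub>M permeabilities) permeabilities snd) A
          = emeasure (geometry \<Otimes>\<^sub>M permeabilities) (space geometry \<times> A)"
        using A by (subst emeasure_distr) auto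
      also have "\<dots> = emeasure geometry (space geometry) * emeasure permeabilities A"
        by (rule permeabilities.emeasure_pair_measure_Times[OF sets.top A])
      finally show "emeasure (distr (geometry \<Otimes>\<^sub>M permeabilities) permeabilities snd) A = emeasure permeabilities A"
        by (simp only: geometry.emeasure_space_1 mult_1)
    qed simp
    also have "distr permeabilities (P i) (\<lambda>x. x i) = P i"
      by (rule distr_PiM_component) (use law i in auto)
    finally show ?thesis .
  qed
  moreover have "integrable (P i) (\<lambda>t. t powr - s)"
    using moment i by (simp add: inverse_moment_def)
  ultimately have "integrable (distr (geometry \<Otimes>\<^sub>M permeabilities) (P i) (\<lambda>u. snd u i)) (\<lambda>t. t powr - s)"
    by simp
  then have "integrable (geometry \<Otimes>\<^sub>M permeabilities) (\<lambda>u. snd u i powr - s)"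
    by (rule integrable_distr[OF comp])
  then have "integrable (prior M Ug n P) (\<lambda>u. snd u i powr - s)"
    unfolding prior_def integrable_restrict_space[OF sets.Int[OF parameters_sets sets.top]]
    by (rule integrable_mult_indicator[OF parameters_sets])
  moreover have "snd u i powr - s = (1 / snd u i) powr s" if "u \<in> space (prior M Ug n P)" for u
  proof -
    have "0 < snd u i"
      using space_prior that i by (auto simp: PiE_def Pi_def)
    then show ?thesis by (simp add: powr_divide powr_minus_divide)
  qed
  ultimately show ?thesis
    by (subst (asm) Bochner_Integration.integrable_cong[OF refl]) auto
qed

end

locale inverse_problem = prior_setting +
  fixes f :: "(point \<Rightarrow> real) \<Rightarrow> real" and l :: "'j::finite \<Rightarrow> (point \<Rightarrow> real) \<Rightarrow> real"
    and R :: "'a::{second_countable_topology, t2_space} \<Rightarrow> nat \<Rightarrow> point set" and \<Gamma> :: "real ^ 'j ^ 'j"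
  assumes f: "f \<in> V_dual" and l: "\<And>j. l j \<in> V_dual" and R: "stable_regions n Ug R" and n: "1 \<le> n"
begin

sublocale bayesian_model "prior M Ug n P" "forward_map f l n R" \<Gamma>
proof (intro bayesian_model.intro prob_space_prior bayesian_model_axioms.intro)
  show "forward_map f l n R \<in> borel_measurable (prior M Ug n P)"
    by (rule continuous_on_measurable_prior[OF forward_map_continuous[OF f l R n]])
qed

text \<open>The envelope is at most a constant plus a multiple of the sum of the inverse permeabilities.\<close>

lemma envelope_moment:
  assumes r: "0 < r" and s: "0 < s" and moment: "inverse_moment s n P"
  shows "integrable (prior M Ug n P) (\<lambda>u. envelope r u powr s)"
proof -
  let ?\<mu> = "prior M Ug n P" and ?S = "\<lambda>u. \<Sum>i=1..n. 1 / snd u i"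
  obtain K where K: "0 \<le> K"
    "\<And>u. u \<in> parameters Ug n \<Longrightarrow> norm (forward_map f l n R u :: real ^ 'j) \<le> K * ?S u"
    using forward_map_bound[of f l n Ug R] f l R n by blast
  define k where "k = onorm ((*v) (inv_sqrt_matrix \<Gamma>)) * K"
  have onorm_nonneg: "0 \<le> onorm ((*v) (inv_sqrt_matrix \<Gamma>))"
    by (rule onorm_pos_le[OF matrix_vector_mul_bounded_linear])
  then have k: "0 \<le> k"
    unfolding k_def using K(1) by (rule mult_nonneg_nonneg)
  have pos: "0 < snd u i" if "u \<in> space ?\<mu>" "i \<in> {1..n}" for u i
    using space_prior that by (auto simp: PiE_def Pi_def)
  have coord [measurable]: "(\<lambda>u. snd u i) \<in> borel_measurable ?\<mu>" for i
  proof -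
    have "continuous_on UNIV (\<lambda>u::'a \<times> (nat \<Rightarrow> real). snd u i)"
      by (rule continuous_on_compose2[OF continuous_on_product_coordinates continuous_on_snd[OF continuous_on_id]]) simp
    then show ?thesis
      by (intro continuous_on_measurable_prior) (rule continuous_on_subset[OF _ subset_UNIV])
  qed
  have "integrable ?\<mu> (\<lambda>u. ?S u powr s)"
    by (intro integrable_powr_sum s integrable_inverse_powr_prior moment)
      (use pos in \<open>auto simp: less_imp_le\<close>)
  then have "integrable ?\<mu> (\<lambda>u. k powr s * ?S u powr s)" by simp
  then have "integrable ?\<mu> (\<lambda>u. (k * ?S u) powr s)"
    by (simp add: powr_mult)
  then have int: "integrable ?\<mu> (\<lambda>u. (r + k * ?S u) powr s)"
    using r s pos k
    by (intro integrable_powr_add) (auto intro!: mult_nonneg_nonneg sum_nonneg simp: less_imp_le)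
  show ?thesis
  proof (rule Bochner_Integration.integrable_bound[OF int])
    show "AE u in ?\<mu>. norm (envelope r u powr s) \<le> norm ((r + k * ?S u) powr s)"
    proof (rule AE_I2)
      fix u assume "u \<in> space ?\<mu>"
      then have "u \<in> parameters Ug n" using space_prior by auto
      have "noise_norm \<Gamma> (forward_map f l n R u) \<le> onorm ((*v) (inv_sqrt_matrix \<Gamma>)) * norm (forward_map f l n R u)"
        by (rule noise_norm_le)
      also have "\<dots> \<le> k * ?S u"
        unfolding k_def mult.assoc
        using K(2)[OF \<open>u \<in> parameters Ug n\<close>] onorm_nonneg
        by (rule mult_left_mono)
      finally have "envelope r u powr s \<le> (r + k * ?S u) powr s"
        using r s by (intro powr_mono2) (auto simp: envelope_def)
      then show "norm (envelope r u powr s) \<le> norm ((r + k * ?S u) powr s)" by simp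
    qed
  qed measurable
qed

lemma posterior_lipschitz_dependence:
  assumes m: "inverse_moment 1 n P" "inverse_moment 2 n P" and r: "0 < r"
  shows "\<exists>C1 C2. \<forall>y y'. max (noise_norm \<Gamma> y) (noise_norm \<Gamma> y') < r \<longrightarrow>
    (\<forall>\<nu>\<in>dominating (posterior (prior M Ug n P) (misfit \<Gamma> (forward_map f l n R)) y)
                    (posterior (prior M Ug n P) (misfit \<Gamma> (forward_map f l n R)) y').
      tv_dist \<nu> (posterior (prior M Ug n P) (misfit \<Gamma> (forward_map f l n R)) y)
                (posterior (prior M Ug n P) (misfit \<Gamma> (forward_map f l n R)) y')
        \<le> C1 * noise_norm \<Gamma> (y - y') \<and>
      hellinger_dist \<nu> (posterior (prior M Ug n P) (misfit \<Gamma> (forward_map f l n R)) y)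
                       (posterior (prior M Ug n P) (misfit \<Gamma> (forward_map f l n R)) y')
        \<le> C2 * noise_norm \<Gamma> (y - y'))"
proof -
  have i1: "integrable (prior M Ug n P) (\<lambda>u. envelope r u powr 1)"
    by (rule envelope_moment[OF r _ m(1)]) simp
  have "integrable (prior M Ug n P) (\<lambda>u. envelope r u powr 2)"
    by (rule envelope_moment[OF r _ m(2)]) simp
  then have i2: "integrable (prior M Ug n P) (\<lambda>u. (envelope r u)\<^sup>2)"
    using envelope_nonneg[OF r] by simp
  have i1': "integrable (prior M Ug n P) (envelope r)"
    using i1 envelope_nonneg[OF r] by simp
  let ?post = "posterior (prior M Ug n P) (misfit \<Gamma> (forward_map f l n R))"
  obtain C1 where C1: "\<And>y y' \<nu>. max (noise_norm \<Gamma> y) (noise_norm \<Gamma> y') < r \<Longrightarrow>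
      \<nu> \<in> dominating (?post y) (?post y') \<Longrightarrow>
      tv_dist \<nu> (?post y) (?post y') \<le> C1 * noise_norm \<Gamma> (y - y') powr 1"
    using posterior_hoelder[OF r zero_less_one order_refl i1] by blast
  obtain C2 where C2: "\<And>y y' \<nu>. max (noise_norm \<Gamma> y) (noise_norm \<Gamma> y') < r \<Longrightarrow>
      \<nu> \<in> dominating (?post y) (?post y') \<Longrightarrow>
      hellinger_dist \<nu> (?post y) (?post y') \<le> C2 * noise_norm \<Gamma> (y - y')"
    using posterior_hellinger_lipschitz[OF r i1' i2] by blast
  have "noise_norm \<Gamma> v powr 1 = noise_norm \<Gamma> v" for v by simp
  with C1 C2 show ?thesis by metis
qed

lemma posterior_hoelder_dependence:
  assumes m: "inverse_moment \<iota> n P" and \<iota>: "0 < \<iota>" "\<iota> < 1" and r: "0 < r"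
  shows "\<exists>K1 K2. \<forall>y y'. max (noise_norm \<Gamma> y) (noise_norm \<Gamma> y') < r \<longrightarrow>
    (\<forall>\<nu>\<in>dominating (posterior (prior M Ug n P) (misfit \<Gamma> (forward_map f l n R)) y)
                    (posterior (prior M Ug n P) (misfit \<Gamma> (forward_map f l n R)) y').
      tv_dist \<nu> (posterior (prior M Ug n P) (misfit \<Gamma> (forward_map f l n R)) y)
                (posterior (prior M Ug n P) (misfit \<Gamma> (forward_map f l n R)) y')
        \<le> K1 * noise_norm \<Gamma> (y - y') powr \<iota> \<and>
      hellinger_dist \<nu> (posterior (prior M Ug n P) (misfit \<Gamma> (forward_map f l n R)) y)
                       (posterior (prior M Ug n P) (misfit \<Gamma> (forward_map f l n R)) y')
        \<le> K2 * noise_norm \<Gamma> (y - y') powr (\<iota> / 2))"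
  using posterior_hoelder[OF r \<iota>(1) less_imp_le[OF \<iota>(2)] envelope_moment[OF r \<iota>(1) m]] by blast

end

text \<open>Permeabilities bounded away from zero have bounded negative powers.\<close>

lemma uniform_laws_inverse_moments:
  assumes "uniform_laws n P"
  shows "positive_laws n P" "0 < s \<Longrightarrow> inverse_moment s n P"
proof -
  obtain lo hi where P: "\<And>i. i \<in> {1..n} \<Longrightarrow> 0 < lo i \<and> lo i < hi i \<and> P i = uniform_measure lborel {lo i..hi i}"
    using assms unfolding uniform_laws_def by blast
  have prob: "prob_space (P i)" and AE: "AE t in P i. lo i \<le> t" if "i \<in> {1..n}" for i
  proof -
    have eq: "P i = uniform_measure lborel {lo i..hi i}" using P[OF that] by simp
    have "emeasure lborel {lo i..hi i} \<noteq> 0" "emeasure lborel {lo i..hi i} \<noteq> \<infinity>"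
      using P[OF that] by auto
    then show "prob_space (P i)"
      unfolding eq by (rule prob_space_uniform_measure)
    show "AE t in P i. lo i \<le> t"
      unfolding eq by (rule AE_uniform_measureI) auto
  qed
  show "positive_laws n P"
    unfolding positive_laws_def
  proof (intro ballI conjI prob)
    fix i assume i: "i \<in> {1..n}"
    show "sets (P i) = sets borel" using P[OF i] by simp
    show "AE t in P i. 0 < t"
      using AE[OF i] by eventually_elim (use P[OF i] in linarith)
  qed
  show "inverse_moment s n P" if "0 < s"
    unfolding inverse_moment_def
  proof
    fix i assume i: "i \<in> {1..n}"
    interpret prob_space "P i" by (rule prob[OF i])
    show "integrable (P i) (\<lambda>t. t powr - s)"
    proof (rule integrable_const_bound[of _ "lo i powr - s"])
      show "AE t in P i. norm (t powr - s) \<le> lo i powr - s"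
        using AE[OF i] by eventually_elim (use P[OF i] that in \<open>auto intro!: powr_mono2'\<close>)
      show "(\<lambda>t. t powr - s) \<in> borel_measurable (P i)"
        using P[OF i] by simp
    qed
  qed
qed

text \<open>Completing the square: an exponential tilt of a normal density is a multiple of a shifted one.\<close>

lemma normal_density_exp_tilt:
  assumes "0 < \<sigma>"
  shows "normal_density m \<sigma> x * exp (- s * x)
    = exp (s\<^sup>2 * \<sigma>\<^sup>2 / 2 - s * m) * normal_density (m - s * \<sigma>\<^sup>2) \<sigma> x"
proof -
  have "- (x - m)\<^sup>2 / (2 * \<sigma>\<^sup>2) + (- s * x)
      = (s\<^sup>2 * \<sigma>\<^sup>2 / 2 - s * m) + - (x - (m - s * \<sigma>\<^sup>2))\<^sup>2 / (2 * \<sigma>\<^sup>2)"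
    using assms by (simp add: field_simps power2_eq_square)
  then have "exp (- (x - m)\<^sup>2 / (2 * \<sigma>\<^sup>2)) * exp (- s * x)
      = exp (s\<^sup>2 * \<sigma>\<^sup>2 / 2 - s * m) * exp (- (x - (m - s * \<sigma>\<^sup>2))\<^sup>2 / (2 * \<sigma>\<^sup>2))"
    by (simp only: exp_add[symmetric])
  then show ?thesis
    by (simp add: normal_density_def)
qed

text \<open>Negative powers of a lognormal variable are exponentials of a normal variable.\<close>

lemma lognormal_laws_inverse_moments:
  assumes "lognormal_laws n P"
  shows "positive_laws n P" "inverse_moment s n P"
proof -
  obtain m \<sigma> where P: "\<And>i. i \<in> {1..n} \<Longrightarrow> 0 < \<sigma> i \<and>
      P i = distr (density lborel (\<lambda>t. ennreal (normal_density (m i) (\<sigma> i) t))) borel exp"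
    using assms unfolding lognormal_laws_def by blast
  show "positive_laws n P"
    unfolding positive_laws_def
  proof (intro ballI conjI)
    fix i assume i: "i \<in> {1..n}"
    interpret prob_space "density lborel (\<lambda>t. ennreal (normal_density (m i) (\<sigma> i) t))"
      using P[OF i] by (intro prob_space_normal_density) simp
    show "prob_space (P i)"
      using P[OF i] by (auto intro!: prob_space_distr)
    show "sets (P i) = sets borel" using P[OF i] by simp
    have eq: "P i = distr (density lborel (\<lambda>t. ennreal (normal_density (m i) (\<sigma> i) t))) borel exp"
      using P[OF i] by simp
    show "AE t in P i. 0 < t"
      unfolding eq by (subst AE_distr_iff) auto
  qed
  show "inverse_moment s n P"
    unfolding inverse_moment_def
  proof
    fix i assume i: "i \<in> {1..n}"
    have "integrable lborel (\<lambda>x. exp (s\<^sup>2 * (\<sigma> i)\<^sup>2 / 2 - s * m i) * normal_density (m i - s * (\<sigma> i)\<^sup>2) (\<sigma> i) x)"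
      using P[OF i] by simp
    then have "integrable lborel (\<lambda>x. normal_density (m i) (\<sigma> i) x * exp (- s * x))"
      using P[OF i] by (simp only: normal_density_exp_tilt)
    then have "integrable lborel (\<lambda>x. normal_density (m i) (\<sigma> i) x *\<^sub>R exp x powr - s)"
      by (simp add: powr_def)
    then have "integrable (density lborel (\<lambda>t. ennreal (normal_density (m i) (\<sigma> i) t))) (\<lambda>x. exp x powr - s)"
      by (subst integrable_density) auto
    then show "integrable (P i) (\<lambda>t. t powr - s)"
      using P[OF i] by (simp add: integrable_distr_eq)
  qed
qed

text \<open>The integral is that of the Gamma function at \<open>1 - s\<close>.\<close>

lemma integrable_powr_exp:
  assumes a: "0 < a" and s: "s < 1"
  shows "integrable lborel (\<lambda>t::real. indicator {0<..} t * (t powr - s * exp (- (a * t))))"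
proof -
  have "(\<lambda>t. complex_of_real t powr (complex_of_real (1 - s) - 1) / of_real (exp (a * t))) absolutely_integrable_on {0<..}"
    using s a by (intro absolutely_integrable_Gamma_integral) auto
  then have "integrable lebesgue (\<lambda>t. norm (indicator {0<..} t *\<^sub>R
      (complex_of_real t powr (complex_of_real (1 - s) - 1) / of_real (exp (a * t)))))"
    unfolding set_integrable_def by (rule integrable_norm)
  also have "(\<lambda>t. norm (indicator {0<..} t *\<^sub>R
      (complex_of_real t powr (complex_of_real (1 - s) - 1) / of_real (exp (a * t)))))
      = (\<lambda>t. indicator {0<..} t * (t powr - s * exp (- (a * t))))"
    by (auto simp: fun_eq_iff indicator_def norm_mult norm_inverse norm_powr_real_powr exp_minus divide_inverse)
  finally show ?thesis
    by (subst (asm) integrable_completion) auto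
qed

lemma exponential_laws_inverse_moments:
  assumes "exponential_laws n P"
  shows "positive_laws n P" "s < 1 \<Longrightarrow> inverse_moment s n P"
proof -
  obtain a where P: "\<And>i. i \<in> {1..n} \<Longrightarrow> 0 < a i \<and>
      P i = density lborel (\<lambda>t. ennreal (exponential_density (a i) t))"
    using assms unfolding exponential_laws_def by blast
  show "positive_laws n P"
    unfolding positive_laws_def
  proof (intro ballI conjI)
    fix i assume i: "i \<in> {1..n}"
    show "prob_space (P i)"
      using P[OF i] prob_space_exponential_density by simp
    show "sets (P i) = sets borel" using P[OF i] by simp
    have "AE t in lborel. 0 < ennreal (exponential_density (a i) t) \<longrightarrow> 0 < t"
      using AE_lborel_singleton[of "0::real"]
      by eventually_elim (auto simp: exponential_density_def split: if_splits)
    moreover have eq: "P i = density lborel (\<lambda>t. ennreal (exponential_density (a i) t))"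
      using P[OF i] by simp
    ultimately show "AE t in P i. 0 < t"
      unfolding eq by (subst AE_density) auto
  qed
  show "inverse_moment s n P" if s: "s < 1"
    unfolding inverse_moment_def
  proof
    fix i assume i: "i \<in> {1..n}"
    have a: "0 < a i" using P[OF i] by simp
    have "integrable lborel (\<lambda>t. a i * (indicator {0<..} t * (t powr - s * exp (- (a i * t)))))"
      using integrable_powr_exp[OF a s] by simp
    also have "(\<lambda>t. a i * (indicator {0<..} t * (t powr - s * exp (- (a i * t)))))
        = (\<lambda>t. exponential_density (a i) t *\<^sub>R t powr - s)"
      by (auto simp: fun_eq_iff indicator_def exponential_density_def mult.commute)
    finally have "integrable (density lborel (\<lambda>t. ennreal (exponential_density (a i) t))) (\<lambda>t. t powr - s)"
      using a by (subst integrable_density) (auto simp: exponential_density_nonneg)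
    then show "integrable (P i) (\<lambda>t. t powr - s)"
      using P[OF i] by simp
  qed
qed

interpretation lborel_family: product_sigma_finite "\<lambda>_::nat. lborel :: real measure" ..

text \<open>The simplex lies between two cubes.\<close>

lemma thickness_set_measure:
  shows "thickness_set n \<in> sets (PiM {1..n-1} (\<lambda>_. lborel))" (is "_ \<in> sets ?M")
    and "emeasure (PiM {1..n-1} (\<lambda>_. lborel)) (thickness_set n) \<noteq> 0"
    and "emeasure (PiM {1..n-1} (\<lambda>_. lborel)) (thickness_set n) \<noteq> \<infinity>"
proof -
  let ?I = "{1..n-1}"
  have "thickness_set n = {x \<in> space ?M. (\<forall>i\<in>?I. 0 \<le> x i) \<and> (\<Sum>i\<in>?I. x i) \<le> 1}"
    by (auto simp: thickness_set_def space_PiM PiE_def Pi_def)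
  also have "\<dots> \<in> sets ?M" by measurable
  finally show sets: "thickness_set n \<in> sets ?M" .
  have "thickness_set n \<subseteq> (\<Pi>\<^sub>E i\<in>?I. {0..1})"
  proof
    fix x assume x: "x \<in> thickness_set n"
    have "x i \<le> 1" if "i \<in> ?I" for i
      using x member_le_sum[of i ?I x] that by (auto simp: thickness_set_def PiE_def Pi_def)
    then show "x \<in> (\<Pi>\<^sub>E i\<in>?I. {0..1})"
      using x by (auto simp: thickness_set_def PiE_def Pi_def)
  qed
  then have "emeasure ?M (thickness_set n) \<le> emeasure ?M (\<Pi>\<^sub>E i\<in>?I. {0..1})"
    by (rule emeasure_mono) (rule sets_PiM_I_finite, auto)
  also have "\<dots> = 1"
    by (subst lborel_family.emeasure_PiM) auto
  finally show "emeasure ?M (thickness_set n) \<noteq> \<infinity>"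
    by (auto simp: top_unique)
  let ?d = "1 / real (n - 1 + 1)"
  have "(\<Pi>\<^sub>E i\<in>?I. {0..?d}) \<subseteq> thickness_set n"
  proof
    fix x assume x: "x \<in> (\<Pi>\<^sub>E i\<in>?I. {0..?d})"
    have "(\<Sum>i\<in>?I. x i) \<le> (\<Sum>i\<in>?I. ?d)"
      using x by (intro sum_mono) (auto simp: PiE_def Pi_def)
    also have "\<dots> \<le> 1" by (simp add: field_simps)
    finally show "x \<in> thickness_set n"
      using x by (auto simp: thickness_set_def PiE_def Pi_def)
  qed
  then have "emeasure ?M (\<Pi>\<^sub>E i\<in>?I. {0..?d}) \<le> emeasure ?M (thickness_set n)"
    by (rule emeasure_mono) (rule sets)
  moreover have "emeasure ?M (\<Pi>\<^sub>E i\<in>?I. {0..?d}) = (\<Prod>i\<in>?I. ennreal ?d)"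
    by (subst lborel_family.emeasure_PiM) auto
  moreover have "(\<Prod>i\<in>?I. ennreal ?d) \<noteq> 0"
    by (subst prod_ennreal) (auto simp: ennreal_eq_0_iff not_le)
  ultimately show "emeasure ?M (thickness_set n) \<noteq> 0"
    by auto
qed

lemma layer_prior_setting:
  assumes c: "0 < cmax" and laws: "positive_laws n P"
  shows "prior_setting (PiM {1..n-1} (\<lambda>_. lborel) \<Otimes>\<^sub>M PiM {1..n-1} (\<lambda>_. lborel) \<Otimes>\<^sub>M lborel)
    (layer_parameters n cmax) n P"
proof
  let ?T = "PiM {1..n-1} (\<lambda>_. lborel :: real measure)"
  note T = thickness_set_measure[of n]
  interpret T: sigma_finite_measure ?T by (rule lborel_family.sigma_finite) simp
  interpret TL: pair_sigma_finite ?T "lborel :: real measure" ..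
  have m: "emeasure (?T \<Otimes>\<^sub>M ?T \<Otimes>\<^sub>M lborel) (layer_parameters n cmax)
      = emeasure ?T (thickness_set n) * (emeasure ?T (thickness_set n) * ennreal (2 * cmax))"
    unfolding layer_parameters_def
    using T(1) c
    by (subst TL.P.emeasure_pair_measure_Times, simp, simp, subst lborel.emeasure_pair_measure_Times) auto
  show "layer_parameters n cmax \<in> sets (?T \<Otimes>\<^sub>M ?T \<Otimes>\<^sub>M lborel)"
    unfolding layer_parameters_def using T(1) by (intro pair_measureI) auto
  show "emeasure (?T \<Otimes>\<^sub>M ?T \<Otimes>\<^sub>M lborel) (layer_parameters n cmax) \<noteq> 0"
    unfolding m using T(2) c by (simp add: ennreal_eq_0_iff)
  show "emeasure (?T \<Otimes>\<^sub>M ?T \<Otimes>\<^sub>M lborel) (layer_parameters n cmax) \<noteq> \<infinity>"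
    unfolding m using T(3) by (simp add: ennreal_mult_eq_top_iff)
  have id_T: "(\<lambda>x. x) \<in> ?T \<rightarrow>\<^sub>M borel"
    by (rule measurable_PiM_borel) simp
  have "(\<lambda>g. (fst g, fst (snd g), snd (snd g))) \<in> borel_measurable (?T \<Otimes>\<^sub>M ?T \<Otimes>\<^sub>M (lborel :: real measure))"
  proof (intro borel_measurable_Pair)
    show "fst \<in> borel_measurable (?T \<Otimes>\<^sub>M ?T \<Otimes>\<^sub>M (lborel :: real measure))"
      by (rule measurable_compose[OF measurable_fst id_T])
    show "(\<lambda>g. fst (snd g)) \<in> borel_measurable (?T \<Otimes>\<^sub>M ?T \<Otimes>\<^sub>M (lborel :: real measure))"
      by (rule measurable_compose[OF measurable_compose[OF measurable_snd measurable_fst] id_T])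
    show "(\<lambda>g. snd (snd g)) \<in> borel_measurable (?T \<Otimes>\<^sub>M ?T \<Otimes>\<^sub>M (lborel :: real measure))"
      by measurable
  qed
  then show "(\<lambda>g. g) \<in> (?T \<Otimes>\<^sub>M ?T \<Otimes>\<^sub>M (lborel :: real measure)) \<rightarrow>\<^sub>M borel" by simp
qed (rule laws)

lemma channel_prior_setting:
  assumes d: "\<forall>i\<in>{1..5}. dlo i < dhi i" and laws: "positive_laws 2 P"
  shows "prior_setting (PiM {1..5} (\<lambda>_. lborel)) (channel_parameters dlo dhi) 2 P"
proof
  let ?M = "PiM {1..5::nat} (\<lambda>_. lborel :: real measure)"
  show "channel_parameters dlo dhi \<in> sets ?M"
    unfolding channel_parameters_def by (rule sets_PiM_I_finite) auto
  have m: "emeasure ?M (channel_parameters dlo dhi) = (\<Prod>i\<in>{1..5}. ennreal (dhi i - dlo i))"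
    unfolding channel_parameters_def using d
    by (subst lborel_family.emeasure_PiM) (auto intro!: prod.cong simp: less_imp_le)
  show "emeasure ?M (channel_parameters dlo dhi) \<noteq> 0"
    unfolding m using d
    by (subst prod_ennreal) (auto simp: ennreal_eq_0_iff not_le less_imp_le intro!: prod_pos)
  show "emeasure ?M (channel_parameters dlo dhi) \<noteq> \<infinity>"
    unfolding m using d by (subst prod_ennreal) (auto simp: less_imp_le)
  show "(\<lambda>g. g) \<in> ?M \<rightarrow>\<^sub>M borel"
    by (rule measurable_PiM_borel) simp
qed (rule laws)


lemma lognormal_or_uniform_inverse_moments:
  assumes "lognormal_laws n P \<or> uniform_laws n P"
  shows "positive_laws n P" "inverse_moment 1 n P" "inverse_moment 2 n P"
  using assms lognormal_laws_inverse_moments[of n P] uniform_laws_inverse_moments[of n P] by auto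

theorem theorem3p5:
  fixes f :: "(point \<Rightarrow> real) \<Rightarrow> real"
    and l :: "'j::finite \<Rightarrow> (point \<Rightarrow> real) \<Rightarrow> real"
    and \<Gamma> :: "real ^ 'j ^ 'j"
  assumes "f \<in> V_dual"
    and "\<And>j. l j \<in> V_dual"
    and "sym_pos_def \<Gamma>"
  shows
    "(\<forall>(n::nat) (cmax::real) (P :: nat \<Rightarrow> real measure). 2 \<le> n \<and> 0 < cmax \<longrightarrow>
        ((lognormal_laws n P \<or> uniform_laws n P) \<longrightarrow>
          (\<forall>r>0. \<exists>C1 C2. \<forall>y y'.
             max (noise_norm \<Gamma> y) (noise_norm \<Gamma> y') < r \<longrightarrow>
             (\<forall>\<nu>\<in>dominating (posterior (layer_prior n cmax P) (misfit \<Gamma> (forward_map f l n (layer_region n))) y)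
                             (posterior (layer_prior n cmax P) (misfit \<Gamma> (forward_map f l n (layer_region n))) y').
               tv_dist \<nu> (posterior (layer_prior n cmax P) (misfit \<Gamma> (forward_map f l n (layer_region n))) y)
                         (posterior (layer_prior n cmax P) (misfit \<Gamma> (forward_map f l n (layer_region n))) y')
                 \<le> C1 * noise_norm \<Gamma> (y - y') \<and>
               hellinger_dist \<nu> (posterior (layer_prior n cmax P) (misfit \<Gamma> (forward_map f l n (layer_region n))) y)
                                (posterior (layer_prior n cmax P) (misfit \<Gamma> (forward_map f l n (layer_region n))) y')
                 \<le> C2 * noise_norm \<Gamma> (y - y')))) \<and>
        (exponential_laws n P \<longrightarrow>
          (\<forall>r>0. \<forall>\<iota>\<in>{0<..<1}. \<exists>K1 K2. \<forall>y y'.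
             max (noise_norm \<Gamma> y) (noise_norm \<Gamma> y') < r \<longrightarrow>
             (\<forall>\<nu>\<in>dominating (posterior (layer_prior n cmax P) (misfit \<Gamma> (forward_map f l n (layer_region n))) y)
                             (posterior (layer_prior n cmax P) (misfit \<Gamma> (forward_map f l n (layer_region n))) y').
               tv_dist \<nu> (posterior (layer_prior n cmax P) (misfit \<Gamma> (forward_map f l n (layer_region n))) y)
                         (posterior (layer_prior n cmax P) (misfit \<Gamma> (forward_map f l n (layer_region n))) y')
                 \<le> K1 * noise_norm \<Gamma> (y - y') powr \<iota> \<and>
               hellinger_dist \<nu> (posterior (layer_prior n cmax P) (misfit \<Gamma> (forward_map f l n (layer_region n))) y)
                                (posterior (layer_prior n cmax P) (misfit \<Gamma> (forward_map f l n (layer_region n))) y')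
                 \<le> K2 * noise_norm \<Gamma> (y - y') powr (\<iota> / 2))))) \<and>
     (\<forall>(dlo :: nat \<Rightarrow> real) (dhi :: nat \<Rightarrow> real) (P :: nat \<Rightarrow> real measure).
        (\<forall>i\<in>{1..5}. dlo i < dhi i) \<and> - pi / 2 < dlo 3 \<and> dhi 3 < pi / 2 \<and> 0 \<le> dlo 5 \<longrightarrow>
        ((lognormal_laws 2 P \<or> uniform_laws 2 P) \<longrightarrow>
          (\<forall>r>0. \<exists>C1 C2. \<forall>y y'.
             max (noise_norm \<Gamma> y) (noise_norm \<Gamma> y') < r \<longrightarrow>
             (\<forall>\<nu>\<in>dominating (posterior (channel_prior dlo dhi P) (misfit \<Gamma> (forward_map f l 2 channel_region)) y)
                             (posterior (channel_prior dlo dhi P) (misfit \<Gamma> (forward_map f l 2 channel_region)) y').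
               tv_dist \<nu> (posterior (channel_prior dlo dhi P) (misfit \<Gamma> (forward_map f l 2 channel_region)) y)
                         (posterior (channel_prior dlo dhi P) (misfit \<Gamma> (forward_map f l 2 channel_region)) y')
                 \<le> C1 * noise_norm \<Gamma> (y - y') \<and>
               hellinger_dist \<nu> (posterior (channel_prior dlo dhi P) (misfit \<Gamma> (forward_map f l 2 channel_region)) y)
                                (posterior (channel_prior dlo dhi P) (misfit \<Gamma> (forward_map f l 2 channel_region)) y')
                 \<le> C2 * noise_norm \<Gamma> (y - y')))) \<and>
        (exponential_laws 2 P \<longrightarrow>
          (\<forall>r>0. \<forall>\<iota>\<in>{0<..<1}. \<exists>K1 K2. \<forall>y y'.
             max (noise_norm \<Gamma> y) (noise_norm \<Gamma> y') < r \<longrightarrow>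
             (\<forall>\<nu>\<in>dominating (posterior (channel_prior dlo dhi P) (misfit \<Gamma> (forward_map f l 2 channel_region)) y)
                             (posterior (channel_prior dlo dhi P) (misfit \<Gamma> (forward_map f l 2 channel_region)) y').
               tv_dist \<nu> (posterior (channel_prior dlo dhi P) (misfit \<Gamma> (forward_map f l 2 channel_region)) y)
                         (posterior (channel_prior dlo dhi P) (misfit \<Gamma> (forward_map f l 2 channel_region)) y')
                 \<le> K1 * noise_norm \<Gamma> (y - y') powr \<iota> \<and>
               hellinger_dist \<nu> (posterior (channel_prior dlo dhi P) (misfit \<Gamma> (forward_map f l 2 channel_region)) y)
                                (posterior (channel_prior dlo dhi P) (misfit \<Gamma> (forward_map f l 2 channel_region)) y')
                 \<le> K2 * noise_norm \<Gamma> (y - y') powr (\<iota> / 2)))))"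
proof -
  note f = assms(1) and l = assms(2)
  note laws = lognormal_or_uniform_inverse_moments and exp_laws = exponential_laws_inverse_moments
  have exp_moment: "inverse_moment \<iota> n P" if "\<iota> \<in> {0<..<1}" "exponential_laws n P" for \<iota> n P
    using exp_laws(2) that by simp
  have layer: "inverse_problem (PiM {1..n-1} (\<lambda>_. lborel) \<Otimes>\<^sub>M PiM {1..n-1} (\<lambda>_. lborel) \<Otimes>\<^sub>M lborel)
      (layer_parameters n cmax) n P f l (layer_region n)"
    if "2 \<le> n \<and> 0 < cmax" "positive_laws n P" for n cmax P
    using that
    by (intro inverse_problem.intro layer_prior_setting inverse_problem_axioms.intro f l layer_regions_stable) auto
  have channel: "inverse_problem (PiM {1..5} (\<lambda>_. lborel)) (channel_parameters dlo dhi) 2 P f l channel_region"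
    if "(\<forall>i\<in>{1..5}. dlo i < dhi i) \<and> - pi / 2 < dlo 3 \<and> dhi 3 < pi / 2 \<and> 0 \<le> dlo 5" "positive_laws 2 P"
    for dlo dhi P
    using that
    by (intro inverse_problem.intro channel_prior_setting inverse_problem_axioms.intro f l channel_regions_stable) auto
  show ?thesis
    unfolding layer_prior_def channel_prior_def
  proof (intro conjI allI impI ballI, goal_cases)
    case 1
    then show ?case
      by (intro inverse_problem.posterior_lipschitz_dependence[OF layer] laws)
  next
    case 2
    with exp_moment show ?case
      by (intro inverse_problem.posterior_hoelder_dependence[OF layer] exp_laws(1)) auto
  next
    case 3
    then show ?case
      by (intro inverse_problem.posterior_lipschitz_dependence[OF channel] laws)
  next
    case 4
    with exp_moment show ?case
      by (intro inverse_problem.posterior_hoelder_dependence[OF channel] exp_laws(1)) auto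
  qed
qed

end
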